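(* Let $(\Omega,\mathcal{F},\mathbb{P})$ be a complete probability space carrying a standard Brownian motion $(B_t)_{t\ge0}$ and an independent random variable $\theta$ with values in $\{-1,1\}$, $p=\mathbb{P}(\theta=1)$. Let $\mu>0$ and $c_0,c_1,c_2>0$ be constants, and let the observed process be $X_t=\mu\theta t+B_t$. Let $\mathbb{F}^X=(\mathcal{F}^X_t)_{t\ge0}$ be the completed right-continuous filtration generated by $X$, and let $M_t=\mathbb{E}(\theta\mid\mathcal{F}^X_t)$ be the posterior mean process (explicitly, $M_t = 1 - \frac{2(1-p)}{p e^{2\mu X_t}+1-p}$). A decision rule is a triple $\delta=(\tau_0,d,T)$, where $\tau_0$ is an $\mathbb{F}^X$-stopping time, $d$ is an $\mathcal{F}^X_{\tau_0}$-measurable random variable with values in $\{-1,1\}$, and $T=(\tau_1,\tau_2,\dots)$ is a sequence of $\mathbb{F}^X$-stopping times with $\tau_n\le\tau_{n+1}$ for all $n\ge0$ (possibly $\tau_n=+\infty$). Associate with $\delta$ the process \[ D_t^\delta=\begin{cases}0,& t<\tau_0,\\ d,& t\in[\tau_{2n},\tau_{2n+1}),\\ -d,& t\in[\tau_{2n+1},\tau_{2n+2}),\end{cases}\qquad n\ge 0, \] and the Bayesian risk \[ R(\delta)=\mathbb{E}\Bigl(c_0\tau_0+c_1\int_{\tau_0}^\infty \mathbf{1}(D^\delta_t\ne\theta)\,dt+c_2\sum_{t>\tau_0}\mathbf{1}(D^\delta_{t-}\ne D^\delta_t)\Bigr). \] Let $B\in(0,1)$ be the unique solution of $\ln\frac{1-B}{1+B}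 + \frac{2B}{1-B^2} = \frac{2\mu^2c_2}{c_1}$, and let $A\in(0,1)$ be the unique solution of $\bigl(\frac{c_1}{2c_0} -1\bigr) \ln\frac{1-A}{1+A} + \frac{2}{1+A}\bigl(\frac{c_1}{2c_0} + \frac{A}{1-A} \bigr) = \frac{c_1}{c_0(1-B^2)}$. Define $\delta^*=(\tau_0^*,d^*,T^* )$ by \[ \tau_0^*=\inf\{t\ge0: |M_t|\ge A\},\qquad d^*=\operatorname{sgn} M_{\tau_0^*}, \] and $T^*=(\tau^*_n)_{n\ge1}$ given, for $k\ge0$, on the event $\{d^*=1\}$ by \[ \tau^*_{2k+1}=\inf\{t\ge\tau^*_{2k}: M_t\le -B\},\qquad \tau^*_{2k+2}=\inf\{t\ge\tau^*_{2k+1}: M_t\ge B\}, \] and on the event $\{d^*=-1\}$ by \[ \tau^*_{2k+1}=\inf\{t\ge\tau^*_{2k}: M_t\ge B\},\qquad \tau^*_{2k+2}=\inf\{t\ge\tau^*_{2k+1}: M_t\le -B\}, \] with $\inf\emptyset=+\infty$. Then $\delta^*$ is optimal: $R(\delta^* )=\inf_\delta R(\delta)$, the infimum being over all decision rules $\delta$.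
   Context: $\operatorname{sgn}$ denotes the sign function; $\mathbf{1}(\cdot)$ is the indicator. The sum $\sum_{t>\tau_0}\mathbf{1}(D^\delta_{t-}\ne D^\delta_t)$ counts the number of changes of decision after $\tau_0$. *)

theory Defs
  imports "HOL-Probability.Probability"
begin

definition gen_events :: "'a measure \<Rightarrow> (real \<Rightarrow> 'a \<Rightarrow> real) \<Rightarrow> real set \<Rightarrow> 'a set set" where
  "gen_events M Y S = sigma_sets (space M) (\<Union>s\<in>S. {Y s -` A \<inter> space M | A. A \<in> sets borel})"

definition gen_events1 :: "'a measure \<Rightarrow> ('a \<Rightarrow> real) \<Rightarrow> 'a set set" where
  "gen_events1 M Z = sigma_sets (space M) {Z -` A \<inter> space M | A. A \<in> sets borel}"

definition std_BM :: "'a measure \<Rightarrow> (real \<Rightarrow> 'a \<Rightarrow> real) \<Rightarrow> bool" where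
  "std_BM M W \<longleftrightarrow>
     (\<forall>t\<ge>0. W t \<in> borel_measurable M) \<and>
     (\<forall>\<omega>\<in>space M. W 0 \<omega> = 0) \<and>
     (\<forall>\<omega>\<in>space M. continuous_on {0..} (\<lambda>t. W t \<omega>)) \<and>
     (\<forall>s t. 0 \<le> s \<and> s < t \<longrightarrow>
        distributed M lborel (\<lambda>\<omega>. W t \<omega> - W s \<omega>) (\<lambda>x. ennreal (normal_density 0 (sqrt (t - s)) x))) \<and>
     (\<forall>ts::real list. sorted_wrt (<) ts \<and> (\<forall>t\<in>set ts. 0 \<le> t) \<longrightarrow>
        prob_space.indep_vars M (\<lambda>_. borel) (\<lambda>i \<omega>. W (ts ! Suc i) \<omega> - W (ts ! i) \<omega>) {..<length ts - 1})"

definition FX :: "'a measure \<Rightarrow> (real \<Rightarrow> 'a \<Rightarrow> real) \<Rightarrow> real \<Rightarrow> 'a set set" where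
  "FX M X t = (\<Inter>u\<in>{t<..}. sigma_sets (space M) (gen_events M X {0..u} \<union> null_sets M))"

definition stopping_time_ext :: "'a measure \<Rightarrow> (real \<Rightarrow> 'a set set) \<Rightarrow> ('a \<Rightarrow> ereal) \<Rightarrow> bool" where
  "stopping_time_ext M F T \<longleftrightarrow> (\<forall>\<omega>\<in>space M. 0 \<le> T \<omega>) \<and>
     (\<forall>t\<ge>0. {\<omega>\<in>space M. T \<omega> \<le> ereal t} \<in> F t)"

definition F_infty :: "'a measure \<Rightarrow> (real \<Rightarrow> 'a set set) \<Rightarrow> 'a set set" where
  "F_infty M F = sigma_sets (space M) (\<Union>t\<in>{0..}. F t)"

definition F_at :: "'a measure \<Rightarrow> (real \<Rightarrow> 'a set set) \<Rightarrow> ('a \<Rightarrow> ereal) \<Rightarrow> 'a set set" where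
  "F_at M F T = {E \<in> F_infty M F. \<forall>t\<ge>0. E \<inter> {\<omega>\<in>space M. T \<omega> \<le> ereal t} \<in> F t}"

text \<open>A decision rule (tau_0, d, (tau_1, tau_2, ...)) is encoded as the sequence tau
  (with tau 0 = tau_0) together with d.\<close>
definition decision_rule :: "'a measure \<Rightarrow> (real \<Rightarrow> 'a set set) \<Rightarrow> (nat \<Rightarrow> 'a \<Rightarrow> ereal) \<Rightarrow> ('a \<Rightarrow> real) \<Rightarrow> bool" where
  "decision_rule M F \<tau> d \<longleftrightarrow>
     (\<forall>n. stopping_time_ext M F (\<tau> n)) \<and>
     (\<forall>n. \<forall>\<omega>\<in>space M. \<tau> n \<omega> \<le> \<tau> (Suc n) \<omega>) \<and>
     (\<forall>\<omega>\<in>space M. d \<omega> \<in> {-1, 1}) \<and>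
     (\<forall>A\<in>sets borel. d -` A \<inter> space M \<in> F_at M F (\<tau> 0))"

text \<open>The decision process D^delta (value 0 where the paper's case list does not apply,
  i.e. after an accumulation point of the tau_n).\<close>
definition Dproc :: "(nat \<Rightarrow> 'a \<Rightarrow> ereal) \<Rightarrow> ('a \<Rightarrow> real) \<Rightarrow> real \<Rightarrow> 'a \<Rightarrow> real" where
  "Dproc \<tau> d t \<omega> =
     (if ereal t < \<tau> 0 \<omega> then 0
      else if \<exists>n. \<tau> (2*n) \<omega> \<le> ereal t \<and> ereal t < \<tau> (2*n+1) \<omega> then d \<omega>
      else if \<exists>n. \<tau> (2*n+1) \<omega> \<le> ereal t \<and> ereal t < \<tau> (2*n+2) \<omega> then - d \<omega>
      else 0)"

definition Dleft :: "(nat \<Rightarrow> 'a \<Rightarrow> ereal) \<Rightarrow> ('a \<Rightarrow> real) \<Rightarrow> real \<Rightarrow> 'a \<Rightarrow> real" where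
  "Dleft \<tau> d t \<omega> = Lim (at_left t) (\<lambda>s. Dproc \<tau> d s \<omega>)"

definition risk :: "'a measure \<Rightarrow> ('a \<Rightarrow> real) \<Rightarrow> real \<Rightarrow> real \<Rightarrow> real \<Rightarrow>
    (nat \<Rightarrow> 'a \<Rightarrow> ereal) \<Rightarrow> ('a \<Rightarrow> real) \<Rightarrow> ennreal" where
  "risk M \<theta> c0 c1 c2 \<tau> d =
     (\<integral>\<^sup>+ \<omega>. ennreal c0 * e2ennreal (\<tau> 0 \<omega>)
        + ennreal c1 * (\<integral>\<^sup>+ t. indicator {t. \<tau> 0 \<omega> \<le> ereal t \<and> Dproc \<tau> d t \<omega> \<noteq> \<theta> \<omega>} t \<partial>lborel)
        + ennreal c2 * emeasure (count_space UNIV) {t. \<tau> 0 \<omega> < ereal t \<and> Dleft \<tau> d t \<omega> \<noteq> Dproc \<tau> d t \<omega>}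
      \<partial>M)"

text \<open>Posterior mean process, given by the paper's explicit formula.\<close>
definition posterior :: "real \<Rightarrow> real \<Rightarrow> (real \<Rightarrow> 'a \<Rightarrow> real) \<Rightarrow> real \<Rightarrow> 'a \<Rightarrow> real" where
  "posterior p \<mu> X t \<omega> = 1 - 2 * (1 - p) / (p * exp (2 * \<mu> * X t \<omega>) + 1 - p)"

text \<open>First time t >= sigma (t >= 0) at which Mp t is in S; Inf {} = +oo.\<close>
definition hit :: "(real \<Rightarrow> 'a \<Rightarrow> real) \<Rightarrow> real set \<Rightarrow> ('a \<Rightarrow> ereal) \<Rightarrow> 'a \<Rightarrow> ereal" where
  "hit Mp S \<sigma> \<omega> = Inf {ereal t | t. 0 \<le> t \<and> \<sigma> \<omega> \<le> ereal t \<and> Mp t \<omega> \<in> S}"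

definition tau0_star :: "(real \<Rightarrow> 'a \<Rightarrow> real) \<Rightarrow> real \<Rightarrow> 'a \<Rightarrow> ereal" where
  "tau0_star Mp A = hit Mp {x. A \<le> \<bar>x\<bar>} (\<lambda>_. 0)"

text \<open>d* = sgn M at tau0*; on the (null) event tau0* = +oo we set d* = 1.\<close>
definition d_star :: "(real \<Rightarrow> 'a \<Rightarrow> real) \<Rightarrow> real \<Rightarrow> 'a \<Rightarrow> real" where
  "d_star Mp A \<omega> = (if tau0_star Mp A \<omega> = \<infinity> then 1
                     else sgn (Mp (real_of_ereal (tau0_star Mp A \<omega>)) \<omega>))"

fun tau_star :: "(real \<Rightarrow> 'a \<Rightarrow> real) \<Rightarrow> real \<Rightarrow> real \<Rightarrow> nat \<Rightarrow> 'a \<Rightarrow> ereal" where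
  "tau_star Mp A B 0 = tau0_star Mp A"
| "tau_star Mp A B (Suc n) = (\<lambda>\<omega>.
     if (d_star Mp A \<omega> = 1) = even n
     then hit Mp {..-B} (tau_star Mp A B n) \<omega>
     else hit Mp {B..} (tau_star Mp A B n) \<omega>)"

end

theory Submission
  imports Defs
begin

text \<open>
  The log-odds of the posterior mean \<open>M\<close> are affine in \<open>X\<close>, and under the expectation \<open>M\<close> may be replaced by
  \<open>\<theta>\<close>. Hence every function \<open>(\<alpha> + \<beta> m) ln ((1 + m) / (1 - m)) + \<gamma> + \<delta> m\<close> of \<open>M\<close> has the explicit drift
  \<open>2 \<mu>\<^sup>2 (\<alpha> \<theta> + \<beta>)\<close>, without any stochastic calculus. The candidate value functions (one for each current
  decision -1, 0, 1) are of this form in the continuation region, and the two free boundary equations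
  are exactly value matching and smooth fit; therefore on the whole interval they differ from such a function by a
  \<^emph>\<open>convex\<close> function of \<open>m\<close>. As \<open>M\<close> is a martingale, Jensen's inequality makes value plus accumulated cost
  a submartingale.

  For the lower bound this is applied along a time grid of mesh \<open>h\<close>, on which the decision process of an
  arbitrary rule is merely an adapted process: the cost accumulated on the grid exceeds the true cost at most by
  a factor \<open>1 + h c1 / c2\<close> and a summand \<open>h c0\<close>. The terminal value vanishes along the grid, because
  \<open>E (1 - D M) = E (1 - D \<theta>)\<close> tends to 0 for a rule of finite risk. For the candidate rule the convex parts
  vanish until the next boundary is hit, so that optional stopping gives equality stage by stage.
\<close>

subsection \<open>The free boundary problem\<close>

text \<open>The value functions are only once differentiable at the boundaries. Splitting off the
  part beyond a boundary as a convex function that vanishes to first order there lets Jensen's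
  inequality replace second derivatives. The drift is explicit because \<open>(\<alpha> + \<beta> *
  \<theta>) * \<theta> = \<alpha> * \<theta> + \<beta>\<close>, as \<open>\<theta>\<close> is a
  sign. Two obstacles shape the rest. The filtration is completed and right-continuous, so its
  events at time \<open>s\<close> are not literally events of the path up to \<open>s\<close>:
  integral identities are shown for generated events, carried to completed ones at some
  \<open>u > s\<close>, and then \<open>u\<close> decreases to \<open>s\<close>. And the log-odds
  are unbounded, so stopping the candidate rule at \<open>min \<sigma> T\<close> needs uniform
  integrability; it comes from second moments, since \<open>(logit m)\<^sup>2\<close> is convex and
  hence a submartingale along \<open>Mp\<close>. An arbitrary rule needs no stopping theorem, its
  decision process being read at deterministic grid times only. For \<open>p\<close> in {0, 1} the
  log-odds are infinite, and that case is settled apart.\<close>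

definition logit :: "real \<Rightarrow> real" where
  "logit m = ln ((1 + m) / (1 - m))"

lemma logit_minus: "\<bar>m\<bar> < 1 \<Longrightarrow> logit (-m) = - logit m"
  unfolding logit_def by (simp add: ln_div)

lemma logit_0 [simp]: "logit 0 = 0"
  by (simp add: logit_def)

lemma logit_DERIV:
  assumes "\<bar>m\<bar> < 1"
  shows "(logit has_real_derivative 2 / (1 - m\<^sup>2)) (at m)"
proof -
  have m: "1 + m > 0" "1 - m > 0" using assms by auto
  have "((\<lambda>m. ln ((1 + m) / (1 - m))) has_real_derivative
      ((1 * (1 - m) - (1 + m) * (0 - 1)) / ((1 - m) * (1 - m))) / ((1 + m) / (1 - m))) (at m)"
    using m by (auto intro!: derivative_eq_intros simp: mult_ac)
  also have "1 * (1 - m) - (1 + m) * (0 - 1) = 2" by simp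
  also have "2 / (x * x) / (y / x) = 2 / (x * y)" if "x > 0" for x y :: real using that by simp
  note this[OF m(2), of "1 + m"]
  also have "(1 - m) * (1 + m) = 1 - m\<^sup>2" by (simp add: algebra_simps power2_eq_square)
  finally show ?thesis unfolding logit_def[abs_def] .
qed

lemma square_less_1: "\<bar>m\<bar> < 1 \<Longrightarrow> m\<^sup>2 < (1::real)"
  using abs_square_less_1 by blast

lemma logit_mono:
  assumes "-1 < x" "x \<le> y" "y < 1"
  shows "logit x \<le> logit y"
proof (rule DERIV_nonneg_imp_nondecreasing[OF assms(2)])
  fix z assume "x \<le> z" "z \<le> y"
  then have z: "\<bar>z\<bar> < 1" using assms by auto
  show "\<exists>d. (logit has_real_derivative d) (at z) \<and> 0 \<le> d"
    using logit_DERIV[OF z] square_less_1[OF z] by (intro exI conjI) auto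
qed

lemma logit_nonneg: "0 \<le> m \<Longrightarrow> m < 1 \<Longrightarrow> 0 \<le> logit m"
  using logit_mono[of 0 m] by simp

lemma logit_nonpos: "-1 < m \<Longrightarrow> m \<le> 0 \<Longrightarrow> logit m \<le> 0"
  using logit_mono[of m 0] by simp

lemma borel_measurable_logit [measurable]: "logit \<in> borel_measurable borel"
  unfolding logit_def[abs_def] by measurable

text \<open>The logarithm of the odds is at most twice their square root, and the factor
  \<open>1 - m\<close> tames that root. Hence \<open>U\<close> vanishes at \<open>m = 1\<close> at
  least like \<open>sqrt (1 - m)\<close>, which \<open>V1_le_sqrt\<close> exploits.\<close>

lemma one_minus_mult_logit_le:
  assumes "0 \<le> m" "m < 1"
  shows "(1 - m) * logit m \<le> 2 * sqrt ((1 + m) * (1 - m))"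
proof -
  define x where "x = (1 + m) / (1 - m)"
  have x: "x > 0" using assms by (simp add: x_def)
  have "ln x = 2 * ln (sqrt x)" using x by (simp add: ln_sqrt)
  also have "\<dots> \<le> 2 * (sqrt x)" using ln_le_minus_one[of "sqrt x"] x by simp
  finally have "(1 - m) * ln x \<le> (1 - m) * (2 * sqrt x)"
    using assms by (intro mult_left_mono) auto
  then have "(1 - m) * ln x \<le> 2 * ((1 - m) * sqrt x)" by (simp only: mult_ac)
  also have "(1 - m) * sqrt x = sqrt ((1 - m)\<^sup>2 * x)"
    using assms by (simp add: real_sqrt_mult)
  also have "(1 - m)\<^sup>2 * x = (1 + m) * (1 - m)"
    using assms by (simp add: x_def power2_eq_square)
  finally show ?thesis by (simp add: logit_def x_def)
qed

text \<open>At the intermediate point the linear terms of the two supporting lines cancel in the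
  average. \<open>D\<close> is any choice of slopes, so the criterion suits functions glued from
  pieces.\<close>

lemma convex_on_if_subgradient:
  fixes f D :: "real \<Rightarrow> real"
  assumes "convex I" and sub: "\<And>x y. x \<in> I \<Longrightarrow> y \<in> I \<Longrightarrow> f x + D x * (y - x) \<le> f y"
  shows "convex_on I f"
proof (rule convex_onI)
  fix t x y assume t: "0 < t" "t < (1::real)" and xy: "x \<in> I" "y \<in> I"
  define z where "z = (1 - t) *\<^sub>R x + t *\<^sub>R y"
  have z: "z \<in> I" unfolding z_def using assms(1) xy t by (intro convexD) auto
  have "(1 - t) * (f z + D z * (x - z)) + t * (f z + D z * (y - z)) \<le> (1 - t) * f x + t * f y"
    using sub[OF z xy(1)] sub[OF z xy(2)] t by (intro add_mono mult_left_mono) auto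
  also have "(1 - t) * (f z + D z * (x - z)) + t * (f z + D z * (y - z)) = f z"
    by (simp add: z_def algebra_simps)
  finally show "f ((1 - t) *\<^sub>R x + t *\<^sub>R y) \<le> (1 - t) * f x + t * f y" unfolding z_def .
qed (rule assms(1))

lemma tangent_le:
  fixes q q' :: "real \<Rightarrow> real"
  assumes der: "\<And>x. b \<le> x \<Longrightarrow> x < c \<Longrightarrow> (q has_real_derivative q' x) (at x)"
    and mono: "\<And>x y. b \<le> x \<Longrightarrow> x \<le> y \<Longrightarrow> y < c \<Longrightarrow> q' x \<le> q' y"
    and x: "b \<le> x" "x < c" and y: "b \<le> y" "y < c"
  shows "q x + q' x * (y - x) \<le> q y"
proof -
  have *: "\<exists>z. z > u \<and> z < v \<and> q v - q u = (v - u) * q' z" if "b \<le> u" "u < v" "v < c" for u v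
    using MVT2[of u v q q'] der that by auto
  consider "x = y" | "x < y" | "y < x" by linarith
  then show ?thesis
  proof cases
    case 2
    then obtain z where "z > x" "z < y" "q y - q x = (y - x) * q' z" using * x y by blast
    moreover have "(y - x) * q' x \<le> (y - x) * q' z"
      using mono[of x z] \<open>x < z\<close> \<open>z < y\<close> x y by (intro mult_left_mono) auto
    ultimately show ?thesis by (simp add: algebra_simps)
  next
    case 3
    then obtain z where "z > y" "z < x" "q x - q y = (x - y) * q' z" using * x y by blast
    moreover have "(x - y) * q' z \<le> (x - y) * q' x"
      using mono[of z x] \<open>y < z\<close> \<open>z < x\<close> x y by (intro mult_left_mono) auto
    ultimately show ?thesis by (simp add: algebra_simps)
  qed auto
qed

text \<open>Value matching and smooth fit at \<open>b\<close> say that the zero function is the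
  tangent of \<open>q\<close> there, so the slope of the glued function is nondecreasing across
  \<open>b\<close>.\<close>

lemma convex_on_glue_zero:
  fixes q q' :: "real \<Rightarrow> real"
  assumes der: "\<And>x. b \<le> x \<Longrightarrow> x < c \<Longrightarrow> (q has_real_derivative q' x) (at x)"
    and mono: "\<And>x y. b \<le> x \<Longrightarrow> x \<le> y \<Longrightarrow> y < c \<Longrightarrow> q' x \<le> q' y"
    and "q b = 0" "q' b = 0"
  shows "convex_on {a<..<c} (\<lambda>m. if b \<le> m then q m else 0)"
proof (rule convex_on_if_subgradient[where D = "\<lambda>m. if b \<le> m then q' m else 0"])
  fix x y assume xy: "x \<in> {a<..<c}" "y \<in> {a<..<c}"
  note T = tangent_le[of b c q q', OF der mono]
  show "(if b \<le> x then q x else 0) + (if b \<le> x then q' x else 0) * (y - x) \<le> (if b \<le> y then q y else 0)"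
  proof (cases "b \<le> x"; cases "b \<le> y")
    assume "b \<le> x" "b \<le> y" then show ?thesis using T[of x y] xy by simp
  next
    \<comment> \<open>The tangent at \<open>x\<close> is already at most 0 over \<open>b\<close>; as
      its slope is nonnegative, it only drops further on the way down to \<open>y\<close>.\<close>
    assume h: "b \<le> x" "\<not> b \<le> y"
    have "q x + q' x * (b - x) \<le> 0" using T[of x b] h xy assms(3) by simp
    moreover have "q' x \<ge> 0" using mono[of b x] h xy assms(4) by simp
    then have "q' x * (y - x) \<le> q' x * (b - x)" using h by (intro mult_left_mono) auto
    ultimately show ?thesis using h by simp
  next
    assume h: "\<not> b \<le> x" "b \<le> y"
    then show ?thesis using T[of b y] xy assms(3,4) by simp
  qed auto
qed simp

lemma convex_on_uminus_arg:
  fixes f :: "real \<Rightarrow> real"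
  assumes "convex_on {-c<..<c} f"
  shows "convex_on {-c<..<c} (\<lambda>m. f (- m))"
proof (rule convex_onI)
  fix t x y assume t: "0 < t" "t < (1::real)" and xy: "x \<in> {-c<..<c}" "y \<in> {-c<..<c}"
  have "f ((1 - t) *\<^sub>R (-x) + t *\<^sub>R (-y)) \<le> (1 - t) * f (-x) + t * f (-y)"
    using t xy by (intro convex_onD[OF assms]) auto
  then show "f (- ((1 - t) *\<^sub>R x + t *\<^sub>R y)) \<le> (1 - t) * f (- x) + t * f (- y)"
    by (simp add: algebra_simps)
qed simp

text \<open>\<open>x\<close> and \<open>logit x\<close> have the same sign, so the second derivative
  is positive. This convexity is the source of the uniform second moments in
  \<open>samp_logit_square\<close>.\<close>

lemma convex_on_logit_square: "convex_on {-1<..<1} (\<lambda>m. (logit m)\<^sup>2)"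
proof (rule f''_ge0_imp_convex)
  fix x :: real assume "x \<in> {-1<..<1}"
  then have x: "\<bar>x\<bar> < 1" by auto
  note d = logit_DERIV[OF x] and s = square_less_1[OF x]
  show "((\<lambda>m. (logit m)\<^sup>2) has_real_derivative 4 * logit x / (1 - x\<^sup>2)) (at x)"
    by (rule derivative_eq_intros d refl)+ simp
  show "((\<lambda>m. 4 * logit m / (1 - m\<^sup>2)) has_real_derivative
     8 * (1 + x * logit x) / (1 - x\<^sup>2)\<^sup>2) (at x)"
    using s by (auto intro!: derivative_eq_intros d simp: divide_simps power2_eq_square) (simp add: algebra_simps)
  have "0 \<le> x * logit x"
    using logit_nonneg[of x] logit_nonpos[of x] x by (cases "0 \<le> x") (auto simp: mult_nonpos_nonpos)
  then show "0 \<le> 8 * (1 + x * logit x) / (1 - x\<^sup>2)\<^sup>2" by simp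
qed simp

text \<open>Once the constant \<open>a\<close> of \<open>U\<close> is fixed by smooth fit at the
  switching boundary, \<open>B_eq\<close> is value matching there (\<open>value_fit\<close>). At the
  stopping boundary the roles are exchanged: \<open>C0\<close> provides value matching, and
  \<open>A_eq\<close> is smooth fit (\<open>rA_A\<close>).\<close>

locale free_boundary =
  fixes \<mu> c0 c1 c2 A B :: real
  assumes \<mu>: "\<mu> > 0" and c0: "c0 > 0" and c1: "c1 > 0" and c2: "c2 > 0"
    and B: "0 < B" "B < 1"
    and B_eq: "ln ((1 - B) / (1 + B)) + 2 * B / (1 - B\<^sup>2) = 2 * \<mu>\<^sup>2 * c2 / c1"
    and A: "0 < A" "A < 1"
    and A_eq: "(c1 / (2 * c0) - 1) * ln ((1 - A) / (1 + A)) + 2 / (1 + A) * (c1 / (2 * c0) + A / (1 - A))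
           = c1 / (c0 * (1 - B\<^sup>2))"
begin

text \<open>\<open>U\<close> is the value after deciding 1 while no switch is due: it solves
  \<open>(\<mu>\<^sup>2 / 2) (1 - m\<^sup>2)\<^sup>2 U'' = - c1 (1 - m) / 2\<close> with \<open>U 1 = 0\<close>. \<open>F0\<close> solves the same equation with right-hand side
  \<open>- c0\<close> and is the value before the first decision. \<open>V1\<close> and \<open>V0\<close> are the value functions on the whole interval;
  \<open>kB\<close> and \<open>kA\<close> are the convex corrections beyond the boundaries.\<close>

definition K :: real where "K = c1 / (4 * \<mu>\<^sup>2)"
definition a :: real where "a = 2 * K / (1 - B\<^sup>2)"
definition C :: real where "C = c0 / (2 * \<mu>\<^sup>2)"
definition U :: "real \<Rightarrow> real" where "U m = K * (1 - m) * logit m + a * (1 - m)"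
definition kB :: "real \<Rightarrow> real" where "kB m = (if B \<le> m then 2 * K * logit m - 2 * a * m + c2 else 0)"
definition V1 :: "real \<Rightarrow> real" where "V1 m = U m + kB (- m)"
definition C0 :: real where "C0 = U A + C * A * logit A"
definition F0 :: "real \<Rightarrow> real" where "F0 m = C0 - C * m * logit m"
definition kA :: "real \<Rightarrow> real" where "kA m = (if A \<le> m then U m - F0 m else 0)"
definition V0 :: "real \<Rightarrow> real" where "V0 m = F0 m + (kA m + kA (- m))"

lemma K_pos: "K > 0" and C_pos: "C > 0" using \<mu> c1 c0 by (auto simp: K_def C_def)
lemma a_gt: "a > 2 * K"
proof -
  have "0 < B\<^sup>2" "B\<^sup>2 < 1" using B square_less_1[of B] by auto
  then show ?thesis using K_pos unfolding a_def by (simp add: divide_simps)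
qed

lemma measurables [measurable]: "U \<in> borel_measurable borel" "kB \<in> borel_measurable borel"
  "V1 \<in> borel_measurable borel" "F0 \<in> borel_measurable borel" "kA \<in> borel_measurable borel"
  "V0 \<in> borel_measurable borel"
proof -
  show [measurable]: "U \<in> borel_measurable borel" unfolding U_def[abs_def] by measurable
  show [measurable]: "kB \<in> borel_measurable borel" unfolding kB_def[abs_def] by measurable
  show "V1 \<in> borel_measurable borel" unfolding V1_def[abs_def] by measurable
  show [measurable]: "F0 \<in> borel_measurable borel" unfolding F0_def[abs_def] by measurable
  show [measurable]: "kA \<in> borel_measurable borel" unfolding kA_def[abs_def] by measurable
  show "V0 \<in> borel_measurable borel" unfolding V0_def[abs_def] by measurable
qed

lemma U_diff: "\<bar>m\<bar> < 1 \<Longrightarrow> U m - U (-m) = 2 * K * logit m - 2 * a * m"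
  by (simp add: U_def logit_minus algebra_simps)

lemma value_fit: "2 * K * logit B - 2 * a * B = - c2"
proof -
  have l: "logit B = - ln ((1 - B) / (1 + B))" using B by (simp add: logit_def ln_div)
  have "2 * K * logit B - 2 * a * B = - (2 * K) * (ln ((1 - B) / (1 + B)) + 2 * B / (1 - B\<^sup>2))"
    by (simp add: l a_def algebra_simps)
  also have "\<dots> = - c2" unfolding B_eq using \<mu> c1 by (simp add: K_def)
  finally show ?thesis .
qed

lemma kB_DERIV:
  assumes "\<bar>x\<bar> < 1"
  shows "((\<lambda>m. 2 * K * logit m - 2 * a * m + c2) has_real_derivative 4 * K / (1 - x\<^sup>2) - 2 * a) (at x)"
  by (rule derivative_eq_intros logit_DERIV[OF assms] refl)+ simp

lemma convex_kB: "convex_on {-1<..<1} kB"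
  unfolding kB_def[abs_def]
proof (rule convex_on_glue_zero[where q' = "\<lambda>x. 4 * K / (1 - x\<^sup>2) - 2 * a"])
  fix x assume "B \<le> x" "x < 1"
  then show "((\<lambda>m. 2 * K * logit m - 2 * a * m + c2) has_real_derivative 4 * K / (1 - x\<^sup>2) - 2 * a) (at x)"
    using B by (intro kB_DERIV) auto
next
  fix x y assume "B \<le> x" "x \<le> y" "y < 1"
  then have "x\<^sup>2 \<le> y\<^sup>2" "y\<^sup>2 < 1" using B square_less_1[of y] by (auto intro!: power_mono)
  then show "4 * K / (1 - x\<^sup>2) - 2 * a \<le> 4 * K / (1 - y\<^sup>2) - 2 * a"
    using K_pos by (auto intro!: divide_left_mono)
qed (use value_fit in \<open>auto simp: a_def\<close>)

text \<open>The slope \<open>4 * K / (1 - z\<^sup>2) - 2 * a\<close> vanishes at both ends of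
  \<open>[-B, B]\<close> by the choice of \<open>a\<close> and is at most 0 in between. So the
  difference \<open>U m - U (- m)\<close> falls from \<open>c2\<close> to \<open>- c2\<close>, and
  no switch pays off inside.\<close>

lemma U_diff_antimono:
  assumes "-B \<le> x" "x \<le> y" "y \<le> B"
  shows "2 * K * logit y - 2 * a * y + c2 \<le> 2 * K * logit x - 2 * a * x + c2"
proof (rule DERIV_nonpos_imp_nonincreasing[OF assms(2)])
  fix z assume "x \<le> z" "z \<le> y"
  then have z: "\<bar>z\<bar> \<le> B" "\<bar>z\<bar> < 1" using assms B by auto
  have "z\<^sup>2 \<le> B\<^sup>2" using z(1) by (metis abs_le_square_iff abs_of_pos B(1))
  moreover have "B\<^sup>2 < 1" using B square_less_1[of B] by auto
  ultimately have "4 * K / (1 - z\<^sup>2) \<le> 4 * K / (1 - B\<^sup>2)"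
    using K_pos by (intro divide_left_mono) auto
  then have "4 * K / (1 - z\<^sup>2) - 2 * a \<le> 0" by (simp add: a_def)
  then show "\<exists>d. ((\<lambda>m. 2 * K * logit m - 2 * a * m + c2) has_real_derivative d) (at z) \<and> d \<le> 0"
    using kB_DERIV[OF z(2)] by blast
qed

lemma value_fit': "2 * K * logit (-B) - 2 * a * (-B) = c2"
  using value_fit B by (simp add: logit_minus)

lemma U_minus_B: "U (-B) = U B + c2"
  using U_diff[of B] value_fit B by simp

lemma U_diff_le:
  assumes "\<bar>m\<bar> \<le> B" shows "\<bar>U m - U (-m)\<bar> \<le> c2"
  using U_diff_antimono[of "-B" m] U_diff_antimono[of m B] U_diff[of m] value_fit value_fit' assms B
  by linarith

lemma U_diff_nonneg:
  assumes "-B \<le> m" "m \<le> 0" shows "U (-m) \<le> U m"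
  using U_diff_antimono[of m 0] U_diff[of m] assms B by auto

text \<open>The restriction is needed: near \<open>-1\<close> the logarithm drives \<open>U\<close>
  to minus infinity. The candidate rule switches at \<open>-B\<close>, so it only meets the region
  treated here.\<close>

lemma U_nonneg:
  assumes "-B \<le> m" "m < 1" shows "0 \<le> U m"
proof -
  have pos: "0 \<le> U m" if "0 \<le> m" "m < 1" for m
    using that logit_nonneg[of m] K_pos a_gt unfolding U_def by auto
  show ?thesis
  proof (cases "0 \<le> m")
    case False
    then show ?thesis using pos[of "-m"] U_diff_nonneg[of m] assms B by auto
  qed (use pos assms in auto)
qed

lemma V1_eq: assumes "\<bar>m\<bar> < 1" shows "V1 m = (if m \<le> -B then U (-m) + c2 else U m)"
  using U_diff[of "-m"] assms by (auto simp: V1_def kB_def)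

text \<open>The dynamic programming inequality: an immediate switch is never better than the value.
  It is an equality below \<open>-B\<close>; in the middle it is \<open>U_diff_le\<close>.\<close>

lemma V1_switch: assumes m: "\<bar>m\<bar> < 1" shows "V1 m \<le> V1 (-m) + c2"
proof -
  consider "m \<le> -B" | "m \<ge> B" | "\<bar>m\<bar> < B" by linarith
  then show ?thesis
  proof cases
    case 1 then show ?thesis using V1_eq[of m] V1_eq[of "-m"] m B by simp
  next
    case 2 then show ?thesis using V1_eq[of m] V1_eq[of "-m"] m B c2 by simp
  next
    case 3 then show ?thesis using V1_eq[of m] V1_eq[of "-m"] m U_diff_le[of m] by (auto simp: abs_if split: if_splits)
  qed
qed

lemma U_abs_le_V1: assumes m: "\<bar>m\<bar> < 1" shows "U \<bar>m\<bar> \<le> V1 m"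
  using U_diff_nonneg[of m] V1_eq[OF m] c2 B by (cases "0 \<le> m") auto

section \<open>Smooth fit and convexity at the stopping boundary; \<open>rA\<close> is the
  derivative of \<open>U - F0\<close>\<close>

definition rA :: "real \<Rightarrow> real" where
  "rA m = K * (2 / (1 + m) - logit m) - a + C * (logit m + 2 * m / (1 - m\<^sup>2))"

lemma rA_A: "rA A = 0"
proof -
  \<comment> \<open>\<open>r\<close> is the quotient \<open>K / C\<close>; after division by
    \<open>C\<close> the equation \<open>rA A = 0\<close> becomes literally
    \<open>A_eq\<close>.\<close>
  define r where "r = c1 / (2 * c0)"
  have l: "ln ((1 - A) / (1 + A)) = - logit A" using A by (simp add: logit_def ln_div)
  have KC: "K = C * r" using \<mu> c0 by (simp add: K_def C_def r_def)
  have AA: "2 * A / (1 - A\<^sup>2) = 2 / (1 + A) * (A / (1 - A))"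
    by (simp add: power2_eq_square algebra_simps)
  have BB: "c1 / (c0 * (1 - B\<^sup>2)) = 2 * r / (1 - B\<^sup>2)" using c0 by (simp add: r_def)
  have eq: "K * (y - l) - 2 * K / b + C * (l + y * z) = C * ((r - 1) * (- l) + y * (r + z) - 2 * r / b)"
    for y l b z by (simp add: KC algebra_simps)
  have "rA A = C * ((r - 1) * (- logit A) + 2 / (1 + A) * (r + A / (1 - A)) - 2 * r / (1 - B\<^sup>2))"
    unfolding rA_def a_def AA by (rule eq)
  then show ?thesis using A_eq[unfolded l BB, folded r_def] by simp
qed

lemma rA_0: "rA 0 < 0" using a_gt by (simp add: rA_def)

text \<open>In this factored form the sign is that of \<open>C - K * (1 - m)\<close>, which up to
  the factor \<open>2 * \<mu>\<^sup>2\<close> compares the cost rate \<open>c0\<close> of waiting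
  with the expected cost rate \<open>c1 * (1 - m) / 2\<close> of the decision 1. It changes at most
  once.\<close>

lemma rA_DERIV:
  assumes "\<bar>m\<bar> < 1"
  shows "(rA has_real_derivative 4 / (1 - m\<^sup>2)\<^sup>2 * (C - K * (1 - m))) (at m)"
proof -
  have m: "1 + m > 0" "1 - m > 0" using assms by auto
  have s: "1 - m\<^sup>2 > 0" using square_less_1[OF assms] by simp
  have e: "1 - m\<^sup>2 = (1 - m) * (1 + m)" by (simp add: algebra_simps power2_eq_square)
  have "(rA has_real_derivative K * (- 2 / (1 + m)\<^sup>2 - 2 / (1 - m\<^sup>2))
      + C * (2 / (1 - m\<^sup>2) + (2 * (1 - m\<^sup>2) + 4 * m\<^sup>2) / (1 - m\<^sup>2)\<^sup>2)) (at m)"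
    unfolding rA_def[abs_def] using m s
    by (auto intro!: derivative_eq_intros logit_DERIV assms simp: power2_eq_square algebra_simps)
  also have "- 2 / (1 + m)\<^sup>2 - 2 / (1 - m\<^sup>2) = 4 / (1 - m\<^sup>2)\<^sup>2 * - (1 - m)"
    unfolding e using m by (simp add: divide_simps power2_eq_square)
  also have "2 / (1 - m\<^sup>2) + (2 * (1 - m\<^sup>2) + 4 * m\<^sup>2) / (1 - m\<^sup>2)\<^sup>2 = 4 / (1 - m\<^sup>2)\<^sup>2"
    using s by (simp add: divide_simps power2_eq_square)
  also have "K * (w * - (1 - m)) + C * w = w * (C - K * (1 - m))" for w
    by (simp add: algebra_simps)
  finally show ?thesis .
qed

lemma rA_mono:
  assumes "0 \<le> x" "x \<le> y" "y < 1" "C - K * (1 - x) \<ge> 0" shows "rA x \<le> rA y"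
proof (rule DERIV_nonneg_imp_nondecreasing[OF assms(2)])
  fix z assume z: "x \<le> z" "z \<le> y"
  then have "K * x \<le> K * z" using K_pos by simp
  then have "C - K * (1 - z) \<ge> 0" using assms(4) by (simp add: algebra_simps)
  then have "0 \<le> 4 / (1 - z\<^sup>2)\<^sup>2 * (C - K * (1 - z))" by simp
  then show "\<exists>d. (rA has_real_derivative d) (at z) \<and> 0 \<le> d"
    using rA_DERIV[of z] z assms by (intro exI conjI) auto
qed

lemma rA_antimono:
  assumes "0 \<le> y" "y < 1" "C - K * (1 - y) \<le> 0" shows "rA y \<le> rA 0"
proof (rule DERIV_nonpos_imp_nonincreasing[OF assms(1)])
  fix z assume z: "0 \<le> z" "z \<le> y"
  then have "K * z \<le> K * y" using K_pos by simp
  then have "C - K * (1 - z) \<le> 0" using assms(3) by (simp add: algebra_simps)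
  then have "4 / (1 - z\<^sup>2)\<^sup>2 * (C - K * (1 - z)) \<le> 0" by (intro mult_nonneg_nonpos) auto
  then show "\<exists>d. (rA has_real_derivative d) (at z) \<and> d \<le> 0"
    using rA_DERIV[of z] z assms by (intro exI conjI) auto
qed

text \<open>\<open>rA\<close> starts negative and its derivative changes sign at most once, from minus to plus;
  hence its zero \<open>A\<close> lies where it is increasing.\<close>

lemma rA_increasing_at_A: "C - K * (1 - A) \<ge> 0"
  using rA_antimono[of A] rA_A rA_0 A by linarith

lemma rA_nonpos: assumes "0 \<le> m" "m \<le> A" shows "rA m \<le> 0"
  using rA_antimono[of m] rA_mono[of m A] rA_0 rA_A assms A by linarith

lemma U_minus_F0_DERIV:
  assumes "\<bar>m\<bar> < 1" shows "((\<lambda>m. U m - F0 m) has_real_derivative rA m) (at m)"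
proof -
  have m: "1 + m > 0" "1 - m > 0" using assms by auto
  have e: "1 - m\<^sup>2 = (1 - m) * (1 + m)" by (simp add: algebra_simps power2_eq_square)
  have "((\<lambda>m. U m - F0 m) has_real_derivative
     (K * (1 - m) * (2 / (1 - m\<^sup>2)) - K * logit m - a + (C * logit m + C * m * (2 / (1 - m\<^sup>2))))) (at m)"
    unfolding U_def F0_def
    by (rule derivative_eq_intros logit_DERIV assms refl)+ (simp add: algebra_simps add_divide_distrib diff_divide_distrib)
  also have "K * (1 - m) * (2 / (1 - m\<^sup>2)) = K * (2 / (1 + m))" unfolding e using m by simp
  finally show ?thesis by (simp add: rA_def algebra_simps)
qed

lemma U_A: "U A = F0 A" by (simp add: F0_def C0_def)

lemma convex_kA: "convex_on {-1<..<1} kA"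
  unfolding kA_def[abs_def]
proof (rule convex_on_glue_zero[where q' = rA])
  fix x assume "A \<le> x" "x < 1"
  then show "((\<lambda>m. U m - F0 m) has_real_derivative rA x) (at x)"
    using A by (intro U_minus_F0_DERIV) auto
next
  fix x y assume xy: "A \<le> x" "x \<le> y" "y < 1"
  have "K * A \<le> K * x" using xy K_pos by simp
  then have "C - K * (1 - x) \<ge> 0" using rA_increasing_at_A by (simp add: algebra_simps)
  then show "rA x \<le> rA y" using rA_mono xy A by simp
qed (auto simp: rA_A U_A)

lemma F0_minus: "\<bar>m\<bar> < 1 \<Longrightarrow> F0 (-m) = F0 m"
  by (simp add: F0_def logit_minus)

lemma F0_abs: "\<bar>m\<bar> < 1 \<Longrightarrow> F0 \<bar>m\<bar> = F0 m"
  using F0_minus[of m] by (cases "0 \<le> m") auto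

lemma V0_eq: assumes "\<bar>m\<bar> < 1" shows "V0 m = (if A \<le> \<bar>m\<bar> then U \<bar>m\<bar> else F0 m)"
  using F0_minus[OF assms] A by (auto simp: V0_def kA_def abs_if)

lemma F0_le_U: assumes "0 \<le> m" "m \<le> A" shows "F0 m \<le> U m"
proof -
  have "U A - F0 A \<le> U m - F0 m"
  proof (rule DERIV_nonpos_imp_nonincreasing[OF assms(2)])
    fix z assume "m \<le> z" "z \<le> A"
    then show "\<exists>d. ((\<lambda>m. U m - F0 m) has_real_derivative d) (at z) \<and> d \<le> 0"
      using U_minus_F0_DERIV[of z] rA_nonpos[of z] assms A by (intro exI conjI) auto
  qed
  then show ?thesis by (simp add: U_A)
qed

lemma V0_le_V1: assumes m: "\<bar>m\<bar> < 1" shows "V0 m \<le> V1 m"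
  using U_abs_le_V1[OF m] V0_eq[OF m] F0_le_U[of "\<bar>m\<bar>"] F0_abs[OF m] by (auto split: if_splits)

lemma F0_ge: assumes "\<bar>m\<bar> \<le> A" shows "U A \<le> F0 m"
proof -
  have "\<bar>m\<bar> * logit \<bar>m\<bar> \<le> A * logit A"
    using assms A logit_mono[of "\<bar>m\<bar>" A] logit_nonneg[of "\<bar>m\<bar>"] by (intro mult_mono) auto
  then have "F0 A \<le> F0 \<bar>m\<bar>" using C_pos by (simp add: F0_def mult.assoc)
  then show ?thesis using U_A F0_abs[of m] assms A by simp
qed

lemma F0_nonneg: assumes "\<bar>m\<bar> \<le> A" shows "0 \<le> F0 m"
  using F0_ge[OF assms] U_nonneg[of A] A B by linarith

section \<open>Upper bounds that vanish as the current decision becomes certain\<close>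

definition Cb :: real where "Cb = 4 * K + 2 * a + c2"

lemma Cb_pos: "Cb > 0" using K_pos a_gt c2 by (simp add: Cb_def)

text \<open>For \<open>m\<close> at least 0 both terms of \<open>U\<close> are multiples of
  \<open>sqrt (1 - m)\<close>, since \<open>1 - m\<close> is at most its own root. For negative
  \<open>m\<close> the root is at least 1, so a constant bound is enough; this is where
  \<open>c2\<close>, the cost of a switch that may be due, enters \<open>Cb\<close>.\<close>

lemma V1_le_sqrt: assumes m: "\<bar>m\<bar> < 1" shows "V1 m \<le> Cb * sqrt (1 - m)"
proof -
  have U: "U x \<le> 2 * K * sqrt ((1 + x) * (1 - x)) + a * (1 - x)" if "0 \<le> x" "x < 1" for x
    using mult_left_mono[OF one_minus_mult_logit_le[OF that], of K] K_pos
    by (simp add: U_def algebra_simps)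
  have a0: "a > 0" using a_gt K_pos by simp
  show ?thesis
  proof (cases "0 \<le> m")
    case True
    have s: "1 - m \<le> sqrt (1 - m)"
      using True m by (intro real_le_rsqrt) (auto simp: power2_eq_square algebra_simps mult_left_le)
    have "sqrt ((1 + m) * (1 - m)) \<le> sqrt (4 * (1 - m))"
      using m by (intro real_sqrt_le_mono mult_right_mono) auto
    also have "\<dots> = 2 * sqrt (1 - m)" by (simp only: real_sqrt_mult real_sqrt_four)
    finally have "2 * K * sqrt ((1 + m) * (1 - m)) \<le> 2 * K * (2 * sqrt (1 - m))"
      using K_pos by (intro mult_left_mono) auto
    moreover have "a * (1 - m) \<le> a * sqrt (1 - m)" using s a0 by simp
    moreover have "0 \<le> a * sqrt (1 - m)" "0 \<le> c2 * sqrt (1 - m)" using m a0 c2 by auto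
    moreover have "V1 m = U m" using V1_eq[OF m] True B by simp
    moreover have "Cb * sqrt (1 - m) = 2 * K * (2 * sqrt (1 - m)) + 2 * (a * sqrt (1 - m)) + c2 * sqrt (1 - m)"
      by (simp add: Cb_def algebra_simps)
    ultimately show ?thesis using U[of m] True m by linarith
  next
    case False
    have "V1 m \<le> Cb"
    proof (cases "m \<le> -B")
      case True
      have "sqrt ((1 + (-m)) * (1 - (-m))) \<le> 1"
        using m by (simp add: algebra_simps)
      then have "2 * K * sqrt ((1 + (-m)) * (1 - (-m))) \<le> 2 * K" using K_pos by simp
      moreover have "a * (1 - (-m)) \<le> a" using False a0 by (simp add: mult_left_le)
      ultimately have "U (-m) \<le> 2 * K + a" using U[of "-m"] False m by simp
      then show ?thesis using V1_eq[OF m] True K_pos a0 by (simp add: Cb_def)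
    next
      case F2: False
      have "K * (1 - m) * logit m \<le> 0" using False m K_pos logit_nonpos[of m]
        by (intro mult_nonneg_nonpos) auto
      moreover have "a * (1 - m) \<le> a * 2" using m a0 by (intro mult_left_mono) auto
      ultimately show ?thesis using V1_eq[OF m] F2 K_pos c2 by (simp add: Cb_def U_def)
    qed
    also have "\<dots> \<le> Cb * sqrt (1 - m)" using False Cb_pos by simp
    finally show ?thesis .
  qed
qed

text \<open>The root is traded for an expression linear in \<open>1 - m\<close>, whose expectation
  at \<open>m = D * Mp\<close> can be rewritten with \<open>\<theta>\<close> and thus measures the
  error probability. The free parameter \<open>e\<close> becomes the mesh \<open>h\<close> in
  \<open>risk_lower_bound\<close>.\<close>

lemma V1_le: assumes m: "\<bar>m\<bar> < 1" and "e > 0" shows "V1 m \<le> Cb * (e + (1 - m) / e)"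
proof -
  define s where "s = sqrt (1 - m)"
  have s: "s \<ge> 0" "s\<^sup>2 = 1 - m" using m by (auto simp: s_def)
  have "s * e \<le> e\<^sup>2 + s\<^sup>2"
  proof -
    have "0 \<le> (s - e)\<^sup>2" "0 \<le> s * e" using s assms by auto
    then show ?thesis by (simp add: power2_diff)
  qed
  then have "s \<le> e + s\<^sup>2 / e" using assms by (simp add: field_simps power2_eq_square)
  then have "Cb * s \<le> Cb * (e + (1 - m) / e)" using Cb_pos s by simp
  then show ?thesis using V1_le_sqrt[OF m] unfolding s_def by linarith
qed

lemma V0_le: assumes m: "\<bar>m\<bar> < 1" shows "V0 m \<le> 2 * Cb"
proof -
  have "V1 m \<le> Cb * sqrt (1 - m)" by (rule V1_le_sqrt[OF m])
  also have "\<dots> \<le> Cb * sqrt 4" using m Cb_pos by (intro mult_left_mono real_sqrt_le_mono) auto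
  finally show ?thesis using V0_le_V1[OF m] by simp
qed

end

subsection \<open>Generated sigma-algebras\<close>

text \<open>A generator of \<open>gen_events M Y S\<close> that is stable under intersection, as
  required by the pi-lambda arguments below.\<close>

definition cylinders :: "'a measure \<Rightarrow> (real \<Rightarrow> 'a \<Rightarrow> real) \<Rightarrow> real set \<Rightarrow> 'a set set" where
  "cylinders M Y S = {E. \<exists>J C. finite J \<and> J \<subseteq> S \<and> (\<forall>j. C j \<in> sets borel) \<and>
     E = {\<omega>\<in>space M. \<forall>j\<in>J. Y j \<omega> \<in> C j}}"

lemma Int_stable_cylinders: "Int_stable (cylinders M Y S)"
proof (rule Int_stableI)
  fix E E' assume "E \<in> cylinders M Y S" "E' \<in> cylinders M Y S"
  then obtain J C J' C' where
    *: "finite J" "J \<subseteq> S" "\<And>j. C j \<in> sets borel" "E = {\<omega>\<in>space M. \<forall>j\<in>J. Y j \<omega> \<in> C j}"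
       "finite J'" "J' \<subseteq> S" "\<And>j. C' j \<in> sets borel" "E' = {\<omega>\<in>space M. \<forall>j\<in>J'. Y j \<omega> \<in> C' j}"
    unfolding cylinders_def by blast
  \<comment> \<open>Both families of constraints are extended by \<open>UNIV\<close> to the union of
    the index sets.\<close>
  define D where "D j = (if j \<in> J then C j else UNIV) \<inter> (if j \<in> J' then C' j else UNIV)" for j
  have "E \<inter> E' = {\<omega>\<in>space M. \<forall>j\<in>J \<union> J'. Y j \<omega> \<in> D j}"
    unfolding *(4,8) D_def by auto
  moreover have "D j \<in> sets borel" for j unfolding D_def using *(3,7) by auto
  ultimately show "E \<inter> E' \<in> cylinders M Y S"
    unfolding cylinders_def mem_Collect_eq using *(1,2,5,6)
    by (intro exI[of _ "J \<union> J'"] exI[of _ D]) auto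
qed

lemma sigma_sets_cylinders: "sigma_sets (space M) (cylinders M Y S) = gen_events M Y S"
proof (intro subset_antisym)
  interpret sigma_algebra "space M" "gen_events M Y S"
    unfolding gen_events_def by (rule sigma_algebra_sigma_sets) auto
  have 1: "{\<omega>\<in>space M. Y j \<omega> \<in> C} \<in> gen_events M Y S" if "j \<in> S" "C \<in> sets borel" for j C
  proof -
    have "Y j -` C \<inter> space M \<in> gen_events M Y S"
      unfolding gen_events_def using that by (intro sigma_sets.Basic) auto
    then show ?thesis by (simp add: vimage_def Int_def conj_commute)
  qed
  have 2: "{\<omega>\<in>space M. \<forall>j\<in>J. Y j \<omega> \<in> C j} \<in> gen_events M Y S"
    if "finite J" "J \<subseteq> S" "\<forall>j. C j \<in> sets borel" for J C
    using that
  proof (induction J)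
    case (insert i J)
    have "{\<omega>\<in>space M. \<forall>j\<in>insert i J. Y j \<omega> \<in> C j} =
        {\<omega>\<in>space M. Y i \<omega> \<in> C i} \<inter> {\<omega>\<in>space M. \<forall>j\<in>J. Y j \<omega> \<in> C j}" by auto
    then show ?case using 1[of i "C i"] insert by auto
  qed auto
  show "sigma_sets (space M) (cylinders M Y S) \<subseteq> gen_events M Y S"
    unfolding cylinders_def by (rule sigma_sets_subset) (use 2 in blast)
  show "gen_events M Y S \<subseteq> sigma_sets (space M) (cylinders M Y S)"
    unfolding gen_events_def
  proof (rule sigma_sets_mono', safe)
    fix s C assume "s \<in> S" "(C::real set) \<in> sets borel"
    then show "Y s -` C \<inter> space M \<in> cylinders M Y S"
      unfolding cylinders_def by (auto intro!: exI[of _ "{s}"] exI[of _ "\<lambda>_. C"])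
  qed
qed

lemma gen_events_subset_sets:
  assumes "\<And>s. s \<in> S \<Longrightarrow> Y s \<in> borel_measurable M"
  shows "gen_events M Y S \<subseteq> sets M"
  unfolding gen_events_def by (rule sets.sigma_sets_subset) (use assms in \<open>auto intro: measurable_sets\<close>)

lemma gen_eventsI: "s \<in> S \<Longrightarrow> C \<in> sets borel \<Longrightarrow> Y s -` C \<inter> space M \<in> gen_events M Y S"
  unfolding gen_events_def by (intro sigma_sets.Basic) blast

lemma sigma_algebra_gen_events: "sigma_algebra (space M) (gen_events M Y S)"
  unfolding gen_events_def by (rule sigma_algebra_sigma_sets) auto

lemma sigma_algebra_gen_events1: "sigma_algebra (space M) (gen_events1 M Z)"
  unfolding gen_events1_def by (rule sigma_algebra_sigma_sets) auto

text \<open>The sets that agree almost everywhere with a member of \<open>G\<close> form a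
  sigma-algebra, and it contains \<open>G\<close> and all null sets.\<close>

lemma sigma_sets_null_approx:
  assumes "sigma_algebra (space M) G" "G \<subseteq> sets M" "E \<in> sigma_sets (space M) (G \<union> null_sets M)"
  shows "\<exists>E'\<in>G. AE \<omega> in M. \<omega> \<in> E \<longleftrightarrow> \<omega> \<in> E'"
  using assms(3)
proof induction
  case (Basic E)
  interpret sigma_algebra "space M" G by fact
  show ?case
  proof (cases "E \<in> G")
    case False
    then have "E \<in> null_sets M" using Basic by auto
    then have "AE \<omega> in M. \<omega> \<notin> E" by (rule AE_not_in)
    then show ?thesis by (intro bexI[of _ "{}"]) auto
  qed auto
next
  case Empty
  interpret sigma_algebra "space M" G by fact
  show ?case by (intro bexI[of _ "{}"]) auto
next
  case (Compl E)
  interpret sigma_algebra "space M" G by fact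
  obtain E' where E': "E' \<in> G" "AE \<omega> in M. \<omega> \<in> E \<longleftrightarrow> \<omega> \<in> E'" using Compl by blast
  show ?case using E' by (intro bexI[of _ "space M - E'"]) auto
next
  case (Union E)
  interpret sigma_algebra "space M" G by fact
  have "\<forall>i. \<exists>E'. E' \<in> G \<and> (AE \<omega> in M. \<omega> \<in> E i \<longleftrightarrow> \<omega> \<in> E')" using Union by blast
  then obtain E' where E': "\<And>i. E' i \<in> G" "\<And>i. AE \<omega> in M. \<omega> \<in> E i \<longleftrightarrow> \<omega> \<in> E' i" by metis
  have "AE \<omega> in M. \<forall>i. \<omega> \<in> E i \<longleftrightarrow> \<omega> \<in> E' i" using E'(2) by (simp add: AE_all_countable)
  then show ?case using E'(1) by (intro bexI[of _ "\<Union>i. E' i"]) auto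
qed

text \<open>Dynkin's pi-lambda theorem: the events over which \<open>f\<close> integrates to 0 are
  closed under disjoint unions, and by \<open>total\<close> also under complements.\<close>

lemma set_integral_zero_sigma_sets:
  fixes f :: "'a \<Rightarrow> real"
  assumes f: "integrable M f" and P: "Int_stable P" "P \<subseteq> sets M"
    and zero: "\<And>E. E \<in> P \<Longrightarrow> (LINT \<omega>:E|M. f \<omega>) = 0" and total: "(LINT \<omega>|M. f \<omega>) = 0"
    and E: "E \<in> sigma_sets (space M) P"
  shows "(LINT \<omega>:E|M. f \<omega>) = 0"
proof -
  have si: "set_integrable M E f" if "E \<in> sets M" for E
    using integrable_mult_indicator[OF that f] by (simp add: set_integrable_def)
  have sub: "sigma_sets (space M) P \<subseteq> sets M" by (rule sets.sigma_sets_subset[OF P(2)])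
  have sp: "P \<subseteq> Pow (space M)" using P(2) sets.sets_into_space by blast
  show ?thesis
  proof (rule sigma_sets_induct_disjoint[OF P(1) sp E])
    fix E assume compl: "E \<in> sigma_sets (space M) P" "(LINT \<omega>:E|M. f \<omega>) = 0"
    have m: "E \<in> sets M" using compl sub by auto
    have "(LINT \<omega>:space M|M. f \<omega>) = (LINT \<omega>:E \<union> (space M - E)|M. f \<omega>)"
      using sets.sets_into_space[OF m] by (simp add: Un_absorb1)
    also have "\<dots> = (LINT \<omega>:E|M. f \<omega>) + (LINT \<omega>:space M - E|M. f \<omega>)"
      using m by (intro set_integral_Un si) auto
    finally show "(LINT \<omega>:space M - E|M. f \<omega>) = 0" using compl total by (simp add: set_integral_space[OF f])
  next
    fix A :: "nat \<Rightarrow> 'a set"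
    assume union: "disjoint_family A" "range A \<subseteq> sigma_sets (space M) P" "\<And>i. (LINT \<omega>:A i|M. f \<omega>) = 0"
    have A: "A i \<in> sets M" for i using union sub by blast
    have "(LINT \<omega>:(\<Union>i. A i)|M. f \<omega>) = (\<Sum>i. LINT \<omega>:A i|M. f \<omega>)"
      using A union(1) by (intro lebesgue_integral_countable_add si)
        (auto simp: disjoint_family_on_def)
    then show "(LINT \<omega>:(\<Union>i. A i)|M. f \<omega>) = 0" using union by simp
  qed (simp_all add: zero, simp add: set_lebesgue_integral_def)
qed

lemma set_integral_cong_AE_set:
  fixes f :: "'a \<Rightarrow> real"
  assumes [measurable]: "f \<in> borel_measurable M" "E \<in> sets M" "E' \<in> sets M"
    and "AE \<omega> in M. \<omega> \<in> E \<longleftrightarrow> \<omega> \<in> E'"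
  shows "(LINT \<omega>:E|M. f \<omega>) = (LINT \<omega>:E'|M. f \<omega>)"
  unfolding set_lebesgue_integral_def
  by (rule integral_cong_AE) (use assms(4) in \<open>auto simp: indicator_def elim!: eventually_mono\<close>)

subsection \<open>The observed process\<close>

locale observed_BM = prob_space M for M :: "'a measure" +
  fixes W :: "real \<Rightarrow> 'a \<Rightarrow> real" and \<theta> :: "'a \<Rightarrow> real" and \<mu> p :: real
  assumes BM: "std_BM M W"
    and \<theta>_meas [measurable]: "\<theta> \<in> borel_measurable M"
    and \<theta>_vals: "\<And>\<omega>. \<omega> \<in> space M \<Longrightarrow> \<theta> \<omega> \<in> {-1, 1}"
    and indep: "indep_set (gen_events1 M \<theta>) (gen_events M W {0..})"
    and p_def: "p = measure M {\<omega>\<in>space M. \<theta> \<omega> = 1}"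
    and \<mu>_pos: "\<mu> > 0"
begin

definition X :: "real \<Rightarrow> 'a \<Rightarrow> real" where
  "X = (\<lambda>t \<omega>. \<mu> * \<theta> \<omega> * t + W t \<omega>)"

text \<open>The set system \<open>FX\<close> as a measure space, the form in which measurability and
  conditional expectations with respect to it can be stated.\<close>

definition Fm :: "real \<Rightarrow> 'a measure" where
  "Fm t = sigma (space M) (FX M X t)"

lemma W_meas [measurable (raw)]: "0 \<le> t \<Longrightarrow> W t \<in> borel_measurable M"
  using BM by (simp add: std_BM_def)

lemma increment_meas: "0 \<le> s \<Longrightarrow> s < t \<Longrightarrow> (\<lambda>\<omega>. W t \<omega> - W s \<omega>) \<in> borel_measurable M"
  by (intro borel_measurable_diff W_meas) auto

lemma W_0: "\<omega> \<in> space M \<Longrightarrow> W 0 \<omega> = 0"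
  using BM by (simp add: std_BM_def)

lemma W_cont: "\<omega> \<in> space M \<Longrightarrow> continuous_on {0..} (\<lambda>t. W t \<omega>)"
  using BM by (simp add: std_BM_def)

lemma X_meas [measurable (raw)]: "0 \<le> t \<Longrightarrow> X t \<in> borel_measurable M"
  unfolding X_def by measurable

lemma X_0: "\<omega> \<in> space M \<Longrightarrow> X 0 \<omega> = 0"
  by (simp add: X_def W_0)

lemma X_cont: "\<omega> \<in> space M \<Longrightarrow> continuous_on {0..} (\<lambda>t. X t \<omega>)"
  unfolding X_def by (intro continuous_intros W_cont)

lemma gen_events_X_sets: "gen_events M X {0..u} \<subseteq> sets M"
  by (rule gen_events_subset_sets) auto

lemma sigma_algebra_FX: "sigma_algebra (space M) (FX M X t)"
proof -
  have sa: "sigma_algebra (space M) (sigma_sets (space M) (gen_events M X {0..u} \<union> null_sets M))" for u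
    using gen_events_X_sets[of u] sets.space_closed[of M]
    by (intro sigma_algebra_sigma_sets) (auto simp: null_sets_def)
  show ?thesis
    unfolding sigma_algebra_iff2 FX_def
  proof (intro conjI ballI allI impI)
    show "(\<Inter>u\<in>{t<..}. sigma_sets (space M) (gen_events M X {0..u} \<union> null_sets M)) \<subseteq> Pow (space M)"
      using sa[of "t+1"] unfolding sigma_algebra_iff2
      by (intro order.trans[OF INT_lower[of "t+1"]]) auto
  next
    fix A :: "nat \<Rightarrow> 'a set"
    assume "range A \<subseteq> (\<Inter>u\<in>{t<..}. sigma_sets (space M) (gen_events M X {0..u} \<union> null_sets M))"
    then show "(\<Union>i. A i) \<in> (\<Inter>u\<in>{t<..}. sigma_sets (space M) (gen_events M X {0..u} \<union> null_sets M))"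
      by (intro INT_I sigma_sets.Union) blast
  qed (auto intro: sigma_sets.intros)
qed

text \<open>Up to a null set, an event of the right-continuous filtration at \<open>t\<close> is
  determined by the path of \<open>X\<close> up to any later time. This is the bridge from generated
  events, where independence is available, to \<open>FX\<close>.\<close>

lemma FX_completed:
  assumes "E \<in> FX M X t" "t < u"
  shows "\<exists>E'\<in>gen_events M X {0..u}. AE \<omega> in M. \<omega> \<in> E \<longleftrightarrow> \<omega> \<in> E'"
  using assms unfolding FX_def
  by (intro sigma_sets_null_approx sigma_algebra_gen_events gen_events_X_sets) auto

lemma FX_sets: "FX M X t \<subseteq> sets M"
proof -
  have "FX M X t \<subseteq> sigma_sets (space M) (gen_events M X {0..t+1} \<union> null_sets M)"
    unfolding FX_def by (intro INT_lower) auto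
  also have "\<dots> \<subseteq> sets M"
    by (rule sets.sigma_sets_subset) (use gen_events_X_sets in auto)
  finally show ?thesis .
qed

lemma FX_mono: "s \<le> t \<Longrightarrow> FX M X s \<subseteq> FX M X t"
  unfolding FX_def by (intro INT_anti_mono) auto

lemma sets_Fm [simp]: "sets (Fm t) = FX M X t" and space_Fm [simp]: "space (Fm t) = space M"
proof -
  interpret sigma_algebra "space M" "FX M X t" by (rule sigma_algebra_FX)
  show "sets (Fm t) = FX M X t" "space (Fm t) = space M"
    unfolding Fm_def by (auto simp: space_closed)
qed

lemma subalgebra_Fm: "subalgebra M (Fm t)"
  using FX_sets by (simp add: subalgebra_def)

sublocale Fm: finite_measure_subalgebra M "Fm t" for t
  by unfold_locales (rule subalgebra_Fm)

lemma Fm_mono_measurable: "s \<le> t \<Longrightarrow> f \<in> borel_measurable (Fm s) \<Longrightarrow> f \<in> borel_measurable (Fm t)"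
  using FX_mono[of s t] by (auto simp: measurable_def)

lemma X_adapted:
  assumes "0 \<le> t" shows "X t \<in> borel_measurable (Fm t)"
proof (rule measurableI)
  fix C :: "real set" assume C: "C \<in> sets borel"
  have "X t -` C \<inter> space M \<in> gen_events M X {0..u}" if "t < u" for u
    using that assms C by (intro gen_eventsI) auto
  then show "X t -` C \<inter> space (Fm t) \<in> sets (Fm t)"
    unfolding sets_Fm space_Fm FX_def by (intro INT_I sigma_sets.Basic) auto
qed simp

subsection \<open>Independence of increments from the past\<close>

text \<open>\<open>std_BM\<close> only speaks of increments over finite lists of times. On a
  cylinder every value of \<open>W\<close> is a partial sum of increments up to \<open>s\<close>, so
  it suffices to group independent increments into all but the last one and the last one, which is
  \<open>W t - W s\<close>.\<close>

lemma increment_indep: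
  assumes st: "0 \<le> s" "s < t"
  shows "indep_set (gen_events M W {0..s}) (gen_events1 M (\<lambda>\<omega>. W t \<omega> - W s \<omega>))"
  unfolding sigma_sets_cylinders[symmetric] gen_events1_def
proof (rule indep_set_sigma_sets[OF indep_setI Int_stable_cylinders])
  let ?D = "{(\<lambda>\<omega>. W t \<omega> - W s \<omega>) -` A \<inter> space M |A. A \<in> sets borel}"
  have "sigma_sets (space M) (cylinders M W {0..s}) \<subseteq> events"
    unfolding sigma_sets_cylinders by (rule gen_events_subset_sets) auto
  then show "cylinders M W {0..s} \<subseteq> events"
    using sigma_sets_superset_generator[of "cylinders M W {0..s}" "space M"] by blast
  have D: "(\<lambda>\<omega>. W t \<omega> - W s \<omega>) \<in> borel_measurable M" by (rule increment_meas[OF st])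
  then show "?D \<subseteq> events" by (auto intro: measurable_sets)
  show "Int_stable ?D"
    unfolding Int_stable_def
  proof safe
    fix A A' :: "real set" assume "A \<in> sets borel" "A' \<in> sets borel"
    then show "\<exists>Aa. ((\<lambda>\<omega>. W t \<omega> - W s \<omega>) -` A \<inter> space M) \<inter> ((\<lambda>\<omega>. W t \<omega> - W s \<omega>) -` A' \<inter> space M)
        = (\<lambda>\<omega>. W t \<omega> - W s \<omega>) -` Aa \<inter> space M \<and> Aa \<in> sets borel"
      by (intro exI[of _ "A \<inter> A'"]) auto
  qed
  fix E F assume "E \<in> cylinders M W {0..s}" "F \<in> ?D"
  then obtain J C A where J: "finite J" "J \<subseteq> {0..s}" and C: "\<And>j. C j \<in> sets borel"
    and E: "E = {\<omega>\<in>space M. \<forall>j\<in>J. W j \<omega> \<in> C j}"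
    and A: "A \<in> sets borel" and F: "F = (\<lambda>\<omega>. W t \<omega> - W s \<omega>) -` A \<inter> space M"
    unfolding cylinders_def by blast
  \<comment> \<open>The time 0 lets the partial sums start at \<open>W 0 = 0\<close>; the time
    \<open>s\<close> makes the increment after the last entry exactly
    \<open>W t - W s\<close>.\<close>
  define xs where "xs = sorted_list_of_set (insert 0 (insert s J))"
  define n where "n = length xs"
  have set_xs: "set xs = insert 0 (insert s J)"
    unfolding xs_def using J by (intro set_sorted_list_of_set) auto
  have sorted: "sorted_wrt (<) xs" unfolding xs_def by simp
  have n: "n > 0" using set_xs by (auto simp: n_def)
  have xs_bd: "0 \<le> x \<and> x \<le> s" if "x \<in> set xs" for x using that set_xs J st by auto
  have nth_mono: "xs ! i \<le> xs ! k" if "i \<le> k" "k < n" for i k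
    using sorted that unfolding n_def by (metis le_neq_implies_less order.order_iff_strict sorted_wrt_nth_less)
  have xs0: "xs ! 0 = 0"
  proof -
    obtain i where "i < n" "xs ! i = 0" using set_xs unfolding n_def by (metis in_set_conv_nth insertI1)
    then have "xs ! 0 \<le> 0" using nth_mono[of 0 i] by auto
    moreover have "0 \<le> xs ! 0" using xs_bd[of "xs ! 0"] n by (simp add: n_def)
    ultimately show ?thesis by simp
  qed
  have xsl: "xs ! (n - 1) = s"
  proof -
    obtain i where "i < n" "xs ! i = s" using set_xs unfolding n_def by (metis in_set_conv_nth insert_iff)
    then have "s \<le> xs ! (n - 1)" using nth_mono[of i "n - 1"] by auto
    moreover have "xs ! (n - 1) \<le> s" using xs_bd[of "xs ! (n - 1)"] n by (simp add: n_def)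
    ultimately show ?thesis by simp
  qed
  define ts where "ts = xs @ [t]"
  define Y where "Y i \<omega> = W (ts ! Suc i) \<omega> - W (ts ! i) \<omega>" for i \<omega>
  have ts1: "sorted_wrt (<) ts" unfolding ts_def sorted_wrt_append using sorted xs_bd st by force
  have ts2: "\<forall>x\<in>set ts. 0 \<le> x" using xs_bd st by (auto simp: ts_def)
  have "length ts - 1 = n" by (simp add: ts_def n_def)
  moreover have "indep_vars (\<lambda>_. borel) (\<lambda>i \<omega>. W (ts ! Suc i) \<omega> - W (ts ! i) \<omega>) {..<length ts - 1}"
    using BM ts1 ts2 unfolding std_BM_def by blast
  ultimately have iv: "indep_vars (\<lambda>_. borel) Y {..<n}" unfolding Y_def[abs_def] by simp
  have last: "Y (n - 1) \<omega> = W t \<omega> - W s \<omega>" for \<omega>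
    using n xsl by (simp add: Y_def ts_def nth_append n_def)
  have tel: "W (xs ! k) \<omega> = (\<Sum>i<k. Y i \<omega>)" if "k < n" "\<omega> \<in> space M" for k \<omega>
    using that(1)
  proof (induction k)
    case 0 then show ?case using xs0 W_0[OF that(2)] by simp
  next
    case (Suc k)
    then show ?case by (simp add: Y_def ts_def nth_append n_def)
  qed
  have "\<forall>j\<in>J. \<exists>k<n. xs ! k = j" using set_xs unfolding n_def by (metis in_set_conv_nth insertCI)
  then obtain k where k: "\<And>j. j \<in> J \<Longrightarrow> k j < n \<and> xs ! (k j) = j" by metis
  define P where "P = PiM {..<n-1} (\<lambda>_::nat. borel :: real measure)"
  define Q where "Q = PiM {n-1} (\<lambda>_::nat. borel :: real measure)"
  \<comment> \<open>\<open>xs @ [t]\<close> has \<open>n\<close> increments; those below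
    \<open>n - 1\<close> take place up to \<open>s\<close>, and number \<open>n - 1\<close> leads
    from \<open>s\<close> to \<open>t\<close>.\<close>
  have ind: "indep_var P (\<lambda>\<omega>. restrict (\<lambda>i. Y i \<omega>) {..<n-1}) Q (\<lambda>\<omega>. restrict (\<lambda>i. Y i \<omega>) {n-1})"
    unfolding P_def Q_def using n by (intro indep_var_restrict[OF iv]) auto
  define EE where "EE = {f\<in>space P. \<forall>j\<in>J. (\<Sum>i<k j. f i) \<in> C j}"
  define FF where "FF = {f\<in>space Q. f (n-1) \<in> A}"
  have EE: "EE \<in> sets P"
  proof -
    have [measurable]: "(\<lambda>f. \<Sum>i<k j. f i) \<in> borel_measurable P" if "j \<in> J" for j
      unfolding P_def using k[OF that] by (intro borel_measurable_sum measurable_component_singleton) auto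
    have "{f\<in>space P. (\<Sum>i<k j. f i) \<in> C j} \<in> sets P" if "j \<in> J" for j
      using that C[of j] by measurable
    then show ?thesis unfolding EE_def using J by (intro sets.sets_Collect_finite_All) auto
  qed
  have FF: "FF \<in> sets Q"
    unfolding FF_def Q_def using A by measurable
  have E_eq: "E = (\<lambda>\<omega>. restrict (\<lambda>i. Y i \<omega>) {..<n-1}) -` EE \<inter> space M"
  proof -
    have "(\<Sum>i<k j. restrict (\<lambda>i. Y i \<omega>) {..<n-1} i) = W j \<omega>" if "j \<in> J" "\<omega> \<in> space M" for j \<omega>
    proof -
      have "(\<Sum>i<k j. restrict (\<lambda>i. Y i \<omega>) {..<n-1} i) = (\<Sum>i<k j. Y i \<omega>)"
        using k[OF that(1)] by (intro sum.cong) auto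
      then show ?thesis using tel[of "k j" \<omega>] k[OF that(1)] that by simp
    qed
    then show ?thesis unfolding E EE_def P_def by (auto simp: space_PiM)
  qed
  have F_eq: "F = (\<lambda>\<omega>. restrict (\<lambda>i. Y i \<omega>) {n-1}) -` FF \<inter> space M"
    unfolding F FF_def Q_def by (auto simp: space_PiM last[simplified])
  have "E \<inter> F = (\<lambda>\<omega>. (restrict (\<lambda>i. Y i \<omega>) {..<n-1}, restrict (\<lambda>i. Y i \<omega>) {n-1})) -` (EE \<times> FF) \<inter> space M"
    unfolding E_eq F_eq by auto
  then show "prob (E \<inter> F) = prob E * prob F"
    using indep_varD[OF ind EE FF] by (simp add: E_eq F_eq)
qed

text \<open>An intersection-stable generator of the joint information of \<open>\<theta>\<close> and
  \<open>W\<close> up to \<open>s\<close>. The generated \<open>Hm s\<close> contains the path of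
  \<open>X\<close> up to \<open>s\<close>, whose drift depends on \<open>\<theta>\<close>, and the
  later noise is still independent of it.\<close>

definition past :: "real \<Rightarrow> 'a set set" where
  "past s = {E \<inter> F | E F. E \<in> gen_events1 M \<theta> \<and> F \<in> gen_events M W {0..s}}"

definition Hm :: "real \<Rightarrow> 'a measure" where
  "Hm s = sigma (space M) (past s)"

lemma gen_events1_\<theta>: "gen_events1 M \<theta> \<subseteq> events" and gen_events_W: "gen_events M W {0..} \<subseteq> events"
  using indep_setD_ev1[OF indep] indep_setD_ev2[OF indep] by auto

lemma gen_events_mono: "S \<subseteq> S' \<Longrightarrow> gen_events M Y S \<subseteq> gen_events M Y S'"
  unfolding gen_events_def by (intro sigma_sets_mono') auto

lemma past_sets: "past s \<subseteq> events"
  using gen_events1_\<theta> gen_events_W gen_events_mono[of "{0..s}" "{0..}" W] unfolding past_def by auto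

lemma sets_Hm: "sets (Hm s) = sigma_sets (space M) (past s)" and space_Hm [simp]: "space (Hm s) = space M"
  using past_sets[of s] sets.space_closed[of M] by (auto simp: Hm_def)

lemma sets_Hm_events: "sets (Hm s) \<subseteq> events"
  unfolding sets_Hm by (rule sets.sigma_sets_subset[OF past_sets])

lemma measurable_Hm: "f \<in> measurable (Hm s) N \<Longrightarrow> f \<in> measurable M N"
  using sets_Hm_events[of s] by (auto simp: measurable_def)

lemma \<theta>_Hm [measurable]: "\<theta> \<in> borel_measurable (Hm s)"
proof (rule measurableI)
  fix C :: "real set" assume C: "C \<in> sets borel"
  interpret sigma_algebra "space M" "gen_events M W {0..s}" by (rule sigma_algebra_gen_events)
  have "\<theta> -` C \<inter> space M \<in> gen_events1 M \<theta>" unfolding gen_events1_def using C by (intro sigma_sets.Basic) auto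
  then have "(\<theta> -` C \<inter> space M) \<inter> space M \<in> past s" unfolding past_def using top by blast
  then show "\<theta> -` C \<inter> space (Hm s) \<in> sets (Hm s)" unfolding sets_Hm by (intro sigma_sets.Basic) (simp add: Int_assoc)
qed simp

lemma W_Hm: assumes "0 \<le> r" "r \<le> s" shows "W r \<in> borel_measurable (Hm s)"
proof (rule measurableI)
  fix C :: "real set" assume C: "C \<in> sets borel"
  interpret sigma_algebra "space M" "gen_events1 M \<theta>" by (rule sigma_algebra_gen_events1)
  have "W r -` C \<inter> space M \<in> gen_events M W {0..s}" using C assms by (intro gen_eventsI) auto
  then have "space M \<inter> (W r -` C \<inter> space M) \<in> past s" unfolding past_def using top by blast
  then show "W r -` C \<inter> space (Hm s) \<in> sets (Hm s)" unfolding sets_Hm by (intro sigma_sets.Basic) (simp add: Int_commute)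
qed simp

lemma X_Hm: assumes "0 \<le> r" "r \<le> s" shows "X r \<in> borel_measurable (Hm s)"
  using W_Hm[OF assms] unfolding X_def by measurable

lemma gen_events_X_Hm: "gen_events M X {0..s} \<subseteq> sets (Hm s)"
proof -
  have "sigma_sets (space (Hm s)) (\<Union>r\<in>{0..s}. {X r -` A \<inter> space M |A. A \<in> sets borel}) \<subseteq> sets (Hm s)"
    by (rule sets.sigma_sets_subset) (use measurable_sets[OF X_Hm] in auto)
  then show ?thesis by (simp add: gen_events_def)
qed

text \<open>Independence of \<open>\<theta>\<close> from the whole of \<open>W\<close> splits
  \<open>E\<close> off \<open>F \<inter> b\<close>, independence of increments separates
  \<open>F\<close> from \<open>b\<close>, and the former then recombines \<open>E\<close> with
  \<open>F\<close>.\<close>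

lemma past_indep:
  assumes st: "0 \<le> s" "s < t"
  shows "indep_set (sets (Hm s)) (gen_events1 M (\<lambda>\<omega>. W t \<omega> - W s \<omega>))"
proof -
  let ?D = "gen_events1 M (\<lambda>\<omega>. W t \<omega> - W s \<omega>)"
  interpret D: sigma_algebra "space M" ?D by (rule sigma_algebra_gen_events1)
  interpret T: sigma_algebra "space M" "gen_events1 M \<theta>" by (rule sigma_algebra_gen_events1)
  interpret Ws: sigma_algebra "space M" "gen_events M W {0..s}" by (rule sigma_algebra_gen_events)
  interpret Wi: sigma_algebra "space M" "gen_events M W {0..}" by (rule sigma_algebra_gen_events)
  note incr = increment_indep[OF st]
  \<comment> \<open>Increment events are events of the whole path of \<open>W\<close>, so the
    independence of \<open>\<theta>\<close> applies to them.\<close>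
  have DW: "?D \<subseteq> gen_events M W {0..}"
  proof -
    let ?G = "sigma (space M) (gen_events M W {0..})"
    have "W r \<in> borel_measurable ?G" if "0 \<le> r" for r
    proof (rule measurableI)
      fix C :: "real set" assume "C \<in> sets borel"
      then show "W r -` C \<inter> space ?G \<in> sets ?G"
        using that by (simp add: Wi.space_closed Wi.sigma_sets_eq gen_eventsI)
    qed simp
    then have "(\<lambda>\<omega>. W t \<omega> - W s \<omega>) \<in> borel_measurable ?G" using st by (intro borel_measurable_diff) auto
    from measurable_sets[OF this] show ?thesis
      unfolding gen_events1_def[of M "\<lambda>\<omega>. W t \<omega> - W s \<omega>"] by (intro Wi.sigma_sets_subset) (auto simp: Wi.space_closed)
  qed
  have "indep_set (sigma_sets (space M) (past s)) (sigma_sets (space M) ?D)"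
  proof (rule indep_set_sigma_sets[OF indep_setI])
    show "past s \<subseteq> events" by (rule past_sets)
    show "?D \<subseteq> events" by (rule indep_setD_ev2[OF incr])
    show "Int_stable ?D" by (auto simp: Int_stable_def)
    show "Int_stable (past s)"
    proof (rule Int_stableI)
      fix a b assume "a \<in> past s" "b \<in> past s"
      then obtain E F E' F' where *: "a = E \<inter> F" "b = E' \<inter> F'" "E \<in> gen_events1 M \<theta>" "E' \<in> gen_events1 M \<theta>"
        "F \<in> gen_events M W {0..s}" "F' \<in> gen_events M W {0..s}" unfolding past_def by blast
      have "a \<inter> b = (E \<inter> E') \<inter> (F \<inter> F')" using * by auto
      then show "a \<inter> b \<in> past s" using * unfolding past_def by blast
    qed
    fix a b assume "a \<in> past s" and b: "b \<in> ?D"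
    then obtain E F where a: "a = E \<inter> F" "E \<in> gen_events1 M \<theta>" "F \<in> gen_events M W {0..s}"
      unfolding past_def by blast
    have F': "F \<in> gen_events M W {0..}" using a gen_events_mono[of "{0..s}" "{0..}" W] by auto
    have "prob (a \<inter> b) = prob (E \<inter> (F \<inter> b))" by (simp add: a Int_assoc)
    also have "\<dots> = prob E * prob (F \<inter> b)"
      using F' b DW a by (intro indep_setD[OF indep]) auto
    also have "prob (F \<inter> b) = prob F * prob b" by (rule indep_setD[OF incr a(3) b])
    also have "prob E * (prob F * prob b) = prob a * prob b"
      using indep_setD[OF indep a(2) F'] by (simp add: a)
    finally show "prob (a \<inter> b) = prob a * prob b" .
  qed
  then show ?thesis by (simp add: sets_Hm D.sigma_sets_eq)
qed

lemma past_indep_distr: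
  assumes st: "0 \<le> s" "s < t" and Z: "Z \<in> measurable (Hm s) N"
  shows "distr M N Z \<Otimes>\<^sub>M distr M borel (\<lambda>\<omega>. W t \<omega> - W s \<omega>)
    = distr M (N \<Otimes>\<^sub>M borel) (\<lambda>\<omega>. (Z \<omega>, W t \<omega> - W s \<omega>))"
proof (rule pair_measure_eqI)
  note [measurable] = measurable_Hm[OF Z] increment_meas[OF st]
  show "sigma_finite_measure (distr M N Z)"
    by (intro prob_space_imp_sigma_finite prob_space_distr) simp
  show "sigma_finite_measure (distr M borel (\<lambda>\<omega>. W t \<omega> - W s \<omega>))"
    by (intro prob_space_imp_sigma_finite prob_space_distr) simp
  show "sets (distr M N Z \<Otimes>\<^sub>M distr M borel (\<lambda>\<omega>. W t \<omega> - W s \<omega>))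
    = sets (distr M (N \<Otimes>\<^sub>M borel) (\<lambda>\<omega>. (Z \<omega>, W t \<omega> - W s \<omega>)))"
    by (simp cong: sets_pair_measure_cong)
  fix A B assume "A \<in> sets (distr M N Z)" "B \<in> sets (distr M borel (\<lambda>\<omega>. W t \<omega> - W s \<omega>))"
  then have AB [measurable]: "A \<in> sets N" "B \<in> sets borel" by auto
  let ?A = "Z -` A \<inter> space M" and ?B = "(\<lambda>\<omega>. W t \<omega> - W s \<omega>) -` B \<inter> space M"
  have "?A \<in> sets (Hm s)" using measurable_sets[OF Z AB(1)] by simp
  moreover have "?B \<in> gen_events1 M (\<lambda>\<omega>. W t \<omega> - W s \<omega>)"
    unfolding gen_events1_def using AB by (intro sigma_sets.Basic) blast
  ultimately have "prob (?A \<inter> ?B) = prob ?A * prob ?B" by (rule indep_setD[OF past_indep[OF st]])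
  moreover have "(\<lambda>\<omega>. (Z \<omega>, W t \<omega> - W s \<omega>)) -` (A \<times> B) \<inter> space M = ?A \<inter> ?B" by auto
  ultimately show "emeasure (distr M N Z) A * emeasure (distr M borel (\<lambda>\<omega>. W t \<omega> - W s \<omega>)) B
    = emeasure (distr M (N \<Otimes>\<^sub>M borel) (\<lambda>\<omega>. (Z \<omega>, W t \<omega> - W s \<omega>))) (A \<times> B)"
    by (simp add: emeasure_distr emeasure_eq_measure ennreal_mult')
qed

lemma increment_distributed:
  "0 \<le> s \<Longrightarrow> s < t \<Longrightarrow> distributed M lborel (\<lambda>\<omega>. W t \<omega> - W s \<omega>) (\<lambda>x. ennreal (normal_density 0 (sqrt (t - s)) x))"
  using BM by (simp add: std_BM_def)

text \<open>The joint law of the past and the increment is a product, so Tonelli integrates out the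
  Gaussian increment while \<open>Z\<close> is held fixed. Nonnegative integrands avoid any
  integrability condition.\<close>

lemma nn_integral_freeze:
  assumes st: "0 \<le> s" "s < t" and Z: "Z \<in> measurable (Hm s) N"
    and f [measurable]: "f \<in> borel_measurable (N \<Otimes>\<^sub>M borel)"
  shows "(\<integral>\<^sup>+\<omega>. f (Z \<omega>, W t \<omega> - W s \<omega>) \<partial>M) =
    (\<integral>\<^sup>+\<omega>. (\<integral>\<^sup>+y. ennreal (normal_density 0 (sqrt (t - s)) y) * f (Z \<omega>, y) \<partial>lborel) \<partial>M)"
proof -
  let ?D = "\<lambda>\<omega>. W t \<omega> - W s \<omega>"
  note [measurable] = measurable_Hm[OF Z]
  have [measurable]: "?D \<in> borel_measurable M" by (rule increment_meas[OF st])
  have eq: "distr M N Z \<Otimes>\<^sub>M distr M borel ?D = distr M (N \<Otimes>\<^sub>M borel) (\<lambda>\<omega>. (Z \<omega>, ?D \<omega>))"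
    by (rule past_indep_distr[OF st Z])
  have D: "distr M borel ?D = density lborel (\<lambda>x. ennreal (normal_density 0 (sqrt (t - s)) x))"
    using increment_distributed[OF st] unfolding distributed_def
    by (metis distr_cong sets_lborel)
  interpret D: prob_space "distr M borel ?D" by (rule prob_space_distr) simp
  have "(\<integral>\<^sup>+\<omega>. f (Z \<omega>, ?D \<omega>) \<partial>M) = (\<integral>\<^sup>+x. f x \<partial>distr M (N \<Otimes>\<^sub>M borel) (\<lambda>\<omega>. (Z \<omega>, ?D \<omega>)))"
    by (subst nn_integral_distr) auto
  also have "\<dots> = (\<integral>\<^sup>+x. f x \<partial>(distr M N Z \<Otimes>\<^sub>M distr M borel ?D))" by (simp add: eq)
  also have "\<dots> = (\<integral>\<^sup>+z. (\<integral>\<^sup>+y. f (z, y) \<partial>distr M borel ?D) \<partial>distr M N Z)"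
    by (rule D.nn_integral_fst[symmetric]) simp
  also have "\<dots> = (\<integral>\<^sup>+\<omega>. (\<integral>\<^sup>+y. f (Z \<omega>, y) \<partial>distr M borel ?D) \<partial>M)"
    by (rule nn_integral_distr) (auto intro!: D.borel_measurable_nn_integral_fst simp: split_beta')
  also have "\<dots> = (\<integral>\<^sup>+\<omega>. (\<integral>\<^sup>+y. ennreal (normal_density 0 (sqrt (t - s)) y) * f (Z \<omega>, y) \<partial>lborel) \<partial>M)"
    unfolding D
  proof (rule nn_integral_cong)
    fix \<omega> assume "\<omega> \<in> space M"
    then have "Z \<omega> \<in> space N" by (rule measurable_space[OF measurable_Hm[OF Z]])
    then have [measurable]: "(\<lambda>y. f (Z \<omega>, y)) \<in> borel_measurable borel" by measurable
    show "(\<integral>\<^sup>+y. f (Z \<omega>, y) \<partial>density lborel (\<lambda>x. ennreal (normal_density 0 (sqrt (t - s)) x))) =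
      (\<integral>\<^sup>+y. ennreal (normal_density 0 (sqrt (t - s)) y) * f (Z \<omega>, y) \<partial>lborel)"
      by (subst nn_integral_density) auto
  qed
  finally show ?thesis .
qed

end

subsection \<open>The likelihood ratio and the posterior mean\<close>

context observed_BM
begin

abbreviation hyp :: "real \<Rightarrow> 'a set" where
  "hyp j \<equiv> {\<omega>\<in>space M. \<theta> \<omega> = j}"

lemma hyp_Hm: "hyp j \<in> sets (Hm s)"
proof -
  have "{\<omega>\<in>space (Hm s). \<theta> \<omega> = j} \<in> sets (Hm s)" by measurable
  then show ?thesis by simp
qed

lemma \<theta>_abs: "\<omega> \<in> space M \<Longrightarrow> \<bar>\<theta> \<omega>\<bar> = 1"
  using \<theta>_vals[of \<omega>] by auto

lemma prob_hyp_minus: "prob (hyp (-1)) = 1 - p"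
proof -
  have "hyp (-1) = space M - hyp 1" using \<theta>_vals by force
  then show ?thesis using prob_compl[of "hyp 1"] p_def by simp
qed

lemma p_bounds: "0 \<le> p" "p \<le> 1"
  unfolding p_def by auto

text \<open>On \<open>E\<close>, the laws of the observation up to \<open>s\<close> under the two
  hypotheses have the density ratio \<open>exp (2 * \<mu> * X s)\<close>. The cross-multiplied form
  with the prior weights replaces conditioning on the hypotheses, and the test functions
  \<open>g\<close> of the current state make an induction over time possible.\<close>

definition likelihood_ratio :: "'a set \<Rightarrow> real \<Rightarrow> bool" where
  "likelihood_ratio E s \<longleftrightarrow> (\<forall>g\<in>borel_measurable borel.
     ennreal (1 - p) * (\<integral>\<^sup>+\<omega>. indicator (hyp 1 \<inter> E) \<omega> * g (X s \<omega>) \<partial>M) =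
     ennreal p * (\<integral>\<^sup>+\<omega>. indicator (hyp (-1) \<inter> E) \<omega> * (g (X s \<omega>) * ennreal (exp (2 * \<mu> * X s \<omega>))) \<partial>M))"

text \<open>The Cameron-Martin formula for one increment: translation by
  \<open>2 * \<mu> * h\<close>, the distance between the two drifts, absorbs the exponential weight
  of the step. The factors \<open>-1\<close> and \<open>1\<close> keep the shape
  \<open>\<mu> * j * h\<close> produced by \<open>freeze_hyp\<close>.\<close>

lemma gaussian_shift:
  fixes g :: "real \<Rightarrow> ennreal"
  assumes [measurable]: "g \<in> borel_measurable borel" and h: "h > 0"
  shows "(\<integral>\<^sup>+y. ennreal (normal_density 0 (sqrt h) y) *
      (g (x + \<mu> * -1 * h + y) * ennreal (exp (2 * \<mu> * (x + \<mu> * -1 * h + y)))) \<partial>lborel) =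
    (\<integral>\<^sup>+y. ennreal (normal_density 0 (sqrt h) y) * g (x + \<mu> * 1 * h + y) \<partial>lborel) * ennreal (exp (2 * \<mu> * x))"
proof -
  have d: "normal_density 0 (sqrt h) (2 * \<mu> * h + y) * exp (2 * \<mu> * (x + \<mu> * h + y))
      = normal_density 0 (sqrt h) y * exp (2 * \<mu> * x)" for y
  proof -
    have "- (2 * \<mu> * h + y)\<^sup>2 / (2 * h) + 2 * \<mu> * (x + \<mu> * h + y) = - y\<^sup>2 / (2 * h) + 2 * \<mu> * x"
      using h by (simp add: field_simps power2_eq_square)
    then have "exp (- (2 * \<mu> * h + y)\<^sup>2 / (2 * h)) * exp (2 * \<mu> * (x + \<mu> * h + y))
        = exp (- y\<^sup>2 / (2 * h)) * exp (2 * \<mu> * x)"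
      by (simp only: exp_add[symmetric])
    then show ?thesis using h by (simp add: normal_density_def)
  qed
  have "(\<integral>\<^sup>+y. ennreal (normal_density 0 (sqrt h) y) *
      (g (x + \<mu> * -1 * h + y) * ennreal (exp (2 * \<mu> * (x + \<mu> * -1 * h + y)))) \<partial>lborel) =
    (\<integral>\<^sup>+y. ennreal (normal_density 0 (sqrt h) (2 * \<mu> * h + y)) *
      (g (x + \<mu> * h + y) * ennreal (exp (2 * \<mu> * (x + \<mu> * h + y)))) \<partial>lborel)"
    by (subst nn_integral_real_affine[where c = 1 and t = "2 * \<mu> * h"]) (auto simp: algebra_simps)
  also have "\<dots> = (\<integral>\<^sup>+y. (ennreal (normal_density 0 (sqrt h) y) * g (x + \<mu> * 1 * h + y)) * ennreal (exp (2 * \<mu> * x)) \<partial>lborel)"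
  proof (rule nn_integral_cong)
    fix y
    have "ennreal (normal_density 0 (sqrt h) (2 * \<mu> * h + y)) * ennreal (exp (2 * \<mu> * (x + \<mu> * h + y)))
       = ennreal (normal_density 0 (sqrt h) y) * ennreal (exp (2 * \<mu> * x))"
      unfolding ennreal_mult'[symmetric, OF normal_density_nonneg] d
      by (simp add: ennreal_mult')
    then show "ennreal (normal_density 0 (sqrt h) (2 * \<mu> * h + y)) *
        (g (x + \<mu> * h + y) * ennreal (exp (2 * \<mu> * (x + \<mu> * h + y)))) =
      (ennreal (normal_density 0 (sqrt h) y) * g (x + \<mu> * 1 * h + y)) * ennreal (exp (2 * \<mu> * x))"
      by (simp add: mult_ac)
  qed
  also have "\<dots> = (\<integral>\<^sup>+y. ennreal (normal_density 0 (sqrt h) y) * g (x + \<mu> * 1 * h + y) \<partial>lborel) * ennreal (exp (2 * \<mu> * x))"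
    by (rule nn_integral_multc) simp
  finally show ?thesis .
qed

text \<open>On \<open>hyp j\<close> the drift is known, so \<open>X s\<close> is
  \<open>X b + \<mu> * j * (s - b)\<close> plus an increment independent of \<open>E\<close> and
  \<open>X b\<close>.\<close>

lemma freeze_hyp:
  assumes bs: "0 \<le> b" "b < s" and E: "E \<in> sets (Hm b)" and f [measurable]: "f \<in> borel_measurable borel"
  shows "(\<integral>\<^sup>+\<omega>. indicator (hyp j \<inter> E) \<omega> * f (X s \<omega>) \<partial>M) =
    (\<integral>\<^sup>+\<omega>. indicator (hyp j \<inter> E) \<omega> *
      (\<integral>\<^sup>+y. ennreal (normal_density 0 (sqrt (s - b)) y) * f (X b \<omega> + \<mu> * j * (s - b) + y) \<partial>lborel) \<partial>M)"
proof -
  define Z where "Z \<omega> = (indicator (hyp j \<inter> E) \<omega> :: ennreal, X b \<omega>)" for \<omega>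
  define F where "F = (\<lambda>z :: (ennreal \<times> real) \<times> real. fst (fst z) * f (snd (fst z) + \<mu> * j * (s - b) + snd z))"
  have jE: "hyp j \<inter> E \<in> sets (Hm b)" using hyp_Hm E by (rule sets.Int)
  have Z: "Z \<in> measurable (Hm b) (borel \<Otimes>\<^sub>M borel)"
    unfolding Z_def using jE X_Hm[OF bs(1) order.refl] by (intro measurable_Pair borel_measurable_indicator)
  have F: "F \<in> borel_measurable ((borel \<Otimes>\<^sub>M borel) \<Otimes>\<^sub>M borel)"
    unfolding F_def by measurable
  have "(\<integral>\<^sup>+\<omega>. indicator (hyp j \<inter> E) \<omega> * f (X s \<omega>) \<partial>M) = (\<integral>\<^sup>+\<omega>. F (Z \<omega>, W s \<omega> - W b \<omega>) \<partial>M)"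
    by (intro nn_integral_cong) (auto simp: F_def Z_def X_def indicator_def algebra_simps)
  also have "\<dots> = (\<integral>\<^sup>+\<omega>. (\<integral>\<^sup>+y. ennreal (normal_density 0 (sqrt (s - b)) y) * F (Z \<omega>, y) \<partial>lborel) \<partial>M)"
    by (rule nn_integral_freeze[OF bs Z F])
  also have "\<dots> = (\<integral>\<^sup>+\<omega>. indicator (hyp j \<inter> E) \<omega> *
      (\<integral>\<^sup>+y. ennreal (normal_density 0 (sqrt (s - b)) y) * f (X b \<omega> + \<mu> * j * (s - b) + y) \<partial>lborel) \<partial>M)"
    by (intro nn_integral_cong) (auto simp: F_def Z_def nn_integral_cmult[symmetric] mult_ac)
  finally show ?thesis .
qed

text \<open>Integrating out the increment turns the test function \<open>g\<close> at time
  \<open>s\<close> into another one, \<open>G\<close>, at time \<open>b\<close>; by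
  \<open>gaussian_shift\<close> it is the same \<open>G\<close> under both hypotheses.\<close>

lemma likelihood_ratio_mono:
  assumes bs: "0 \<le> b" "b \<le> s" and E: "E \<in> sets (Hm b)" and LR: "likelihood_ratio E b"
  shows "likelihood_ratio E s"
proof (cases "b = s")
  case False
  then have bs': "b < s" using bs by simp
  show ?thesis
    unfolding likelihood_ratio_def
  proof
    fix g :: "real \<Rightarrow> ennreal" assume g [measurable]: "g \<in> borel_measurable borel"
    let ?n = "\<lambda>y. ennreal (normal_density 0 (sqrt (s - b)) y)"
    define G where "G x = (\<integral>\<^sup>+y. ?n y * g (x + \<mu> * 1 * (s - b) + y) \<partial>lborel)" for x
    have [measurable]: "G \<in> borel_measurable borel" unfolding G_def by measurable
    have "(\<integral>\<^sup>+\<omega>. indicator (hyp 1 \<inter> E) \<omega> * g (X s \<omega>) \<partial>M) = (\<integral>\<^sup>+\<omega>. indicator (hyp 1 \<inter> E) \<omega> * G (X b \<omega>) \<partial>M)"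
      unfolding G_def by (rule freeze_hyp[OF bs(1) bs' E g])
    moreover have "(\<integral>\<^sup>+\<omega>. indicator (hyp (-1) \<inter> E) \<omega> * (g (X s \<omega>) * ennreal (exp (2 * \<mu> * X s \<omega>))) \<partial>M)
       = (\<integral>\<^sup>+\<omega>. indicator (hyp (-1) \<inter> E) \<omega> * (G (X b \<omega>) * ennreal (exp (2 * \<mu> * X b \<omega>))) \<partial>M)"
      unfolding G_def using bs'
      by (subst freeze_hyp[OF bs(1) bs' E, of "\<lambda>x. g x * ennreal (exp (2 * \<mu> * x))"])
         (auto simp only: gaussian_shift[OF g] diff_gt_0_iff_gt, measurable)
    ultimately show "ennreal (1 - p) * (\<integral>\<^sup>+\<omega>. indicator (hyp 1 \<inter> E) \<omega> * g (X s \<omega>) \<partial>M) =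
     ennreal p * (\<integral>\<^sup>+\<omega>. indicator (hyp (-1) \<inter> E) \<omega> * (g (X s \<omega>) * ennreal (exp (2 * \<mu> * X s \<omega>))) \<partial>M)"
      using LR unfolding likelihood_ratio_def by simp
  qed
qed (use LR in simp)

lemma likelihood_ratio_0: "likelihood_ratio (space M) 0"
  unfolding likelihood_ratio_def
proof
  fix g :: "real \<Rightarrow> ennreal"
  have 1: "(\<integral>\<^sup>+\<omega>. indicator (hyp 1 \<inter> space M) \<omega> * g (X 0 \<omega>) \<partial>M) = (\<integral>\<^sup>+\<omega>. g 0 * indicator (hyp 1) \<omega> \<partial>M)"
    by (intro nn_integral_cong) (auto simp: X_0 indicator_def)
  have 2: "(\<integral>\<^sup>+\<omega>. indicator (hyp (-1) \<inter> space M) \<omega> * (g (X 0 \<omega>) * ennreal (exp (2 * \<mu> * X 0 \<omega>))) \<partial>M)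
      = (\<integral>\<^sup>+\<omega>. g 0 * indicator (hyp (-1)) \<omega> \<partial>M)"
    by (intro nn_integral_cong) (auto simp: X_0 indicator_def)
  have h: "emeasure M (hyp 1) = ennreal p" "emeasure M (hyp (-1)) = ennreal (1 - p)"
    by (simp_all add: emeasure_eq_measure prob_hyp_minus p_def)
  show "ennreal (1 - p) * (\<integral>\<^sup>+\<omega>. indicator (hyp 1 \<inter> space M) \<omega> * g (X 0 \<omega>) \<partial>M) =
     ennreal p * (\<integral>\<^sup>+\<omega>. indicator (hyp (-1) \<inter> space M) \<omega> * (g (X 0 \<omega>) * ennreal (exp (2 * \<mu> * X 0 \<omega>))) \<partial>M)"
    unfolding 1 2 by (simp add: nn_integral_cmult_indicator h mult_ac)
qed

text \<open>Induction over the largest time \<open>b\<close>: the identity for the earlier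
  constraints is carried to \<open>b\<close>, where the new constraint is absorbed into the test
  function, and the result is carried on to \<open>s\<close>.\<close>

lemma likelihood_ratio_cylinder:
  assumes "finite J" "J \<subseteq> {0..s}" "0 \<le> s" and C: "\<And>j. C j \<in> sets borel"
  shows "likelihood_ratio {\<omega>\<in>space M. \<forall>j\<in>J. X j \<omega> \<in> C j} s"
  using assms(1-3)
proof (induction J arbitrary: s rule: finite_linorder_max_induct)
  case empty
  then show ?case using likelihood_ratio_mono[OF _ _ _ likelihood_ratio_0, of s]
    sets.top[of "Hm 0"] by simp
next
  case (insert b J)
  let ?E = "{\<omega>\<in>space M. \<forall>j\<in>J. X j \<omega> \<in> C j}" and ?E' = "{\<omega>\<in>space M. \<forall>j\<in>insert b J. X j \<omega> \<in> C j}"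
  have b: "0 \<le> b" "b \<le> s" using insert by auto
  have "J \<subseteq> {0..b}" using insert by force
  then have IH: "likelihood_ratio ?E b" using insert.IH b by blast
  have "?E' \<in> cylinders M X {0..b}"
    unfolding cylinders_def using insert(1) \<open>J \<subseteq> {0..b}\<close> b C by (auto intro!: exI[of _ "insert b J"] exI[of _ C])
  then have "?E' \<in> gen_events M X {0..b}" unfolding sigma_sets_cylinders[symmetric] by (rule sigma_sets.Basic)
  then have E': "?E' \<in> sets (Hm b)" using gen_events_X_Hm by blast
  have "likelihood_ratio ?E' b"
    unfolding likelihood_ratio_def
  proof
    fix g :: "real \<Rightarrow> ennreal" assume g [measurable]: "g \<in> borel_measurable borel"
    have [measurable]: "(\<lambda>x. indicator (C b) x * g x) \<in> borel_measurable borel" using C[of b] by measurable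
    have "indicator (hyp j \<inter> ?E') \<omega> * x = indicator (hyp j \<inter> ?E) \<omega> * (indicator (C b) (X b \<omega>) * x)" for j \<omega> and x :: ennreal
      by (auto simp: indicator_def)
    then show "ennreal (1 - p) * (\<integral>\<^sup>+\<omega>. indicator (hyp 1 \<inter> ?E') \<omega> * g (X b \<omega>) \<partial>M) =
     ennreal p * (\<integral>\<^sup>+\<omega>. indicator (hyp (-1) \<inter> ?E') \<omega> * (g (X b \<omega>) * ennreal (exp (2 * \<mu> * X b \<omega>))) \<partial>M)"
      using IH[unfolded likelihood_ratio_def, rule_format, of "\<lambda>x. indicator (C b) x * g x"]
      by (simp only: mult.assoc) simp
  qed
  then show ?case by (rule likelihood_ratio_mono[OF b E'])
qed

subsection \<open>Moments of the increments\<close>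

lemma integrable_increment_square: "0 \<le> s \<Longrightarrow> s < t \<Longrightarrow> integrable M (\<lambda>\<omega>. (W t \<omega> - W s \<omega>)\<^sup>2)"
  using distributed_integrable[OF increment_distributed, of s t "\<lambda>x. x\<^sup>2"] integrable_normal_moment[of "sqrt (t - s)" 0 2]
  by simp

lemma integrable_increment: "0 \<le> s \<Longrightarrow> s < t \<Longrightarrow> integrable M (\<lambda>\<omega>. W t \<omega> - W s \<omega>)"
  using distributed_integrable[OF increment_distributed, of s t "\<lambda>x. x"] integrable_normal_moment_nz_1[of "sqrt (t - s)" 0]
  by simp

lemma increment_expectation: "0 \<le> s \<Longrightarrow> s < t \<Longrightarrow> (LINT \<omega>|M. W t \<omega> - W s \<omega>) = 0"
  using normal_distributed_expectation[of "sqrt (t - s)", OF _ increment_distributed] by simp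

lemma increment_abs_le:
  assumes "0 \<le> s" "s < t" shows "(LINT \<omega>|M. \<bar>W t \<omega> - W s \<omega>\<bar>) \<le> sqrt (t - s)"
proof -
  let ?D = "\<lambda>\<omega>. W t \<omega> - W s \<omega>"
  define e where "e = sqrt (t - s)"
  have e: "e > 0" "e\<^sup>2 = t - s" using assms by (auto simp: e_def)
  have "(LINT \<omega>|M. (?D \<omega>)\<^sup>2) = t - s"
    using normal_distributed_variance[OF _ increment_distributed[OF assms]] increment_expectation[OF assms] assms
    by (simp add: prob_space)
  then have sq: "(LINT \<omega>|M. (?D \<omega>)\<^sup>2) = e\<^sup>2" using e by simp
  have "\<bar>x\<bar> \<le> (e + x\<^sup>2 / e) / 2" for x :: real
  proof -
    have "0 \<le> (\<bar>x\<bar> - e)\<^sup>2" by simp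
    then have "2 * \<bar>x\<bar> * e \<le> e * e + x\<^sup>2" by (simp add: power2_eq_square algebra_simps)
    then show ?thesis using e by (simp add: field_simps)
  qed
  then have "(LINT \<omega>|M. \<bar>?D \<omega>\<bar>) \<le> (LINT \<omega>|M. (e + (?D \<omega>)\<^sup>2 / e) / 2)"
    using integrable_increment[OF assms] integrable_increment_square[OF assms]
    by (intro integral_mono) auto
  also have "\<dots> = (e + e\<^sup>2 / e) / 2"
    using integrable_increment_square[OF assms] by (simp add: prob_space sq)
  also have "\<dots> = e" using e(1) by (simp add: power2_eq_square)
  finally show ?thesis by (simp add: e_def)
qed

lemma integrable_W_square: assumes "0 \<le> t" shows "integrable M (\<lambda>\<omega>. (W t \<omega>)\<^sup>2)"
proof (cases "t = 0")
  case True
  have "integrable M (\<lambda>\<omega>. (W t \<omega>)\<^sup>2) \<longleftrightarrow> integrable M (\<lambda>_. 0 :: real)"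
    using W_0 True by (intro Bochner_Integration.integrable_cong) auto
  then show ?thesis by simp
next
  case False
  have "integrable M (\<lambda>\<omega>. (W t \<omega>)\<^sup>2) \<longleftrightarrow> integrable M (\<lambda>\<omega>. (W t \<omega> - W 0 \<omega>)\<^sup>2)"
    using W_0 by (intro Bochner_Integration.integrable_cong) auto
  then show ?thesis using integrable_increment_square[of 0 t] False assms by simp
qed

lemma past_increment_uncorrelated:
  assumes st: "0 \<le> s" "s < t" and Z: "Z \<in> borel_measurable (Hm s)" and bd: "\<And>\<omega>. \<omega> \<in> space M \<Longrightarrow> \<bar>Z \<omega>\<bar> \<le> c"
  shows "(LINT \<omega>|M. Z \<omega> * (W t \<omega> - W s \<omega>)) = 0"
proof -
  note [measurable] = measurable_Hm[OF Z] increment_meas[OF st]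
  have "indep_var borel Z borel (\<lambda>\<omega>. W t \<omega> - W s \<omega>)"
    unfolding indep_var_distribution_eq using past_indep_distr[OF st Z] by simp
  moreover have "integrable M Z" using bd by (intro integrable_const_bound[where B=c]) auto
  ultimately show ?thesis
    using indep_var_lebesgue_integral[OF _ _ integrable_increment[OF st]] increment_expectation[OF st] by simp
qed

text \<open>The events of \<open>FX\<close> at \<open>s\<close> look infinitesimally beyond
  \<open>s\<close>, hence the detour over \<open>u > s\<close>: the part of the increment after
  \<open>u\<close> is uncorrelated with a generated version of \<open>E\<close>, and the part
  between \<open>s\<close> and \<open>u\<close> is of order \<open>sqrt (u - s)\<close>.\<close>

lemma increment_martingale:
  assumes st: "0 \<le> s" "s < t" and E: "E \<in> FX M X s"
  shows "(LINT \<omega>|M. indicator E \<omega> * ((\<alpha> + \<beta> * \<theta> \<omega>) * (W t \<omega> - W s \<omega>))) = 0"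
proof -
  define Q where "Q \<omega> = \<alpha> + \<beta> * \<theta> \<omega>" for \<omega>
  have [measurable]: "E \<in> sets M" using E FX_sets by auto
  have [measurable]: "Q \<in> borel_measurable M" unfolding Q_def by measurable
  have Q: "\<bar>Q \<omega>\<bar> \<le> \<bar>\<alpha>\<bar> + \<bar>\<beta>\<bar>" if "\<omega> \<in> space M" for \<omega>
    using \<theta>_vals[OF that] by (auto simp: Q_def)
  have Qi: "integrable M (\<lambda>\<omega>. indicator E \<omega> * (Q \<omega> * (W v \<omega> - W u \<omega>)))" if "0 \<le> u" "u < v" for u v
  proof (rule Bochner_Integration.integrable_bound)
    show "integrable M (\<lambda>\<omega>. (\<bar>\<alpha>\<bar> + \<bar>\<beta>\<bar>) * (W v \<omega> - W u \<omega>))"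
      using integrable_increment[OF that] by simp
    show "(\<lambda>\<omega>. indicator E \<omega> * (Q \<omega> * (W v \<omega> - W u \<omega>))) \<in> borel_measurable M"
      using increment_meas[OF that] by measurable
    show "AE \<omega> in M. norm (indicator E \<omega> * (Q \<omega> * (W v \<omega> - W u \<omega>))) \<le> norm ((\<bar>\<alpha>\<bar> + \<bar>\<beta>\<bar>) * (W v \<omega> - W u \<omega>))"
      using Q by (intro AE_I2) (auto simp: abs_mult indicator_def intro!: mult_right_mono)
  qed
  have zero: "(LINT \<omega>|M. indicator E \<omega> * (Q \<omega> * (W t \<omega> - W u \<omega>))) = 0" if u: "s < u" "u < t" for u
  proof -
    obtain E' where E': "E' \<in> gen_events M X {0..u}" "AE \<omega> in M. \<omega> \<in> E \<longleftrightarrow> \<omega> \<in> E'"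
      using FX_completed[OF E u(1)] by blast
    have E'H: "E' \<in> sets (Hm u)" using E' gen_events_X_Hm by auto
    then have [measurable]: "E' \<in> sets M" using sets_Hm_events by auto
    have u0: "0 \<le> u" using u st by simp
    have "(LINT \<omega>|M. indicator E \<omega> * (Q \<omega> * (W t \<omega> - W u \<omega>))) = (LINT \<omega>|M. (indicator E' \<omega> * Q \<omega>) * (W t \<omega> - W u \<omega>))"
      using E'(2) increment_meas[OF u0 u(2)]
      by (intro integral_cong_AE) (auto elim!: eventually_mono simp: indicator_def)
    also have "\<dots> = 0"
    proof (rule past_increment_uncorrelated[OF u0 u(2)])
      show "(\<lambda>\<omega>. indicator E' \<omega> * Q \<omega>) \<in> borel_measurable (Hm u)" unfolding Q_def using E'H by measurable
      show "\<bar>indicator E' \<omega> * Q \<omega>\<bar> \<le> \<bar>\<alpha>\<bar> + \<bar>\<beta>\<bar>" if "\<omega> \<in> space M" for \<omega>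
        using Q[OF that] by (auto simp: indicator_def)
    qed
    finally show ?thesis .
  qed
  define R where "R = \<bar>LINT \<omega>|M. indicator E \<omega> * (Q \<omega> * (W t \<omega> - W s \<omega>))\<bar>"
  have bound: "R \<le> (\<bar>\<alpha>\<bar> + \<bar>\<beta>\<bar>) * sqrt (u - s)" if u: "s < u" "u < t" for u
  proof -
    have u0: "0 \<le> u" using u st by simp
    have "(LINT \<omega>|M. indicator E \<omega> * (Q \<omega> * (W t \<omega> - W s \<omega>)))
      = (LINT \<omega>|M. indicator E \<omega> * (Q \<omega> * (W t \<omega> - W u \<omega>)) + indicator E \<omega> * (Q \<omega> * (W u \<omega> - W s \<omega>)))"
      by (intro Bochner_Integration.integral_cong) (auto simp: algebra_simps)
    also have "\<dots> = (LINT \<omega>|M. indicator E \<omega> * (Q \<omega> * (W u \<omega> - W s \<omega>)))"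
      using Qi[OF u0 u(2)] Qi[OF st(1) u(1)] zero[OF u] by simp
    finally have "R = \<bar>LINT \<omega>|M. indicator E \<omega> * (Q \<omega> * (W u \<omega> - W s \<omega>))\<bar>" by (simp add: R_def)
    also have "\<dots> \<le> (LINT \<omega>|M. \<bar>indicator E \<omega> * (Q \<omega> * (W u \<omega> - W s \<omega>))\<bar>)" by (rule integral_abs_bound)
    also have "\<dots> \<le> (LINT \<omega>|M. (\<bar>\<alpha>\<bar> + \<bar>\<beta>\<bar>) * \<bar>W u \<omega> - W s \<omega>\<bar>)"
    proof (rule integral_mono)
      show "integrable M (\<lambda>\<omega>. \<bar>indicator E \<omega> * (Q \<omega> * (W u \<omega> - W s \<omega>))\<bar>)" using Qi[OF st(1) u(1)] by simp
      show "integrable M (\<lambda>\<omega>. (\<bar>\<alpha>\<bar> + \<bar>\<beta>\<bar>) * \<bar>W u \<omega> - W s \<omega>\<bar>)" using integrable_increment[OF st(1) u(1)] by simp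
      show "\<bar>indicator E \<omega> * (Q \<omega> * (W u \<omega> - W s \<omega>))\<bar> \<le> (\<bar>\<alpha>\<bar> + \<bar>\<beta>\<bar>) * \<bar>W u \<omega> - W s \<omega>\<bar>"
        if "\<omega> \<in> space M" for \<omega>
        using Q[OF that] by (auto simp: abs_mult indicator_def intro!: mult_right_mono)
    qed
    also have "\<dots> \<le> (\<bar>\<alpha>\<bar> + \<bar>\<beta>\<bar>) * sqrt (u - s)"
      using increment_abs_le[OF st(1) u(1)] by (simp add: mult_left_mono)
    finally show ?thesis .
  qed
  have "((\<lambda>u. (\<bar>\<alpha>\<bar> + \<bar>\<beta>\<bar>) * sqrt (u - s)) \<longlongrightarrow> (\<bar>\<alpha>\<bar> + \<bar>\<beta>\<bar>) * sqrt (s - s)) (at_right s)"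
    by (intro tendsto_intros)
  moreover have "eventually (\<lambda>u. R \<le> (\<bar>\<alpha>\<bar> + \<bar>\<beta>\<bar>) * sqrt (u - s)) (at_right s)"
    using eventually_at_right[OF st(2)] bound st(2) by blast
  ultimately have "R \<le> (\<bar>\<alpha>\<bar> + \<bar>\<beta>\<bar>) * sqrt (s - s)"
    by (intro tendsto_lowerbound[where F="at_right s"]) auto
  then show ?thesis unfolding R_def Q_def by simp
qed

end

section \<open>The posterior mean as a conditional expectation, for a prior strictly between 0 and
  1\<close>

locale nondegenerate = observed_BM +
  assumes p01: "0 < p" "p < 1"
begin

definition Mp :: "real \<Rightarrow> 'a \<Rightarrow> real" where "Mp = posterior p \<mu> X"

definition L0 :: real where "L0 = ln (p / (1 - p))"

definition den :: "real \<Rightarrow> real" where "den x = p * exp (2 * \<mu> * x) + 1 - p"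

lemma den_pos: "den x > 0"
  unfolding den_def using p01 by (simp add: add_pos_pos add_diff_eq[symmetric] del: add_diff_eq)

lemma one_minus_Mp: "1 - Mp t \<omega> = 2 * (1 - p) / den (X t \<omega>)"
  by (simp add: Mp_def posterior_def den_def)

lemma one_plus_Mp: "1 + Mp t \<omega> = 2 * p * exp (2 * \<mu> * X t \<omega>) / den (X t \<omega>)"
proof -
  have "1 + Mp t \<omega> = (2 * den (X t \<omega>) - 2 * (1 - p)) / den (X t \<omega>)"
    using den_pos[of "X t \<omega>"] one_minus_Mp[of t \<omega>] by (simp add: diff_divide_distrib)
  then show ?thesis by (simp add: den_def)
qed

lemma Mp_bounds: "-1 < Mp t \<omega>" "Mp t \<omega> < 1"
proof -
  have "1 - Mp t \<omega> > 0" "1 + Mp t \<omega> > 0"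
    unfolding one_minus_Mp one_plus_Mp using den_pos p01 by auto
  then show "-1 < Mp t \<omega>" "Mp t \<omega> < 1" by auto
qed

lemma Mp_abs: "\<bar>Mp t \<omega>\<bar> < 1" using Mp_bounds[of t \<omega>] by auto

lemma logit_Mp: "logit (Mp t \<omega>) = 2 * \<mu> * X t \<omega> + L0"
proof -
  have "(1 + Mp t \<omega>) / (1 - Mp t \<omega>) = p / (1 - p) * exp (2 * \<mu> * X t \<omega>)"
    unfolding one_minus_Mp one_plus_Mp using den_pos[of "X t \<omega>"] p01 by (simp add: field_simps)
  moreover have "ln (p / (1 - p) * exp (2 * \<mu> * X t \<omega>)) = L0 + 2 * \<mu> * X t \<omega>"
    unfolding L0_def using p01 by (subst ln_mult) auto
  ultimately show ?thesis by (simp add: logit_def)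
qed

lemma Mp_eq: "Mp t = (\<lambda>\<omega>. 1 - 2 * (1 - p) / den (X t \<omega>))"
  by (auto simp: Mp_def posterior_def den_def)

lemma den_measurable [measurable]: "den \<in> borel_measurable borel"
  unfolding den_def[abs_def] by measurable

lemma Mp_meas [measurable (raw)]: "0 \<le> t \<Longrightarrow> Mp t \<in> borel_measurable M"
  unfolding Mp_eq by measurable

lemma Mp_adapted: "0 \<le> t \<Longrightarrow> Mp t \<in> borel_measurable (Fm t)"
  unfolding Mp_eq using X_adapted[of t] by measurable

lemma Mp_0: "\<omega> \<in> space M \<Longrightarrow> Mp 0 \<omega> = 2 * p - 1"
  by (simp add: Mp_eq X_0 den_def)

lemma Mp_cont: "\<omega> \<in> space M \<Longrightarrow> continuous_on {0..} (\<lambda>t. Mp t \<omega>)"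
  unfolding Mp_eq den_def using den_pos[unfolded den_def]
  by (intro continuous_intros X_cont) (auto simp: less_imp_neq[symmetric])

lemma integrable_Mp: "0 \<le> t \<Longrightarrow> integrable M (Mp t)"
  using Mp_abs[of t] by (intro integrable_const_bound[where B=1]) (auto intro: less_imp_le)

lemma integrable_\<theta>: "integrable M \<theta>"
  by (intro integrable_const_bound[where B=1] AE_I2) (auto simp: \<theta>_abs)

text \<open>The likelihood identity is tested with \<open>2 / den\<close>. With the prior weights
  its sides become the integrals of \<open>1 - Mp u\<close> over \<open>hyp 1\<close> and of
  \<open>1 + Mp u\<close> over \<open>hyp (-1)\<close>, which are the positive and negative parts of
  \<open>\<theta> - Mp u\<close>.\<close>

lemma posterior_integral_cylinder:
  assumes u: "0 \<le> u" and E: "E \<in> cylinders M X {0..u}"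
  shows "(LINT \<omega>:E|M. \<theta> \<omega> - Mp u \<omega>) = 0"
proof -
  have LR: "likelihood_ratio E u"
    using E u likelihood_ratio_cylinder unfolding cylinders_def by blast
  have "E \<in> gen_events M X {0..u}" using E unfolding sigma_sets_cylinders[symmetric] by (rule sigma_sets.Basic)
  then have [measurable]: "E \<in> sets M" using gen_events_X_sets by auto
  note [measurable] = Mp_meas[OF u] X_meas[OF u]
  let ?f = "\<lambda>\<omega>. indicator (hyp 1 \<inter> E) \<omega> * (1 - Mp u \<omega>)"
  let ?g = "\<lambda>\<omega>. indicator (hyp (-1) \<inter> E) \<omega> * (1 + Mp u \<omega>)"
  have nn: "(\<integral>\<^sup>+\<omega>. ennreal (?f \<omega>) \<partial>M) = (\<integral>\<^sup>+\<omega>. ennreal (?g \<omega>) \<partial>M)"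
  proof -
    have "(\<integral>\<^sup>+\<omega>. ennreal (?f \<omega>) \<partial>M) = (\<integral>\<^sup>+\<omega>. ennreal (1 - p) * (indicator (hyp 1 \<inter> E) \<omega> * ennreal (2 / den (X u \<omega>))) \<partial>M)"
      using p01 den_pos by (intro nn_integral_cong)
        (auto simp: one_minus_Mp indicator_def ennreal_mult'[symmetric] mult_ac less_imp_le)
    also have "\<dots> = ennreal (1 - p) * (\<integral>\<^sup>+\<omega>. indicator (hyp 1 \<inter> E) \<omega> * ennreal (2 / den (X u \<omega>)) \<partial>M)"
      by (rule nn_integral_cmult) measurable
    also have "\<dots> = ennreal p * (\<integral>\<^sup>+\<omega>. indicator (hyp (-1) \<inter> E) \<omega> * (ennreal (2 / den (X u \<omega>)) * ennreal (exp (2 * \<mu> * X u \<omega>))) \<partial>M)"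
      using LR[unfolded likelihood_ratio_def, rule_format, of "\<lambda>x. ennreal (2 / den x)"] by simp
    also have "\<dots> = (\<integral>\<^sup>+\<omega>. ennreal p * (indicator (hyp (-1) \<inter> E) \<omega> * (ennreal (2 / den (X u \<omega>)) * ennreal (exp (2 * \<mu> * X u \<omega>)))) \<partial>M)"
      by (rule nn_integral_cmult[symmetric]) measurable
    also have "\<dots> = (\<integral>\<^sup>+\<omega>. ennreal (?g \<omega>) \<partial>M)"
      using p01 den_pos by (intro nn_integral_cong)
        (auto simp: one_plus_Mp indicator_def ennreal_mult'[symmetric] mult_ac less_imp_le)
    finally show ?thesis .
  qed
  have f: "integrable M ?f" and g: "integrable M ?g"
    using Mp_bounds[of u] by (auto intro!: integrable_const_bound[where B=2] AE_I2 simp: indicator_def abs_if)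
      (smt (verit))+
  have "(LINT \<omega>|M. ?f \<omega>) = (LINT \<omega>|M. ?g \<omega>)"
  proof -
    have "0 \<le> ?f \<omega>" "0 \<le> ?g \<omega>" for \<omega> using Mp_bounds[of u \<omega>] by (auto simp: indicator_def)
    then show ?thesis using nn f g by (simp add: integral_eq_nn_integral)
  qed
  moreover have "(LINT \<omega>:E|M. \<theta> \<omega> - Mp u \<omega>) = (LINT \<omega>|M. ?f \<omega> - ?g \<omega>)"
    unfolding set_lebesgue_integral_def
    using \<theta>_vals by (intro Bochner_Integration.integral_cong) (auto simp: indicator_def)
  ultimately show ?thesis using f g by simp
qed

text \<open>The identity holds at every \<open>u > t\<close>, where \<open>E\<close> is almost
  surely a generated event; path continuity of \<open>Mp\<close> and bounded convergence bring it
  back to \<open>t\<close>.\<close>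

lemma posterior_integral:
  assumes t: "0 \<le> t" and E: "E \<in> FX M X t"
  shows "(LINT \<omega>:E|M. \<theta> \<omega> - Mp t \<omega>) = 0"
proof -
  have [measurable]: "E \<in> sets M" using E FX_sets by auto
  have int: "integrable M (\<lambda>\<omega>. \<theta> \<omega> - Mp u \<omega>)" if "0 \<le> u" for u
    using integrable_Mp[OF that] integrable_\<theta> by simp
  have zero: "(LINT \<omega>:E|M. \<theta> \<omega> - Mp u \<omega>) = 0" if u: "t < u" for u
  proof -
    have u0: "0 \<le> u" using u t by simp
    obtain E' where E': "E' \<in> gen_events M X {0..u}" "AE \<omega> in M. \<omega> \<in> E \<longleftrightarrow> \<omega> \<in> E'"
      using FX_completed[OF E u(1)] by blast
    have [measurable]: "E' \<in> sets M" using E' gen_events_X_sets by auto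
    have cyl: "cylinders M X {0..u} \<subseteq> sets M"
      using gen_events_X_sets[of u] unfolding sigma_sets_cylinders[symmetric] by (auto intro: sigma_sets.Basic)
    have sp: "space M \<in> cylinders M X {0..u}"
      unfolding cylinders_def by (auto intro!: exI[of _ "{}"] exI[of _ "\<lambda>_. {}"])
    have "(LINT \<omega>:E'|M. \<theta> \<omega> - Mp u \<omega>) = 0"
    proof (rule set_integral_zero_sigma_sets[OF int[OF u0] Int_stable_cylinders cyl])
      show "(LINT \<omega>|M. \<theta> \<omega> - Mp u \<omega>) = 0"
        using posterior_integral_cylinder[OF u0 sp] by (simp add: set_integral_space[OF int[OF u0]])
      show "E' \<in> sigma_sets (space M) (cylinders M X {0..u})" unfolding sigma_sets_cylinders by (rule E')
    qed (rule posterior_integral_cylinder[OF u0])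
    then show ?thesis using E'(2) Mp_meas[OF u0]
      by (subst set_integral_cong_AE_set[of _ _ _ E']) auto
  qed
  define u where "u n = t + inverse (real (Suc n))" for n
  have u: "u n > t" for n by (simp add: u_def)
  have lim: "u \<longlonglongrightarrow> t" unfolding u_def using LIMSEQ_inverse_real_of_nat_add[of t] by simp
  have "(\<lambda>n. LINT \<omega>|M. indicator E \<omega> *\<^sub>R (\<theta> \<omega> - Mp (u n) \<omega>)) \<longlonglongrightarrow> (LINT \<omega>|M. indicator E \<omega> *\<^sub>R (\<theta> \<omega> - Mp t \<omega>))"
  proof (rule integral_dominated_convergence[where w="\<lambda>_. 2"])
    show "(\<lambda>\<omega>. indicator E \<omega> *\<^sub>R (\<theta> \<omega> - Mp t \<omega>)) \<in> borel_measurable M" using t by measurable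
    show "(\<lambda>\<omega>. indicator E \<omega> *\<^sub>R (\<theta> \<omega> - Mp (u n) \<omega>)) \<in> borel_measurable M" for n
      using Mp_meas[OF order.trans[OF t less_imp_le[OF u[of n]]]] by measurable
    show "AE \<omega> in M. (\<lambda>n. indicator E \<omega> *\<^sub>R (\<theta> \<omega> - Mp (u n) \<omega>)) \<longlonglongrightarrow> indicator E \<omega> *\<^sub>R (\<theta> \<omega> - Mp t \<omega>)"
    proof (rule AE_I2)
      fix \<omega> assume "\<omega> \<in> space M"
      then have "(\<lambda>n. Mp (u n) \<omega>) \<longlonglongrightarrow> Mp t \<omega>"
        using u t by (intro continuous_on_tendsto_compose[OF Mp_cont lim]) (auto intro!: always_eventually less_imp_le order.trans[OF t])
      then show "(\<lambda>n. indicator E \<omega> *\<^sub>R (\<theta> \<omega> - Mp (u n) \<omega>)) \<longlonglongrightarrow> indicator E \<omega> *\<^sub>R (\<theta> \<omega> - Mp t \<omega>)"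
        by (intro tendsto_intros)
    qed
    show "AE \<omega> in M. norm (indicator E \<omega> *\<^sub>R (\<theta> \<omega> - Mp (u n) \<omega>)) \<le> 2" for n
    proof (rule AE_I2)
      fix \<omega> assume "\<omega> \<in> space M"
      then show "norm (indicator E \<omega> *\<^sub>R (\<theta> \<omega> - Mp (u n) \<omega>)) \<le> 2"
        using \<theta>_vals[of \<omega>] Mp_bounds[of "u n" \<omega>] by (auto simp: indicator_def)
    qed
  qed simp
  moreover have "(LINT \<omega>|M. indicator E \<omega> *\<^sub>R (\<theta> \<omega> - Mp (u n) \<omega>)) = 0" for n
    using zero[OF u[of n]] by (simp add: set_lebesgue_integral_def)
  ultimately show ?thesis by (simp add: set_lebesgue_integral_def LIMSEQ_const_iff)
qed

lemma set_integral_\<theta>_eq: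
  assumes t: "0 \<le> t" and E: "E \<in> FX M X t"
  shows "(LINT \<omega>:E|M. \<theta> \<omega>) = (LINT \<omega>:E|M. Mp t \<omega>)"
proof -
  have E': "E \<in> sets M" using E FX_sets by auto
  have "set_integrable M E \<theta>" "set_integrable M E (Mp t)"
    using integrable_mult_indicator[OF E' integrable_\<theta>] integrable_mult_indicator[OF E' integrable_Mp[OF t]]
    by (auto simp: set_integrable_def)
  then show ?thesis using posterior_integral[OF assms] by (simp add: set_integral_diff)
qed

lemma cond_exp_\<theta>: "0 \<le> t \<Longrightarrow> AE \<omega> in M. real_cond_exp M (Fm t) \<theta> \<omega> = Mp t \<omega>"
  by (rule Fm.real_cond_exp_charact) (auto simp: set_integral_\<theta>_eq integrable_\<theta> integrable_Mp Mp_adapted)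

lemma cond_exp_Mp: "0 \<le> s \<Longrightarrow> s \<le> t \<Longrightarrow> AE \<omega> in M. real_cond_exp M (Fm s) (Mp t) \<omega> = Mp s \<omega>"
proof (rule Fm.real_cond_exp_charact)
  fix E assume st: "0 \<le> s" "s \<le> t" and "E \<in> sets (Fm s)"
  then have "E \<in> FX M X s" "E \<in> FX M X t" using FX_mono[of s t] by auto
  then show "(LINT \<omega>:E|M. Mp t \<omega>) = (LINT \<omega>:E|M. Mp s \<omega>)"
    using set_integral_\<theta>_eq[of s E] set_integral_\<theta>_eq[of t E] st by simp
qed (auto simp: integrable_Mp Mp_adapted)

lemma integral_mult_\<theta>:
  assumes t: "0 \<le> t" and Z: "Z \<in> borel_measurable (Fm t)" "integrable M Z"
  shows "(LINT \<omega>|M. Z \<omega> * \<theta> \<omega>) = (LINT \<omega>|M. Z \<omega> * Mp t \<omega>)"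
    and "integrable M (\<lambda>\<omega>. Z \<omega> * \<theta> \<omega>)" and "integrable M (\<lambda>\<omega>. Z \<omega> * Mp t \<omega>)"
proof -
  have [measurable]: "Z \<in> borel_measurable M" using Z(2) by simp
  show int: "integrable M (\<lambda>\<omega>. Z \<omega> * \<theta> \<omega>)"
    by (intro Bochner_Integration.integrable_bound[OF Z(2)] AE_I2) (auto simp: abs_mult \<theta>_abs)
  show "integrable M (\<lambda>\<omega>. Z \<omega> * Mp t \<omega>)"
    using Mp_abs[of t] t by (intro Bochner_Integration.integrable_bound[OF Z(2)] AE_I2)
      (auto simp: abs_mult mult_left_le less_imp_le)
  have "(LINT \<omega>|M. Z \<omega> * Mp t \<omega>) = (LINT \<omega>|M. Z \<omega> * real_cond_exp M (Fm t) \<theta> \<omega>)"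
    using cond_exp_\<theta>[OF t] t by (intro integral_cong_AE) auto
  also have "\<dots> = (LINT \<omega>|M. Z \<omega> * \<theta> \<omega>)" by (rule Fm.real_cond_exp_intg(2)[OF int Z(1)]) simp
  finally show "(LINT \<omega>|M. Z \<omega> * \<theta> \<omega>) = (LINT \<omega>|M. Z \<omega> * Mp t \<omega>)" by simp
qed

lemma integrable_logit_square: assumes t: "0 \<le> t" shows "integrable M (\<lambda>\<omega>. (logit (Mp t \<omega>))\<^sup>2)"
proof (rule Bochner_Integration.integrable_bound)
  let ?k = "2 * (\<bar>2 * \<mu> * \<mu> * t\<bar> + \<bar>L0\<bar>)\<^sup>2"
  show "integrable M (\<lambda>\<omega>. ?k + 2 * (2 * \<mu>)\<^sup>2 * (W t \<omega>)\<^sup>2)"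
    using integrable_W_square[OF t] by simp
  show "(\<lambda>\<omega>. (logit (Mp t \<omega>))\<^sup>2) \<in> borel_measurable M" using t by measurable
  show "AE \<omega> in M. norm ((logit (Mp t \<omega>))\<^sup>2) \<le> norm (?k + 2 * (2 * \<mu>)\<^sup>2 * (W t \<omega>)\<^sup>2)"
  proof (rule AE_I2)
    fix \<omega> assume w: "\<omega> \<in> space M"
    have sq: "(x + y)\<^sup>2 \<le> 2 * x\<^sup>2 + 2 * y\<^sup>2" for x y :: real
      using zero_le_power2[of "x - y"] by (simp add: power2_sum power2_diff)
    have "logit (Mp t \<omega>) = (2 * \<mu> * \<mu> * t * \<theta> \<omega> + L0) + 2 * \<mu> * W t \<omega>"
      by (simp add: logit_Mp X_def algebra_simps)
    then have "(logit (Mp t \<omega>))\<^sup>2 \<le> 2 * (2 * \<mu> * \<mu> * t * \<theta> \<omega> + L0)\<^sup>2 + 2 * (2 * \<mu> * W t \<omega>)\<^sup>2"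
      using sq by metis
    also have "(2 * \<mu> * \<mu> * t * \<theta> \<omega> + L0)\<^sup>2 \<le> (\<bar>2 * \<mu> * \<mu> * t\<bar> + \<bar>L0\<bar>)\<^sup>2"
      using \<theta>_vals[OF w] by (intro power2_le_iff_abs_le[THEN iffD2]) auto
    finally show "norm ((logit (Mp t \<omega>))\<^sup>2) \<le> norm (?k + 2 * (2 * \<mu>)\<^sup>2 * (W t \<omega>)\<^sup>2)"
      by (simp add: power_mult_distrib algebra_simps)
  qed
qed

text \<open>Quadratic growth in the log-odds is the integrability class used from here on. It is
  natural because the log-odds are affine in \<open>W\<close> with bounded coefficients at a fixed
  time.\<close>

lemma integrable_of_Mp:
  assumes t: "0 \<le> t" and [measurable]: "q \<in> borel_measurable borel"
    and bd: "\<And>m. \<bar>m\<bar> < 1 \<Longrightarrow> \<bar>q m\<bar> \<le> a + b * (logit m)\<^sup>2"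
  shows "integrable M (\<lambda>\<omega>. q (Mp t \<omega>))"
proof (rule Bochner_Integration.integrable_bound)
  show "integrable M (\<lambda>\<omega>. a + b * (logit (Mp t \<omega>))\<^sup>2)" using integrable_logit_square[OF t] by simp
  show "(\<lambda>\<omega>. q (Mp t \<omega>)) \<in> borel_measurable M" using t by measurable
  show "AE \<omega> in M. norm (q (Mp t \<omega>)) \<le> norm (a + b * (logit (Mp t \<omega>))\<^sup>2)"
  proof (rule AE_I2)
    fix \<omega> show "norm (q (Mp t \<omega>)) \<le> norm (a + b * (logit (Mp t \<omega>))\<^sup>2)"
      using bd[OF Mp_abs[of t \<omega>]] by simp
  qed
qed

section \<open>Submartingale inequality for convex functions and exact drift for log-odds functions
  of \<open>Mp\<close>\<close>

lemma Mp_jensen: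
  assumes st: "0 \<le> s" "s \<le> t" and E: "E \<in> FX M X s"
    and q: "convex_on {-1<..<1} q" "q \<in> borel_measurable borel"
    and bd: "\<And>m. \<bar>m\<bar> < 1 \<Longrightarrow> \<bar>q m\<bar> \<le> a + b * (logit m)\<^sup>2"
  shows "(LINT \<omega>|M. indicator E \<omega> * q (Mp s \<omega>)) \<le> (LINT \<omega>|M. indicator E \<omega> * q (Mp t \<omega>))"
proof -
  have t: "0 \<le> t" using st by simp
  note [measurable] = q(2)
  have [measurable]: "E \<in> sets M" using E FX_sets by auto
  note it = integrable_of_Mp[OF t q(2) bd] and is' = integrable_of_Mp[OF st(1) q(2) bd]
  have "AE \<omega> in M. q (real_cond_exp M (Fm s) (Mp t) \<omega>) \<le> real_cond_exp M (Fm s) (\<lambda>\<omega>. q (Mp t \<omega>)) \<omega>"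
    using Mp_bounds by (intro Fm.real_cond_exp_jensens_inequality(2)[where I="{-1<..<1}" and a="-1" and b=1] integrable_Mp t it q)
      auto
  then have le: "AE \<omega> in M. q (Mp s \<omega>) \<le> real_cond_exp M (Fm s) (\<lambda>\<omega>. q (Mp t \<omega>)) \<omega>"
    using cond_exp_Mp[OF st] by eventually_elim simp
  have iE: "integrable M (\<lambda>\<omega>. indicator E \<omega> * q (Mp u \<omega>))" if "integrable M (\<lambda>\<omega>. q (Mp u \<omega>))" for u
    using integrable_real_mult_indicator[OF \<open>E \<in> sets M\<close> that] by (simp add: mult.commute)
  have c: "integrable M (\<lambda>\<omega>. indicator E \<omega> * real_cond_exp M (Fm s) (\<lambda>\<omega>. q (Mp t \<omega>)) \<omega>)"
    "(LINT \<omega>|M. indicator E \<omega> * real_cond_exp M (Fm s) (\<lambda>\<omega>. q (Mp t \<omega>)) \<omega>) = (LINT \<omega>|M. indicator E \<omega> * q (Mp t \<omega>))"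
    using E t by (auto intro!: Fm.real_cond_exp_intg iE it borel_measurable_indicator)
  have "(LINT \<omega>|M. indicator E \<omega> * q (Mp s \<omega>)) \<le> (LINT \<omega>|M. indicator E \<omega> * real_cond_exp M (Fm s) (\<lambda>\<omega>. q (Mp t \<omega>)) \<omega>)"
    using le by (intro integral_mono_AE iE is' c) (auto elim!: eventually_mono simp: indicator_def)
  then show ?thesis using c by simp
qed

lemma abs_logit_le: "\<bar>logit m\<bar> \<le> 1 + (logit m)\<^sup>2"
proof -
  have "0 \<le> (\<bar>logit m\<bar> - 1)\<^sup>2" by simp
  then have "2 * \<bar>logit m\<bar> \<le> 1 + (logit m)\<^sup>2" by (simp add: power2_diff)
  then show ?thesis by linarith
qed

text \<open>The family contains \<open>U (j * m)\<close> for both signs (\<open>U_affine\<close>)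
  and \<open>F0\<close> (\<open>F0_affine\<close>), so one drift formula and one stopping theorem
  serve all stages.\<close>

definition affine_logit :: "real \<Rightarrow> real \<Rightarrow> real \<Rightarrow> real \<Rightarrow> real \<Rightarrow> real" where
  "affine_logit \<alpha> \<beta> \<gamma> \<delta> m = (\<alpha> + \<beta> * m) * logit m + \<gamma> + \<delta> * m"

lemma affine_logit_measurable [measurable]: "affine_logit \<alpha> \<beta> \<gamma> \<delta> \<in> borel_measurable borel"
  unfolding affine_logit_def[abs_def] by measurable

lemma affine_logit_abs:
  assumes m: "\<bar>m\<bar> < 1"
  shows "\<bar>affine_logit \<alpha> \<beta> \<gamma> \<delta> m\<bar> \<le> (\<bar>\<alpha>\<bar> + \<bar>\<beta>\<bar>) * \<bar>logit m\<bar> + (\<bar>\<gamma>\<bar> + \<bar>\<delta>\<bar>)"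
proof -
  have b: "\<bar>x * m\<bar> \<le> \<bar>x\<bar>" for x using m by (simp add: abs_mult mult_left_le)
  have "\<bar>\<alpha> + \<beta> * m\<bar> \<le> \<bar>\<alpha>\<bar> + \<bar>\<beta>\<bar>" using b[of \<beta>] by linarith
  then have "\<bar>(\<alpha> + \<beta> * m) * logit m\<bar> \<le> (\<bar>\<alpha>\<bar> + \<bar>\<beta>\<bar>) * \<bar>logit m\<bar>"
    unfolding abs_mult by (intro mult_right_mono) auto
  then show ?thesis using b[of \<delta>] unfolding affine_logit_def by linarith
qed

lemma affine_logit_bound:
  assumes m: "\<bar>m\<bar> < 1"
  shows "\<bar>affine_logit \<alpha> \<beta> \<gamma> \<delta> m\<bar> \<le> (\<bar>\<alpha>\<bar> + \<bar>\<beta>\<bar> + \<bar>\<gamma>\<bar> + \<bar>\<delta>\<bar>) + (\<bar>\<alpha>\<bar> + \<bar>\<beta>\<bar>) * (logit m)\<^sup>2"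
  using affine_logit_abs[OF m, of \<alpha> \<beta> \<gamma> \<delta>] mult_left_mono[OF abs_logit_le[of m], of "\<bar>\<alpha>\<bar> + \<bar>\<beta>\<bar>"]
  by (simp add: algebra_simps)

text \<open>Since \<open>logit (Mp t)\<close> is affine in \<open>X t\<close> and \<open>Mp t\<close> may be replaced by \<open>\<theta>\<close> under the expectation,
  the drift of such a function of \<open>Mp t\<close> is read off from \<open>X t - X s = \<mu> \<theta> (t - s) + (W t - W s)\<close>.\<close>

lemma affine_logit_drift:
  assumes st: "0 \<le> s" "s \<le> t" and E: "E \<in> FX M X s"
  shows "(LINT \<omega>|M. indicator E \<omega> * affine_logit \<alpha> \<beta> \<gamma> \<delta> (Mp t \<omega>)) =
    (LINT \<omega>|M. indicator E \<omega> * affine_logit \<alpha> \<beta> \<gamma> \<delta> (Mp s \<omega>)) + 2 * \<mu>\<^sup>2 * (t - s) * (LINT \<omega>|M. indicator E \<omega> * (\<alpha> * \<theta> \<omega> + \<beta>))"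
proof (cases "s = t")
  case False
  then have st': "s < t" and t: "0 \<le> t" using st by auto
  have EM [measurable]: "E \<in> sets M" using E FX_sets by auto
  let ?L = "\<lambda>r \<omega>. indicator E \<omega> * logit (Mp r \<omega>)"
  let ?F = "\<lambda>r \<omega>. indicator E \<omega> * ((\<alpha> + \<beta> * \<theta> \<omega>) * logit (Mp r \<omega>) + \<gamma> + \<delta> * \<theta> \<omega>)"
  have logit_int: "integrable M (\<lambda>\<omega>. logit (Mp r \<omega>))" if "0 \<le> r" for r
    by (rule integrable_of_Mp[OF that, where a=1 and b=1]) (use abs_logit_le in auto)
  \<comment> \<open>Every \<open>Mp r\<close> outside the logarithm is replaced by
    \<open>\<theta>\<close>. Afterwards the integrands at two times differ only in their log-odds,
    which are affine in \<open>X\<close>.\<close>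
  have eq: "(LINT \<omega>|M. indicator E \<omega> * affine_logit \<alpha> \<beta> \<gamma> \<delta> (Mp r \<omega>)) = (LINT \<omega>|M. ?F r \<omega>) \<and> integrable M (?F r)"
    if r: "s \<le> r" for r
  proof -
    have r0: "0 \<le> r" using r st by simp
    have EF: "E \<in> FX M X r" using E FX_mono[OF r] by auto
    have L: "?L r \<in> borel_measurable (Fm r)" "integrable M (?L r)"
      using Mp_adapted[OF r0] EF integrable_real_mult_indicator[OF EM logit_int[OF r0]]
      by (auto simp: mult.commute intro!: borel_measurable_times borel_measurable_indicator measurable_compose[OF _ borel_measurable_logit])
    have I: "(indicator E :: 'a \<Rightarrow> real) \<in> borel_measurable (Fm r)" "integrable M (indicator E :: 'a \<Rightarrow> real)"
      using EF by (auto intro!: borel_measurable_indicator simp: integrable_indicator_iff emeasure_eq_measure)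
    note LL = integral_mult_\<theta>[OF r0 L] and II = integral_mult_\<theta>[OF r0 I]
    have "(LINT \<omega>|M. indicator E \<omega> * affine_logit \<alpha> \<beta> \<gamma> \<delta> (Mp r \<omega>))
       = (LINT \<omega>|M. \<alpha> * ?L r \<omega> + \<beta> * (?L r \<omega> * Mp r \<omega>) + \<gamma> * indicator E \<omega> + \<delta> * (indicator E \<omega> * Mp r \<omega>))"
      by (intro Bochner_Integration.integral_cong) (auto simp: affine_logit_def algebra_simps)
    also have "\<dots> = (LINT \<omega>|M. \<alpha> * ?L r \<omega> + \<beta> * (?L r \<omega> * \<theta> \<omega>) + \<gamma> * indicator E \<omega> + \<delta> * (indicator E \<omega> * \<theta> \<omega>))"
      using L I LL II by simp
    also have "\<dots> = (LINT \<omega>|M. ?F r \<omega>)"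
      by (intro Bochner_Integration.integral_cong) (auto simp: algebra_simps)
    finally have 1: "(LINT \<omega>|M. indicator E \<omega> * affine_logit \<alpha> \<beta> \<gamma> \<delta> (Mp r \<omega>)) = (LINT \<omega>|M. ?F r \<omega>)" .
    have "integrable M (\<lambda>\<omega>. \<alpha> * ?L r \<omega> + \<beta> * (?L r \<omega> * \<theta> \<omega>) + \<gamma> * indicator E \<omega> + \<delta> * (indicator E \<omega> * \<theta> \<omega>))"
      using L I LL II by simp
    then have "integrable M (?F r)" by (simp add: algebra_simps)
    with 1 show ?thesis by simp
  qed
  let ?D = "\<lambda>\<omega>. indicator E \<omega> * ((\<alpha> + \<beta> * \<theta> \<omega>) * (W t \<omega> - W s \<omega>))"
  let ?T = "\<lambda>\<omega>. indicator E \<omega> * (\<alpha> * \<theta> \<omega> + \<beta>)"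
  have T: "integrable M ?T"
  proof (intro integrable_const_bound[where B="\<bar>\<alpha>\<bar> + \<bar>\<beta>\<bar>"] AE_I2)
    fix \<omega> assume "\<omega> \<in> space M"
    then have "\<theta> \<omega> \<in> {-1, 1}" by (rule \<theta>_vals)
    then show "norm (indicator E \<omega> * (\<alpha> * \<theta> \<omega> + \<beta>)) \<le> \<bar>\<alpha>\<bar> + \<bar>\<beta>\<bar>" by (auto simp: indicator_def)
  qed measurable
  have split: "?F t \<omega> - ?F s \<omega> = 2 * \<mu>\<^sup>2 * (t - s) * ?T \<omega> + 2 * \<mu> * ?D \<omega>" if "\<omega> \<in> space M" for \<omega>
  proof -
    have th: "\<theta> \<omega> * \<theta> \<omega> = 1" using \<theta>_vals[OF that] by auto
    have "?F t \<omega> - ?F s \<omega> = indicator E \<omega> * ((\<alpha> + \<beta> * \<theta> \<omega>) * (logit (Mp t \<omega>) - logit (Mp s \<omega>)))"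
      by (simp add: algebra_simps)
    also have "logit (Mp t \<omega>) - logit (Mp s \<omega>) = 2 * \<mu>\<^sup>2 * (t - s) * \<theta> \<omega> + 2 * \<mu> * (W t \<omega> - W s \<omega>)"
      by (simp add: logit_Mp X_def algebra_simps power2_eq_square)
    also have "indicator E \<omega> * ((\<alpha> + \<beta> * \<theta> \<omega>) * (2 * \<mu>\<^sup>2 * (t - s) * \<theta> \<omega> + 2 * \<mu> * (W t \<omega> - W s \<omega>)))
      = 2 * \<mu>\<^sup>2 * (t - s) * (indicator E \<omega> * (\<alpha> * \<theta> \<omega> + \<beta> * (\<theta> \<omega> * \<theta> \<omega>))) + 2 * \<mu> * ?D \<omega>"
      by (simp add: algebra_simps)
    finally show ?thesis by (simp add: th)
  qed
  have D: "integrable M ?D"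
  proof -
    have "integrable M (\<lambda>\<omega>. (?F t \<omega> - ?F s \<omega> - 2 * \<mu>\<^sup>2 * (t - s) * ?T \<omega>) / (2 * \<mu>))"
      using eq[of t] eq[of s] T st by simp
    then show ?thesis
      by (subst Bochner_Integration.integrable_cong[OF refl, where g="\<lambda>\<omega>. (?F t \<omega> - ?F s \<omega> - 2 * \<mu>\<^sup>2 * (t - s) * ?T \<omega>) / (2 * \<mu>)"])
        (use split \<mu>_pos in auto)
  qed
  have "(LINT \<omega>|M. ?F t \<omega>) - (LINT \<omega>|M. ?F s \<omega>) = (LINT \<omega>|M. ?F t \<omega> - ?F s \<omega>)"
    using eq[of t] eq[of s] st by simp
  also have "\<dots> = (LINT \<omega>|M. 2 * \<mu>\<^sup>2 * (t - s) * ?T \<omega> + 2 * \<mu> * ?D \<omega>)"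
    by (intro Bochner_Integration.integral_cong split) auto
  also have "\<dots> = 2 * \<mu>\<^sup>2 * (t - s) * (LINT \<omega>|M. ?T \<omega>)"
    using T D increment_martingale[OF st(1) st' E, of \<alpha> \<beta>] by simp
  finally show ?thesis using eq[of t] eq[of s] st by simp
qed simp

end

subsection \<open>Hitting times\<close>

text \<open>For a continuous path and a closed target the admissible times form a closed set, so a
  finite infimum is attained.\<close>

lemma hit_cases:
  assumes cont: "continuous_on {0..} (\<lambda>t. Y t \<omega>)" and S: "closed S"
  obtains "hit Y S \<sigma> \<omega> = \<infinity>" "\<And>r. 0 \<le> r \<Longrightarrow> \<sigma> \<omega> \<le> ereal r \<Longrightarrow> Y r \<omega> \<notin> S"
  | r where "hit Y S \<sigma> \<omega> = ereal r" "0 \<le> r" "\<sigma> \<omega> \<le> ereal r" "Y r \<omega> \<in> S"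
    "\<And>s. 0 \<le> s \<Longrightarrow> \<sigma> \<omega> \<le> ereal s \<Longrightarrow> Y s \<omega> \<in> S \<Longrightarrow> r \<le> s"
proof -
  define R where "R = {r. 0 \<le> r \<and> \<sigma> \<omega> \<le> ereal r \<and> Y r \<omega> \<in> S}"
  have hit: "hit Y S \<sigma> \<omega> = Inf (ereal ` R)"
    unfolding hit_def R_def by (rule arg_cong[where f=Inf]) auto
  show ?thesis
  proof (cases "R = {}")
    case True
    then have "hit Y S \<sigma> \<omega> = \<infinity>" using hit by (simp add: top_ereal_def)
    then show ?thesis using that(1) True by (auto simp: R_def)
  next
    case False
    have "closed ({0..} \<inter> (\<lambda>t. Y t \<omega>) -` S)"
      using cont S by (intro continuous_closed_preimage) auto
    moreover have "closed {r. \<sigma> \<omega> \<le> ereal r}"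
      by (intro closed_Collect_le continuous_intros)
    moreover have "R = ({0..} \<inter> (\<lambda>t. Y t \<omega>) -` S) \<inter> {r. \<sigma> \<omega> \<le> ereal r}" by (auto simp: R_def)
    ultimately have "closed R" by auto
    have bdd: "bdd_below R" by (rule bdd_belowI[of _ 0]) (auto simp: R_def)
    define r where "r = Inf R"
    have r: "r \<in> R" unfolding r_def by (rule closed_contains_Inf[OF False bdd \<open>closed R\<close>])
    have le: "r \<le> s" if "s \<in> R" for s unfolding r_def by (rule cInf_lower[OF that bdd])
    have "Inf (ereal ` R) = ereal r"
      using r le by (intro Inf_eqI) auto
    then show ?thesis using that(2)[of r] r le hit by (auto simp: R_def)
  qed
qed

lemma hit_ge: "\<sigma> \<omega> \<le> hit Y S \<sigma> \<omega>"
  unfolding hit_def by (rule Inf_greatest) auto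

lemma hit_nonneg: "0 \<le> hit Y S \<sigma> \<omega>"
  unfolding hit_def by (rule Inf_greatest) auto

lemma hit_le_iff:
  assumes cont: "continuous_on {0..} (\<lambda>t. Y t \<omega>)" and S: "closed S"
  shows "hit Y S \<sigma> \<omega> \<le> ereal t \<longleftrightarrow> (\<exists>r. 0 \<le> r \<and> r \<le> t \<and> \<sigma> \<omega> \<le> ereal r \<and> Y r \<omega> \<in> S)"
  using assms
proof (cases rule: hit_cases[where \<sigma>=\<sigma>])
  case 1 then show ?thesis by auto
next
  case (2 r)
  then show ?thesis by (auto intro: exI[of _ r] order.trans)
qed

text \<open>Countably many dense times in \<open>[0, t]\<close>. The end point is added because a
  hit exactly at \<open>t\<close> cannot be approximated from the right within the interval.\<close>

definition rat_times :: "real \<Rightarrow> real set" where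
  "rat_times t = insert t (\<rat> \<inter> {0..t})"

lemma countable_rat_times: "countable (rat_times t)"
  unfolding rat_times_def using countable_rat by auto

lemma rat_times_bounds: "0 \<le> t \<Longrightarrow> q \<in> rat_times t \<Longrightarrow> 0 \<le> q \<and> q \<le> t"
  unfolding rat_times_def by auto

text \<open>A countable description of the hitting event that uses no time after \<open>t\<close>,
  hence an event of the filtration at \<open>t\<close>. From left to right, a hit is approximated
  from the right, which keeps the times beyond \<open>\<sigma>\<close> and meets the slightly
  lowered thresholds; conversely, near-hits accumulate at a true hit by compactness.\<close>

lemma hit_le_iff_rat_times:
  assumes cont: "continuous_on {0..} (\<lambda>t. Y t \<omega>)" and f: "continuous_on UNIV f" and t: "0 \<le> t"
  shows "hit Y {x. c \<le> f x} \<sigma> \<omega> \<le> ereal t \<longleftrightarrow>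
    (\<forall>n. \<exists>q\<in>rat_times t. \<sigma> \<omega> \<le> ereal q \<and> c - inverse (real (Suc n)) < f (Y q \<omega>))" (is "?L \<longleftrightarrow> ?R")
proof -
  have S: "closed {x. c \<le> f x}" using f by (intro closed_Collect_le continuous_intros)
  have fY: "continuous_on {0..} (\<lambda>r. f (Y r \<omega>))"
    by (rule continuous_on_compose2[OF f cont]) auto
  show ?thesis
  proof
    assume ?L
    then obtain r where r: "0 \<le> r" "r \<le> t" "\<sigma> \<omega> \<le> ereal r" "c \<le> f (Y r \<omega>)"
      using hit_le_iff[where Y=Y and \<omega>=\<omega> and \<sigma>=\<sigma> and t=t, OF cont S] by auto
    show ?R
    proof
      fix n
      show "\<exists>q\<in>rat_times t. \<sigma> \<omega> \<le> ereal q \<and> c - inverse (real (Suc n)) < f (Y q \<omega>)"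
      proof (cases "r = t")
        case True then show ?thesis using r by (intro bexI[of _ t]) (auto simp: rat_times_def intro: less_le_trans[of _ c])
      next
        case False
        then have rt: "r < t" using r by simp
        have "((\<lambda>q. f (Y q \<omega>)) \<longlongrightarrow> f (Y r \<omega>)) (at r within {0..})"
          using fY r unfolding continuous_on_def by auto
        then have "((\<lambda>q. f (Y q \<omega>)) \<longlongrightarrow> f (Y r \<omega>)) (at_right r)"
          by (rule tendsto_within_subset) (use r in auto)
        moreover have "c - inverse (real (Suc n)) < f (Y r \<omega>)" using r by (auto intro: less_le_trans[of _ c])
        ultimately have "eventually (\<lambda>q. c - inverse (real (Suc n)) < f (Y q \<omega>)) (at_right r)"
          by (rule order_tendstoD)
        then obtain b where b: "b > r" "\<And>q. r < q \<Longrightarrow> q < b \<Longrightarrow> c - inverse (real (Suc n)) < f (Y q \<omega>)"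
          unfolding eventually_at_right[OF rt] by blast
        obtain q where q: "q \<in> \<rat>" "r < q" "q < min b t"
          using Rats_dense_in_real[of r "min b t"] b rt by auto
        have "\<sigma> \<omega> \<le> ereal q" using r(3) q(2) by (meson ereal_less_eq(3) less_imp_le order.trans)
        then show ?thesis using q b r by (intro bexI[of _ q]) (auto simp: rat_times_def)
      qed
    qed
  next
    assume ?R
    then obtain q where q: "\<And>n. q n \<in> rat_times t" "\<And>n. \<sigma> \<omega> \<le> ereal (q n)"
      "\<And>n. c - inverse (real (Suc n)) < f (Y (q n) \<omega>)" by metis
    have qb: "q n \<in> {0..t}" for n using rat_times_bounds[OF t q(1)] by simp
    have "compact {0..t}" by simp
    then have "seq_compact {0..t}" by (rule compact_imp_seq_compact)
    then obtain r k where r: "r \<in> {0..t}" and k: "strict_mono k" and lim: "(q \<circ> k) \<longlonglongrightarrow> r"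
      using qb unfolding seq_compact_def by blast
    have "\<sigma> \<omega> \<le> ereal r"
    proof (rule LIMSEQ_le_const)
      show "(\<lambda>n. ereal ((q \<circ> k) n)) \<longlonglongrightarrow> ereal r" using lim by (simp add: o_def)
    qed (use q(2) in auto)
    moreover have "c \<le> f (Y r \<omega>)"
    proof (rule LIMSEQ_le)
      show "(\<lambda>n. f (Y ((q \<circ> k) n) \<omega>)) \<longlonglongrightarrow> f (Y r \<omega>)"
        using qb r by (intro continuous_on_tendsto_compose[OF fY lim]) (auto intro!: always_eventually)
      have "(\<lambda>n. c - inverse (real (Suc n))) \<longlonglongrightarrow> c"
        using LIMSEQ_inverse_real_of_nat_add_minus[of c] by simp
      then show "(\<lambda>n. c - inverse (real (Suc (k n)))) \<longlonglongrightarrow> c"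
        using LIMSEQ_subseq_LIMSEQ[OF _ k, of "\<lambda>n. c - inverse (real (Suc n))" c] by (simp add: o_def)
    qed (use less_imp_le[OF q(3)] in auto)
    ultimately show ?L using hit_le_iff[where Y=Y and \<omega>=\<omega> and \<sigma>=\<sigma> and t=t, OF cont S] r by auto
  qed
qed

subsection \<open>The candidate rule is a decision rule\<close>

definition D_star :: "(real \<Rightarrow> 'a \<Rightarrow> real) \<Rightarrow> real \<Rightarrow> 'a \<Rightarrow> nat \<Rightarrow> real" where
  "D_star Y A \<omega> n = d_star Y A \<omega> * (-1) ^ n"

lemma closed_abs_ge: "closed {x::real. A \<le> \<bar>x\<bar>}"
  by (intro closed_Collect_le continuous_intros)

lemma closed_mult_ge: "closed {x::real. B \<le> c * x}"
  by (intro closed_Collect_le continuous_intros)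

context
  fixes Y :: "real \<Rightarrow> 'a \<Rightarrow> real" and A B :: real and \<omega> :: 'a
  assumes cont: "continuous_on {0..} (\<lambda>t. Y t \<omega>)" and A: "0 < A"
begin

lemma tau0_star_attained:
  assumes "tau0_star Y A \<omega> = ereal r"
  shows "0 \<le> r" "A \<le> \<bar>Y r \<omega>\<bar>" "\<And>s. 0 \<le> s \<Longrightarrow> s < r \<Longrightarrow> \<bar>Y s \<omega>\<bar> < A"
proof -
  have "hit Y {x. A \<le> \<bar>x\<bar>} (\<lambda>_. 0) \<omega> = ereal r" using assms by (simp add: tau0_star_def)
  with cont closed_abs_ge[of A] show "0 \<le> r" "A \<le> \<bar>Y r \<omega>\<bar>" "\<And>s. 0 \<le> s \<Longrightarrow> s < r \<Longrightarrow> \<bar>Y s \<omega>\<bar> < A"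
    by (cases rule: hit_cases[where Y=Y and \<omega>=\<omega> and \<sigma>="\<lambda>_. 0"]; force)+
qed

lemma tau0_star_infinite:
  assumes "tau0_star Y A \<omega> = \<infinity>" "0 \<le> s" shows "\<bar>Y s \<omega>\<bar> < A"
proof -
  have "hit Y {x. A \<le> \<bar>x\<bar>} (\<lambda>_. 0) \<omega> = \<infinity>" using assms by (simp add: tau0_star_def)
  with cont closed_abs_ge[of A] assms(2) show ?thesis
    by (cases rule: hit_cases[where Y=Y and \<omega>=\<omega> and \<sigma>="\<lambda>_. 0"]; force)
qed

lemma tau0_star_nonneg: "0 \<le> tau0_star Y A \<omega>"
  unfolding tau0_star_def by (rule hit_nonneg)

lemma d_star_vals: "d_star Y A \<omega> \<in> {-1, 1}"
  using tau0_star_nonneg tau0_star_attained(2)[of "real_of_ereal (tau0_star Y A \<omega>)"] A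
  unfolding d_star_def by (cases "tau0_star Y A \<omega>") (auto simp: sgn_if)

lemma d_star_tau0: "tau0_star Y A \<omega> = ereal r \<Longrightarrow> A \<le> d_star Y A \<omega> * Y r \<omega>"
  using tau0_star_attained(2)[of r] A unfolding d_star_def by (auto simp: sgn_if abs_if split: if_splits)

lemma D_star_vals: "D_star Y A \<omega> n \<in> {-1, 1}"
  using d_star_vals by (cases "even n") (auto simp: D_star_def)

lemma D_star_Suc: "D_star Y A \<omega> (Suc n) = - D_star Y A \<omega> n"
  by (simp add: D_star_def)

text \<open>Multiplied by the decision in force, the two alternating boundaries become one
  condition, so that what follows needs no case split on parity or on the first decision.\<close>

lemma tau_star_Suc: "tau_star Y A B (Suc n) \<omega> = hit Y {x. B \<le> - D_star Y A \<omega> n * x} (tau_star Y A B n) \<omega>"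
proof -
  have "D_star Y A \<omega> n = 1 \<longleftrightarrow> (d_star Y A \<omega> = 1) = even n"
    using d_star_vals by (cases "even n") (auto simp: D_star_def)
  moreover have "{x. B \<le> - D_star Y A \<omega> n * x} = (if D_star Y A \<omega> n = 1 then {..-B} else {B..})"
    using D_star_vals[of n] by auto
  ultimately show ?thesis by (cases "D_star Y A \<omega> n = 1") auto
qed

lemma tau_star_mono: "tau_star Y A B n \<omega> \<le> tau_star Y A B (Suc n) \<omega>"
  unfolding tau_star_Suc by (rule hit_ge)

lemma tau_star_nonneg: "0 \<le> tau_star Y A B n \<omega>"
  by (cases n) (auto simp: tau0_star_nonneg hit_nonneg simp del: tau_star.simps(2) simp: tau_star_Suc)

lemma tau_star_Suc_attained:
  assumes "tau_star Y A B (Suc n) \<omega> = ereal r" shows "0 \<le> r" "B \<le> D_star Y A \<omega> (Suc n) * Y r \<omega>"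
proof -
  have h: "hit Y {x. B \<le> - D_star Y A \<omega> n * x} (tau_star Y A B n) \<omega> = ereal r"
    using assms unfolding tau_star_Suc .
  show "0 \<le> r" using tau_star_nonneg[of "Suc n"] assms by simp
  show "B \<le> D_star Y A \<omega> (Suc n) * Y r \<omega>" using cont closed_mult_ge[of B "- D_star Y A \<omega> n"] h unfolding D_star_Suc
    by (cases rule: hit_cases[where Y=Y and \<omega>=\<omega> and \<sigma>="tau_star Y A B n"]) auto
qed

lemma tau_star_attained:
  assumes "tau_star Y A B n \<omega> = ereal r" shows "0 \<le> r" "min A B \<le> D_star Y A \<omega> n * Y r \<omega>"
  using assms tau_star_nonneg[of n] d_star_tau0[of r] tau_star_Suc_attained(2)
  by (cases n; auto simp: D_star_def min_def simp del: tau_star.simps(2); fastforce)+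

lemma before_tau_star_Suc:
  assumes "tau_star Y A B n \<omega> \<le> ereal s" "ereal s < tau_star Y A B (Suc n) \<omega>"
  shows "- B < D_star Y A \<omega> n * Y s \<omega>"
proof (rule ccontr)
  assume "\<not> ?thesis"
  then have "B \<le> - D_star Y A \<omega> n * Y s \<omega>" by simp
  moreover have "0 \<le> s" using assms(1) tau_star_nonneg[of n] by (metis ereal_less_eq(5) order.trans)
  ultimately have "tau_star Y A B (Suc n) \<omega> \<le> ereal s"
    using hit_le_iff[where Y=Y and \<omega>=\<omega> and \<sigma>="tau_star Y A B n" and t=s, OF cont closed_mult_ge[of B "- D_star Y A \<omega> n"]] assms(1) unfolding tau_star_Suc by auto
  then show False using assms(2) by simp
qed

text \<open>A stage begins with a positive signed posterior mean, so the next switch comes strictly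
  later. Until then the signed value exceeds \<open>- B\<close>, and continuity rules out an
  overshoot.\<close>

lemma at_tau_star_Suc:
  assumes B: "0 < B" and "tau_star Y A B (Suc n) \<omega> = ereal r"
  shows "D_star Y A \<omega> n * Y r \<omega> = - B"
proof (rule antisym)
  show "D_star Y A \<omega> n * Y r \<omega> \<le> - B" using tau_star_Suc_attained(2)[OF assms(2)] by (simp add: D_star_Suc)
  obtain r0 where r0: "tau_star Y A B n \<omega> = ereal r0" "r0 \<le> r"
    using tau_star_mono[of n] tau_star_nonneg[of n] assms(2) by (cases "tau_star Y A B n \<omega>") (auto simp del: tau_star.simps(2))
  note a = tau_star_attained[OF r0(1)]
  have pos: "0 < D_star Y A \<omega> n * Y r0 \<omega>" using a A B by (auto simp: min_def split: if_splits)
  have "r0 < r"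
  proof (rule ccontr)
    assume "\<not> r0 < r" then have "r0 = r" using r0 by simp
    then show False using pos \<open>D_star Y A \<omega> n * Y r \<omega> \<le> - B\<close> B by simp
  qed
  have "((\<lambda>s. D_star Y A \<omega> n * Y s \<omega>) \<longlongrightarrow> D_star Y A \<omega> n * Y r \<omega>) (at r within {0..})"
    using cont a r0 unfolding continuous_on_def by (intro tendsto_intros) auto
  then have "((\<lambda>s. D_star Y A \<omega> n * Y s \<omega>) \<longlongrightarrow> D_star Y A \<omega> n * Y r \<omega>) (at r within {r0..r})"
    by (rule tendsto_within_subset) (use a in auto)
  then have lim: "((\<lambda>s. D_star Y A \<omega> n * Y s \<omega>) \<longlongrightarrow> D_star Y A \<omega> n * Y r \<omega>) (at_left r)"
    using at_within_Icc_at_left[OF \<open>r0 < r\<close>] by simp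
  have "eventually (\<lambda>s. - B \<le> D_star Y A \<omega> n * Y s \<omega>) (at_left r)"
    unfolding eventually_at_left[OF \<open>r0 < r\<close>]
  proof (intro exI conjI allI impI)
    fix s assume "r0 < s" "s < r"
    then show "- B \<le> D_star Y A \<omega> n * Y s \<omega>"
      using before_tau_star_Suc[of n s] r0 assms(2) by (auto simp del: tau_star.simps(2))
  qed fact
  then show "- B \<le> D_star Y A \<omega> n * Y r \<omega>" using lim by (intro tendsto_lowerbound[OF lim]) auto
qed

lemma abs_at_tau0_star:
  assumes "tau0_star Y A \<omega> = ereal r" "\<bar>Y 0 \<omega>\<bar> < A"
  shows "\<bar>Y r \<omega>\<bar> = A"
proof (rule antisym)
  note a = tau0_star_attained[OF assms(1)]
  show "A \<le> \<bar>Y r \<omega>\<bar>" by (rule a)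
  have r: "0 < r" using a assms(2) by (cases "r = 0") auto
  have "((\<lambda>s. \<bar>Y s \<omega>\<bar>) \<longlongrightarrow> \<bar>Y r \<omega>\<bar>) (at r within {0..})"
    using cont r unfolding continuous_on_def by (intro tendsto_intros) auto
  then have "((\<lambda>s. \<bar>Y s \<omega>\<bar>) \<longlongrightarrow> \<bar>Y r \<omega>\<bar>) (at r within {0..r})"
    by (rule tendsto_within_subset) auto
  then have lim: "((\<lambda>s. \<bar>Y s \<omega>\<bar>) \<longlongrightarrow> \<bar>Y r \<omega>\<bar>) (at_left r)"
    using at_within_Icc_at_left[OF r] by simp
  have "eventually (\<lambda>s. \<bar>Y s \<omega>\<bar> \<le> A) (at_left r)"
    unfolding eventually_at_left[OF r] using a r by (intro exI[of _ 0]) (auto intro: less_imp_le)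
  then show "\<bar>Y r \<omega>\<bar> \<le> A" by (intro tendsto_upperbound[OF lim]) auto
qed

text \<open>The decision is 1 iff \<open>A\<close> is reached before \<open>-A\<close>, and a time
  from a countable set separates the two hitting times. This expresses the event by stopping times
  already known to be measurable.\<close>

lemma d_star_1_iff:
  assumes t: "0 \<le> t"
  shows "tau0_star Y A \<omega> \<le> ereal t \<and> d_star Y A \<omega> = 1 \<longleftrightarrow>
    (\<exists>q\<in>rat_times t. hit Y {x. A \<le> x} (\<lambda>_. 0) \<omega> \<le> ereal q \<and> \<not> hit Y {x. A \<le> - x} (\<lambda>_. 0) \<omega> \<le> ereal q)"
    (is "?L \<longleftrightarrow> ?R")
proof -
  have c1: "closed {x::real. A \<le> x}" and c2: "closed {x::real. A \<le> - x}"
    by (intro closed_Collect_le continuous_intros)+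
  note h1 = hit_le_iff[where Y=Y and \<omega>=\<omega> and \<sigma>="\<lambda>_. 0", OF cont c1] and h2 = hit_le_iff[where Y=Y and \<omega>=\<omega> and \<sigma>="\<lambda>_. 0", OF cont c2]
  show ?thesis
  proof
    assume L: ?L
    then obtain r where r: "tau0_star Y A \<omega> = ereal r" "r \<le> t"
      using tau0_star_nonneg by (cases "tau0_star Y A \<omega>") auto
    note a = tau0_star_attained[OF r(1)]
    have Yr: "A \<le> Y r \<omega>" using d_star_tau0[OF r(1)] L by simp
    have p: "hit Y {x. A \<le> x} (\<lambda>_. 0) \<omega> \<le> ereal r" using h1[of r] Yr a by auto
    have "\<not> hit Y {x. A \<le> - x} (\<lambda>_. 0) \<omega> \<le> ereal r"
    proof
      assume "hit Y {x. A \<le> - x} (\<lambda>_. 0) \<omega> \<le> ereal r"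
      then obtain s where s: "0 \<le> s" "s \<le> r" "A \<le> - Y s \<omega>" using h2[of r] by auto
      then show False using a(3)[of s] Yr A by (cases "s = r") auto
    qed
    then have m: "ereal r < hit Y {x. A \<le> - x} (\<lambda>_. 0) \<omega>" by simp
    show ?R
    proof (cases "r = t")
      case True then show ?thesis using p m by (intro bexI[of _ t]) (auto simp: rat_times_def)
    next
      case False
      then have "ereal r < min (ereal t) (hit Y {x. A \<le> - x} (\<lambda>_. 0) \<omega>)" using r m by auto
      then obtain z where z: "ereal r < ereal z" "ereal z < min (ereal t) (hit Y {x. A \<le> - x} (\<lambda>_. 0) \<omega>)"
        using ereal_dense2 by blast
      obtain q where q: "q \<in> \<rat>" "r < q" "q < z" using Rats_dense_in_real[of r z] z by auto
      have "ereal q < hit Y {x. A \<le> - x} (\<lambda>_. 0) \<omega>" "q < t"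
        using z(2) q(3) by (auto intro: order.strict_trans[of "ereal q" "ereal z"])
      moreover have "hit Y {x. A \<le> x} (\<lambda>_. 0) \<omega> \<le> ereal q" using p q(2)
        by (meson ereal_less_eq(3) less_imp_le order.trans)
      ultimately show ?thesis using q a(1) by (intro bexI[of _ q]) (auto simp: rat_times_def)
    qed
  next
    assume ?R
    then obtain q where q: "q \<in> rat_times t" "hit Y {x. A \<le> x} (\<lambda>_. 0) \<omega> \<le> ereal q"
      "\<not> hit Y {x. A \<le> - x} (\<lambda>_. 0) \<omega> \<le> ereal q" by blast
    have qt: "0 \<le> q" "q \<le> t" using rat_times_bounds[OF t q(1)] by auto
    obtain s where s: "0 \<le> s" "s \<le> q" "A \<le> Y s \<omega>" using q(2) h1[of q] by auto
    have "tau0_star Y A \<omega> \<le> ereal q"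
      unfolding tau0_star_def hit_le_iff[where Y=Y and \<omega>=\<omega> and \<sigma>="\<lambda>_. 0", OF cont closed_abs_ge[of A]] using s by (intro exI[of _ s]) auto
    then obtain r where r: "tau0_star Y A \<omega> = ereal r" "r \<le> q"
      using tau0_star_nonneg by (cases "tau0_star Y A \<omega>") auto
    have "\<not> A \<le> - Y r \<omega>" using q(3) h2[of q] tau0_star_attained(1)[OF r(1)] r(2) by auto
    then have "0 < Y r \<omega>" using tau0_star_attained(2)[OF r(1)] A by auto
    then have "d_star Y A \<omega> = 1" using r by (simp add: d_star_def)
    then show ?L using r qt by auto
  qed
qed

end

context observed_BM
begin

lemma FX_Collect_Int: "E \<in> FX M X t \<Longrightarrow> F \<in> FX M X t \<Longrightarrow> E \<inter> F \<in> FX M X t"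
  using sets.Int[of E "Fm t" F] by simp

lemma stopping_timeD:
  "stopping_time_ext M (FX M X) \<sigma> \<Longrightarrow> 0 \<le> s \<Longrightarrow> s \<le> t \<Longrightarrow> {\<omega>\<in>space M. \<sigma> \<omega> \<le> ereal s} \<in> FX M X t"
  using FX_mono[of s t] unfolding stopping_time_ext_def by auto

lemma stopping_time_hit:
  assumes ad: "\<And>t. 0 \<le> t \<Longrightarrow> Y t \<in> borel_measurable (Fm t)"
    and ct: "\<And>\<omega>. \<omega> \<in> space M \<Longrightarrow> continuous_on {0..} (\<lambda>t. Y t \<omega>)"
    and \<sigma>: "stopping_time_ext M (FX M X) \<sigma>" and f: "continuous_on UNIV (f :: real \<Rightarrow> real)"
  shows "stopping_time_ext M (FX M X) (hit Y {x. c \<le> f x} \<sigma>)"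
  unfolding stopping_time_ext_def
proof (intro conjI ballI allI impI)
  show "0 \<le> hit Y {x. c \<le> f x} \<sigma> \<omega>" for \<omega> by (rule hit_nonneg)
  fix t :: real assume t: "0 \<le> t"
  have fb: "f \<in> borel_measurable borel" using f by (rule borel_measurable_continuous_onI)
  have 1: "{\<omega>\<in>space M. \<sigma> \<omega> \<le> ereal q \<and> c - inverse (real (Suc n)) < f (Y q \<omega>)} \<in> sets (Fm t)"
    if "q \<in> rat_times t" for n q
  proof -
    have q: "0 \<le> q" "q \<le> t" using rat_times_bounds[OF t that] by auto
    have "Y q \<in> borel_measurable (Fm t)" by (rule Fm_mono_measurable[OF q(2) ad[OF q(1)]])
    then have "(\<lambda>\<omega>. f (Y q \<omega>)) \<in> borel_measurable (Fm t)" using fb by measurable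
    then have "{\<omega>\<in>space (Fm t). c - inverse (real (Suc n)) < f (Y q \<omega>)} \<in> sets (Fm t)" by measurable
    then have "{\<omega>\<in>space M. \<sigma> \<omega> \<le> ereal q} \<inter> {\<omega>\<in>space M. c - inverse (real (Suc n)) < f (Y q \<omega>)} \<in> sets (Fm t)"
      using stopping_timeD[OF \<sigma> q] by (intro sets.Int) auto
    then show ?thesis by (simp add: Int_def conj_ac cong: conj_cong)
  qed
  have "{\<omega>\<in>space M. hit Y {x. c \<le> f x} \<sigma> \<omega> \<le> ereal t} =
    {\<omega>\<in>space (Fm t). \<forall>n. \<exists>q\<in>rat_times t. \<sigma> \<omega> \<le> ereal q \<and> c - inverse (real (Suc n)) < f (Y q \<omega>)}"
    using hit_le_iff_rat_times[where Y=Y, OF ct f t] by auto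
  also have "\<dots> \<in> sets (Fm t)"
    using 1 countable_rat_times by (intro sets.sets_Collect_countable_All sets.sets_Collect_countable_Ex') auto
  finally show "{\<omega>\<in>space M. hit Y {x. c \<le> f x} \<sigma> \<omega> \<le> ereal t} \<in> FX M X t" by simp
qed

lemma stopping_time_0: "stopping_time_ext M (FX M X) (\<lambda>_. 0)"
  unfolding stopping_time_ext_def
proof (intro conjI allI impI)
  fix t :: real assume "0 \<le> t"
  then show "{\<omega>\<in>space M. 0 \<le> ereal t} \<in> FX M X t" using sets.top[of "Fm t"] by simp
qed simp

text \<open>Stated for any adapted continuous \<open>Y\<close>, so that it also covers priors in {0,
  1}.\<close>

lemma decision_rule_star:
  assumes ad: "\<And>t. 0 \<le> t \<Longrightarrow> Y t \<in> borel_measurable (Fm t)"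
    and ct: "\<And>\<omega>. \<omega> \<in> space M \<Longrightarrow> continuous_on {0..} (\<lambda>t. Y t \<omega>)"
    and A: "0 < A"
  shows "decision_rule M (FX M X) (tau_star Y A B) (d_star Y A)"
proof -
  have st: "stopping_time_ext M (FX M X) (hit Y {x. c \<le> f x} \<sigma>)"
    if "stopping_time_ext M (FX M X) \<sigma>" "continuous_on UNIV f" for \<sigma> c and f :: "real \<Rightarrow> real"
    by (rule stopping_time_hit[OF ad ct that])
  have ci: "continuous_on UNIV (\<lambda>x::real. x)" and cm: "continuous_on UNIV (\<lambda>x::real. - x)"
    by (intro continuous_intros)+
  have st0: "stopping_time_ext M (FX M X) (tau0_star Y A)"
    unfolding tau0_star_def by (intro st stopping_time_0 continuous_intros)
  have d1: "{\<omega>\<in>space M. tau0_star Y A \<omega> \<le> ereal t \<and> d_star Y A \<omega> = 1} \<in> FX M X t" if t: "0 \<le> t" for t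
  proof -
    have s1: "stopping_time_ext M (FX M X) (hit Y {x. A \<le> x} (\<lambda>_. 0))"
      "stopping_time_ext M (FX M X) (hit Y {x. A \<le> - x} (\<lambda>_. 0))"
      using st[OF stopping_time_0 ci, of A] st[OF stopping_time_0 cm, of A] by auto
    have "{\<omega>\<in>space (Fm t). hit Y {x. A \<le> x} (\<lambda>_. 0) \<omega> \<le> ereal q \<and> \<not> hit Y {x. A \<le> - x} (\<lambda>_. 0) \<omega> \<le> ereal q} \<in> sets (Fm t)"
      if "q \<in> rat_times t" for q
    proof -
      have q: "0 \<le> q" "q \<le> t" using rat_times_bounds[OF t that] by auto
      show ?thesis using stopping_timeD[OF s1(1) q] stopping_timeD[OF s1(2) q]
        by (intro sets.sets_Collect) auto
    qed
    then have "{\<omega>\<in>space (Fm t). \<exists>q\<in>rat_times t. hit Y {x. A \<le> x} (\<lambda>_. 0) \<omega> \<le> ereal q \<and> \<not> hit Y {x. A \<le> - x} (\<lambda>_. 0) \<omega> \<le> ereal q} \<in> sets (Fm t)"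
      using countable_rat_times by (intro sets.sets_Collect_countable_Ex') auto
    also have "{\<omega>\<in>space (Fm t). \<exists>q\<in>rat_times t. hit Y {x. A \<le> x} (\<lambda>_. 0) \<omega> \<le> ereal q \<and> \<not> hit Y {x. A \<le> - x} (\<lambda>_. 0) \<omega> \<le> ereal q}
      = {\<omega>\<in>space M. tau0_star Y A \<omega> \<le> ereal t \<and> d_star Y A \<omega> = 1}"
      using d_star_1_iff[where Y=Y, OF ct A t] by auto
    finally show ?thesis by simp
  qed
  have stop: "stopping_time_ext M (FX M X) (tau_star Y A B n) \<and> (\<forall>\<omega>\<in>space M. tau0_star Y A \<omega> \<le> tau_star Y A B n \<omega>)" for n
  proof (induction n)
    case 0 then show ?case using st0 by simp
  next
    case (Suc n)
    let ?h1 = "hit Y {..-B} (tau_star Y A B n)" and ?h2 = "hit Y {B..} (tau_star Y A B n)"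
    have "{..-B} = {x. B \<le> - x}" "{B..} = {x. B \<le> x}" by auto
    then have h: "stopping_time_ext M (FX M X) ?h1" "stopping_time_ext M (FX M X) ?h2"
      using st[OF _ cm, of "tau_star Y A B n" B] st[OF _ ci, of "tau_star Y A B n" B] Suc by auto
    have ge: "tau0_star Y A \<omega> \<le> ?h1 \<omega>" "tau0_star Y A \<omega> \<le> ?h2 \<omega>" if "\<omega> \<in> space M" for \<omega>
      using Suc that hit_ge[of "tau_star Y A B n" \<omega> Y] order.trans by blast+
    have "{\<omega>\<in>space M. tau_star Y A B (Suc n) \<omega> \<le> ereal t} \<in> FX M X t" if t: "0 \<le> t" for t
    proof -
      \<comment> \<open>At time \<open>t\<close> the first decision is known only where
        \<open>tau0_star\<close> has occurred, so its value is tested jointly with that event;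
        elsewhere the next stopping time exceeds \<open>t\<close> in either case.\<close>
      let ?P = "\<lambda>\<omega>. (tau0_star Y A \<omega> \<le> ereal t \<and> d_star Y A \<omega> = 1)"
      have "{\<omega>\<in>space (Fm t). (if ?P \<omega> = even n then ?h1 \<omega> \<le> ereal t else ?h2 \<omega> \<le> ereal t) \<and> tau0_star Y A \<omega> \<le> ereal t} \<in> sets (Fm t)"
      proof -
        have [measurable]: "Measurable.pred (Fm t) ?P" "Measurable.pred (Fm t) (\<lambda>\<omega>. ?h1 \<omega> \<le> ereal t)"
          "Measurable.pred (Fm t) (\<lambda>\<omega>. ?h2 \<omega> \<le> ereal t)" "Measurable.pred (Fm t) (\<lambda>\<omega>. tau0_star Y A \<omega> \<le> ereal t)"
          using d1[OF t] stopping_timeD[OF h(1) t order.refl] stopping_timeD[OF h(2) t order.refl] stopping_timeD[OF st0 t order.refl]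
          unfolding pred_def by auto
        show ?thesis by measurable
      qed
      also have "{\<omega>\<in>space (Fm t). (if ?P \<omega> = even n then ?h1 \<omega> \<le> ereal t else ?h2 \<omega> \<le> ereal t) \<and> tau0_star Y A \<omega> \<le> ereal t}
        = {\<omega>\<in>space M. tau_star Y A B (Suc n) \<omega> \<le> ereal t}"
        using ge by (auto split: if_splits intro: order.trans)
      finally show ?thesis by simp
    qed
    then show ?case using hit_nonneg[of Y _ "tau_star Y A B n"] ge unfolding stopping_time_ext_def by auto
  qed
  have F: "d_star Y A -` C \<inter> space M \<in> F_at M (FX M X) (tau_star Y A B 0)" for C
  proof -
    have eq: "d_star Y A -` C \<inter> space M = {\<omega>\<in>space M. (d_star Y A \<omega> = 1 \<and> 1 \<in> C) \<or> (\<not> d_star Y A \<omega> = 1 \<and> -1 \<in> C)}"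
      using d_star_vals[where Y=Y, OF ct A] by force
    have 1: "(d_star Y A -` C \<inter> space M) \<inter> {\<omega>\<in>space M. tau0_star Y A \<omega> \<le> ereal t} \<in> FX M X t" if t: "0 \<le> t" for t
    proof -
      have [measurable]: "Measurable.pred (Fm t) (\<lambda>\<omega>. tau0_star Y A \<omega> \<le> ereal t \<and> d_star Y A \<omega> = 1)"
        "Measurable.pred (Fm t) (\<lambda>\<omega>. tau0_star Y A \<omega> \<le> ereal t)"
        using d1[OF t] stopping_timeD[OF st0 t order.refl] unfolding pred_def by auto
      have "{\<omega>\<in>space (Fm t). (((tau0_star Y A \<omega> \<le> ereal t \<and> d_star Y A \<omega> = 1) \<and> 1 \<in> C) \<or>
          (\<not> (tau0_star Y A \<omega> \<le> ereal t \<and> d_star Y A \<omega> = 1) \<and> -1 \<in> C)) \<and> tau0_star Y A \<omega> \<le> ereal t} \<in> sets (Fm t)"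
        by measurable
      also have "{\<omega>\<in>space (Fm t). (((tau0_star Y A \<omega> \<le> ereal t \<and> d_star Y A \<omega> = 1) \<and> 1 \<in> C) \<or>
          (\<not> (tau0_star Y A \<omega> \<le> ereal t \<and> d_star Y A \<omega> = 1) \<and> -1 \<in> C)) \<and> tau0_star Y A \<omega> \<le> ereal t}
        = (d_star Y A -` C \<inter> space M) \<inter> {\<omega>\<in>space M. tau0_star Y A \<omega> \<le> ereal t}"
        unfolding eq by auto
      finally show ?thesis by simp
    qed
    have F_infty: "sigma_algebra (space M) (F_infty M (FX M X))"
      unfolding F_infty_def using FX_sets sets.sets_into_space
      by (intro sigma_algebra_sigma_sets) blast
    interpret I: sigma_algebra "space M" "F_infty M (FX M X)" by fact
    have sub: "FX M X t \<subseteq> F_infty M (FX M X)" if "0 \<le> t" for t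
      unfolding F_infty_def using that by (auto intro!: sigma_sets.Basic)
    let ?N = "\<lambda>n::nat. {\<omega>\<in>space M. tau0_star Y A \<omega> \<le> ereal (real n)}"
    have N: "?N n \<in> F_infty M (FX M X)" for n
      using stopping_timeD[OF st0, of "real n" "real n"] sub[of "real n"] by auto
    have NU: "space M - (\<Union>n. ?N n) \<in> F_infty M (FX M X)"
      using N by (intro I.compl_sets I.countable_nat_UN) auto
    have fin: "(\<exists>n. tau0_star Y A \<omega> \<le> ereal (real n)) \<longleftrightarrow> tau0_star Y A \<omega> \<noteq> \<infinity>" for \<omega>
    proof
      assume "tau0_star Y A \<omega> \<noteq> \<infinity>"
      moreover have "0 \<le> tau0_star Y A \<omega>" unfolding tau0_star_def by (rule hit_nonneg)
      ultimately obtain r where "tau0_star Y A \<omega> = ereal r" by (cases "tau0_star Y A \<omega>") auto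
      then show "\<exists>n. tau0_star Y A \<omega> \<le> ereal (real n)" using real_arch_simple[of r] by auto
    qed auto
    \<comment> \<open>The part where a first decision is made is exhausted by integer times; on the
      remaining event \<open>d_star\<close> is 1 by convention.\<close>
    have "d_star Y A -` C \<inter> space M =
      (\<Union>n. (d_star Y A -` C \<inter> space M) \<inter> ?N n) \<union> (if 1 \<in> C then space M - (\<Union>n. ?N n) else {})"
      using fin by (auto simp: d_star_def split: if_splits)
    also have "\<dots> \<in> F_infty M (FX M X)"
      using 1[of "real _"] sub[of "real _"] NU by (intro I.Un I.countable_nat_UN) auto
    finally show ?thesis using 1 unfolding F_at_def by simp
  qed
  show ?thesis
    unfolding decision_rule_def
  proof (intro conjI allI ballI)
    show "stopping_time_ext M (FX M X) (tau_star Y A B n)" for n using stop by blast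
    show "tau_star Y A B n \<omega> \<le> tau_star Y A B (Suc n) \<omega>" if "\<omega> \<in> space M" for n \<omega>
      by (rule tau_star_mono[where Y=Y, OF ct[OF that] A])
    show "d_star Y A \<omega> \<in> {-1, 1}" if "\<omega> \<in> space M" for \<omega> by (rule d_star_vals[where Y=Y, OF ct[OF that] A])
    show "d_star Y A -` C \<inter> space M \<in> F_at M (FX M X) (tau_star Y A B 0)" for C by (rule F)
  qed
qed

end

subsection \<open>The decision process along a path\<close>

definition path_cost :: "('a \<Rightarrow> real) \<Rightarrow> real \<Rightarrow> real \<Rightarrow> real \<Rightarrow>
    (nat \<Rightarrow> 'a \<Rightarrow> ereal) \<Rightarrow> ('a \<Rightarrow> real) \<Rightarrow> 'a \<Rightarrow> ennreal" where
  "path_cost \<theta> c0 c1 c2 \<tau> d \<omega> = ennreal c0 * e2ennreal (\<tau> 0 \<omega>)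
        + ennreal c1 * (\<integral>\<^sup>+ t. indicator {t. \<tau> 0 \<omega> \<le> ereal t \<and> Dproc \<tau> d t \<omega> \<noteq> \<theta> \<omega>} t \<partial>lborel)
        + ennreal c2 * emeasure (count_space UNIV) {t. \<tau> 0 \<omega> < ereal t \<and> Dleft \<tau> d t \<omega> \<noteq> Dproc \<tau> d t \<omega>}"

lemma risk_eq: "risk M \<theta> c0 c1 c2 \<tau> d = (\<integral>\<^sup>+ \<omega>. path_cost \<theta> c0 c1 c2 \<tau> d \<omega> \<partial>M)"
  by (simp add: risk_def path_cost_def)

text \<open>Differs from \<open>Dproc\<close> only after an accumulation point of the switching times.\<close>

definition Dalt :: "(nat \<Rightarrow> 'a \<Rightarrow> ereal) \<Rightarrow> ('a \<Rightarrow> real) \<Rightarrow> real \<Rightarrow> 'a \<Rightarrow> real" where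
  "Dalt \<tau> d t \<omega> =
     (if ereal t < \<tau> 0 \<omega> then 0
      else if \<exists>n. \<tau> (2*n) \<omega> \<le> ereal t \<and> ereal t < \<tau> (2*n+1) \<omega> then d \<omega>
      else - d \<omega>)"

definition grid_cost :: "('a \<Rightarrow> real) \<Rightarrow> real \<Rightarrow> real \<Rightarrow> real \<Rightarrow>
    (nat \<Rightarrow> 'a \<Rightarrow> ereal) \<Rightarrow> ('a \<Rightarrow> real) \<Rightarrow> real \<Rightarrow> nat \<Rightarrow> 'a \<Rightarrow> real" where
  "grid_cost \<theta> c0 c1 c2 \<tau> d h k \<omega> =
    h * (if Dalt \<tau> d (real k * h) \<omega> = 0 then c0 else if Dalt \<tau> d (real k * h) \<omega> \<noteq> \<theta> \<omega> then c1 else 0)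
    + c2 * (if Dalt \<tau> d (real k * h) \<omega> \<noteq> 0 \<and> Dalt \<tau> d (real k * h) \<omega> \<noteq> Dalt \<tau> d (real (Suc k) * h) \<omega> then 1 else 0)"

lemma nn_integral_indicator_mono:
  "S \<subseteq> T \<Longrightarrow> (\<integral>\<^sup>+ t. indicator S t \<partial>M) \<le> (\<integral>\<^sup>+ t. indicator T t \<partial>M)"
  by (intro nn_integral_mono) (auto split: split_indicator)

lemma Lim_at_left_const:
  fixes f :: "real \<Rightarrow> real"
  assumes "a < t" "\<And>s. a < s \<Longrightarrow> s < t \<Longrightarrow> f s = c"
  shows "Lim (at_left t) f = c"
proof (rule tendsto_Lim)
  have "eventually (\<lambda>s. f s = c) (at_left t)"
    unfolding eventually_at_left[OF assms(1)] using assms by blast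
  then show "(f \<longlongrightarrow> c) (at_left t)" by (rule tendsto_eventually)
qed simp

lemma Dalt_zero_iff: "d \<omega> \<in> {-1, 1} \<Longrightarrow> Dalt \<tau> d t \<omega> = 0 \<longleftrightarrow> ereal t < \<tau> 0 \<omega>"
  by (auto simp: Dalt_def)

context
  fixes \<tau> :: "nat \<Rightarrow> 'a \<Rightarrow> ereal" and d :: "'a \<Rightarrow> real" and \<omega> :: 'a
  assumes mono: "\<And>n. \<tau> n \<omega> \<le> \<tau> (Suc n) \<omega>"
begin

lemma \<tau>_mono: "m \<le> n \<Longrightarrow> \<tau> m \<omega> \<le> \<tau> n \<omega>"
  using lift_Suc_mono_le[of "\<lambda>n. \<tau> n \<omega>"] mono by blast

lemma between_unique:
  assumes "\<tau> n \<omega> \<le> ereal t" "ereal t < \<tau> (Suc n) \<omega>" "\<tau> m \<omega> \<le> ereal t" "ereal t < \<tau> (Suc m) \<omega>"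
  shows "m = n"
proof (rule ccontr)
  assume "m \<noteq> n"
  then consider "Suc m \<le> n" | "Suc n \<le> m" by linarith
  then show False
    using \<tau>_mono[of "Suc m" n] \<tau>_mono[of "Suc n" m] assms by cases (auto dest: order.trans leD)
qed

lemma Dproc_between:
  assumes n: "\<tau> n \<omega> \<le> ereal t" "ereal t < \<tau> (Suc n) \<omega>"
  shows "Dproc \<tau> d t \<omega> = d \<omega> * (-1) ^ n" "Dalt \<tau> d t \<omega> = d \<omega> * (-1) ^ n"
proof -
  have 0: "\<not> ereal t < \<tau> 0 \<omega>" using \<tau>_mono[of 0 n] n(1) by (auto dest: order.trans)
  have ev: "(\<exists>k. \<tau> (2*k) \<omega> \<le> ereal t \<and> ereal t < \<tau> (2*k+1) \<omega>) \<longleftrightarrow> even n"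
  proof
    assume "\<exists>k. \<tau> (2*k) \<omega> \<le> ereal t \<and> ereal t < \<tau> (2*k+1) \<omega>"
    then obtain k where "\<tau> (2*k) \<omega> \<le> ereal t" "ereal t < \<tau> (Suc (2*k)) \<omega>" by auto
    then show "even n" using between_unique[OF n, of "2*k"] by auto
  next
    assume "even n"
    then obtain k where k: "n = 2*k" by (auto elim: evenE)
    show "\<exists>k. \<tau> (2*k) \<omega> \<le> ereal t \<and> ereal t < \<tau> (2*k+1) \<omega>"
      using n unfolding k by (intro exI[of _ k]) auto
  qed
  have od: "(\<exists>k. \<tau> (2*k+1) \<omega> \<le> ereal t \<and> ereal t < \<tau> (2*k+2) \<omega>) \<longleftrightarrow> odd n"
  proof
    assume "\<exists>k. \<tau> (2*k+1) \<omega> \<le> ereal t \<and> ereal t < \<tau> (2*k+2) \<omega>"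
    then obtain k where "\<tau> (2*k+1) \<omega> \<le> ereal t" "ereal t < \<tau> (Suc (2*k+1)) \<omega>" by auto
    then show "odd n" using between_unique[OF n, of "2*k+1"] by auto
  next
    assume "odd n"
    then obtain k where k: "n = 2*k+1" by (auto elim: oddE)
    show "\<exists>k. \<tau> (2*k+1) \<omega> \<le> ereal t \<and> ereal t < \<tau> (2*k+2) \<omega>"
      using n unfolding k by (intro exI[of _ k]) auto
  qed
  show "Dproc \<tau> d t \<omega> = d \<omega> * (-1) ^ n"
    unfolding Dproc_def ev od using 0 by (cases "even n") auto
  show "Dalt \<tau> d t \<omega> = d \<omega> * (-1) ^ n"
    unfolding Dalt_def ev using 0 by (cases "even n") auto
qed

text \<open>Past an accumulation point of the switching times \<open>Dproc\<close> stays 0, which is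
  never the value of \<open>\<theta>\<close>. The error time would then be infinite, so a path of
  finite cost has no such point.\<close>

lemma between_if_integral_finite:
  assumes fin: "(\<integral>\<^sup>+ t. indicator {t. \<tau> 0 \<omega> \<le> ereal t \<and> Dproc \<tau> d t \<omega> \<noteq> \<theta> \<omega>} t \<partial>lborel) \<noteq> \<infinity>"
    and \<theta>: "\<theta> \<omega> \<noteq> 0" and t: "\<tau> 0 \<omega> \<le> ereal t"
  shows "\<exists>n. \<tau> n \<omega> \<le> ereal t \<and> ereal t < \<tau> (Suc n) \<omega>"
proof (rule ccontr)
  assume no: "\<not> ?thesis"
  have all: "\<tau> n \<omega> \<le> ereal t" for n
    by (induction n) (use no t in \<open>auto simp: not_less\<close>)
  have "Dproc \<tau> d s \<omega> = 0" if "t \<le> s" for s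
  proof -
    have "\<tau> n \<omega> \<le> ereal s" for n using all[of n] that by (meson ereal_less_eq(3) order.trans)
    then have "\<not> ereal s < \<tau> n \<omega>" for n by (simp add: not_less)
    then show ?thesis by (simp add: Dproc_def)
  qed
  then have sub: "{t..} \<subseteq> {s. \<tau> 0 \<omega> \<le> ereal s \<and> Dproc \<tau> d s \<omega> \<noteq> \<theta> \<omega>}"
    using \<theta> t by (auto intro: order.trans)
  have "ennreal (real n) \<le> (\<integral>\<^sup>+ s. indicator {s. \<tau> 0 \<omega> \<le> ereal s \<and> Dproc \<tau> d s \<omega> \<noteq> \<theta> \<omega>} s \<partial>lborel)" for n :: nat
  proof -
    have "ennreal (real n) = emeasure lborel {t..t + real n}" by simp
    also have "\<dots> = (\<integral>\<^sup>+ s. indicator {t..t + real n} s \<partial>lborel)" by simp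
    also have "\<dots> \<le> (\<integral>\<^sup>+ s. indicator {s. \<tau> 0 \<omega> \<le> ereal s \<and> Dproc \<tau> d s \<omega> \<noteq> \<theta> \<omega>} s \<partial>lborel)"
      using sub by (intro nn_integral_indicator_mono) auto
    finally show ?thesis .
  qed
  moreover obtain n :: nat where "(\<integral>\<^sup>+ s. indicator {s. \<tau> 0 \<omega> \<le> ereal s \<and> Dproc \<tau> d s \<omega> \<noteq> \<theta> \<omega>} s \<partial>lborel) < of_nat n"
    using ennreal_Ex_less_of_nat fin by (auto simp: less_top)
  ultimately show False by (metis ennreal_of_nat_eq_real_of_nat leD)
qed

context
  assumes noacc: "\<And>t. \<tau> 0 \<omega> \<le> ereal t \<Longrightarrow> \<exists>n. \<tau> n \<omega> \<le> ereal t \<and> ereal t < \<tau> (Suc n) \<omega>"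
begin

lemma Dproc_eq_Dalt: "Dproc \<tau> d t \<omega> = Dalt \<tau> d t \<omega>"
proof (cases "ereal t < \<tau> 0 \<omega>")
  case True then show ?thesis by (simp add: Dproc_def Dalt_def)
next
  case False then show ?thesis using noacc[of t] Dproc_between[of _ t] by force
qed

text \<open>At the infimum of the deviating times right-continuity already shows a new value while
  the left limit is still the old one, so this infimum is a counted jump.\<close>

lemma Dproc_constant:
  assumes a: "\<tau> 0 \<omega> \<le> ereal a" and nojump: "\<And>t. a < t \<Longrightarrow> t \<le> b \<Longrightarrow> Dleft \<tau> d t \<omega> = Dproc \<tau> d t \<omega>"
    and t: "a \<le> t" "t \<le> b"
  shows "Dproc \<tau> d t \<omega> = Dproc \<tau> d a \<omega>"
proof (rule ccontr)
  assume ne: "Dproc \<tau> d t \<omega> \<noteq> Dproc \<tau> d a \<omega>"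
  define S where "S = {s. a \<le> s \<and> s \<le> b \<and> Dproc \<tau> d s \<omega> \<noteq> Dproc \<tau> d a \<omega>}"
  have S: "S \<noteq> {}" "bdd_below S" using ne t by (auto simp: S_def intro: bdd_belowI[of _ a])
  define u where "u = Inf S"
  have ua: "a \<le> u" unfolding u_def by (rule cInf_greatest[OF S(1)]) (auto simp: S_def)
  have ub: "u \<le> t" unfolding u_def by (rule cInf_lower[OF _ S(2)]) (use ne t in \<open>auto simp: S_def\<close>)
  have below: "Dproc \<tau> d s \<omega> = Dproc \<tau> d a \<omega>" if "a \<le> s" "s < u" for s
  proof (rule ccontr)
    assume "Dproc \<tau> d s \<omega> \<noteq> Dproc \<tau> d a \<omega>"
    then have "s \<in> S" using that ub t by (auto simp: S_def)
    then have "u \<le> s" unfolding u_def by (rule cInf_lower[OF _ S(2)])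
    then show False using that by simp
  qed
  have u0: "\<tau> 0 \<omega> \<le> ereal u" using a ua by (meson ereal_less_eq(3) order.trans)
  obtain n where n: "\<tau> n \<omega> \<le> ereal u" "ereal u < \<tau> (Suc n) \<omega>" using noacc[OF u0] by blast
  have right: "Dproc \<tau> d s \<omega> = Dproc \<tau> d u \<omega>" if "u \<le> s" "ereal s < \<tau> (Suc n) \<omega>" for s
  proof -
    have "\<tau> n \<omega> \<le> ereal s" using n(1) that(1) by (meson ereal_less_eq(3) order.trans)
    then show ?thesis using Dproc_between[OF n] Dproc_between[of n s] that by simp
  qed
  have "Dproc \<tau> d u \<omega> \<noteq> Dproc \<tau> d a \<omega>"
  proof
    assume eq: "Dproc \<tau> d u \<omega> = Dproc \<tau> d a \<omega>"
    obtain z where z: "ereal u < ereal z" "ereal z < \<tau> (Suc n) \<omega>" using ereal_dense2[OF n(2)] by blast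
    have "z \<le> Inf S"
    proof (rule cInf_greatest[OF S(1)])
      fix s assume s: "s \<in> S"
      show "z \<le> s"
      proof (rule ccontr)
        assume "\<not> z \<le> s"
        moreover have "u \<le> s" unfolding u_def by (rule cInf_lower[OF s S(2)])
        ultimately have "ereal s < \<tau> (Suc n) \<omega>" using order.strict_trans[OF _ z(2), of "ereal s"] by simp
        then show False using right[OF \<open>u \<le> s\<close>] eq s by (simp add: S_def)
      qed
    qed
    then show False using z(1) by (simp add: u_def)
  qed
  moreover have au: "a < u" using calculation ua by (cases "a = u") auto
  moreover have "Dleft \<tau> d u \<omega> = Dproc \<tau> d a \<omega>"
    unfolding Dleft_def by (rule Lim_at_left_const[OF au], rule below) auto
  ultimately show False using nojump[of u] ub t by simp
qed

text \<open>On a cell without a jump, starting after the first decision, the process is constant: a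
  wrong left end point means that the whole cell is spent in error, and no switch is charged. There
  are at most as many cells with a jump as jumps, and each of them can overcharge error time by at
  most \<open>h\<close>. The additional \<open>c0 * h\<close> rounds the first decision time up to
  the grid.\<close>

lemma grid_cost_le:
  fixes \<theta> :: "'a \<Rightarrow> real" and n :: nat
  assumes d: "d \<omega> \<in> {-1, 1}" and h: "h > 0" and c: "c0 > 0" "c1 > 0" "c2 > 0"
    and r: "\<tau> 0 \<omega> = ereal r" "0 \<le> r"
    and J: "finite {t. \<tau> 0 \<omega> < ereal t \<and> Dleft \<tau> d t \<omega> \<noteq> Dproc \<tau> d t \<omega>}"
    and I: "(\<integral>\<^sup>+ t. indicator {t. \<tau> 0 \<omega> \<le> ereal t \<and> Dproc \<tau> d t \<omega> \<noteq> \<theta> \<omega>} t \<partial>lborel) = ennreal I" "0 \<le> I"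
  shows "(\<Sum>k<n. grid_cost \<theta> c0 c1 c2 \<tau> d h k \<omega>) \<le> c0 * (r + h)
     + c1 * (I + h * real (card {t. \<tau> 0 \<omega> < ereal t \<and> Dleft \<tau> d t \<omega> \<noteq> Dproc \<tau> d t \<omega>}))
     + c2 * real (card {t. \<tau> 0 \<omega> < ereal t \<and> Dleft \<tau> d t \<omega> \<noteq> Dproc \<tau> d t \<omega>})"
proof -
  define Js where "Js = {t. \<tau> 0 \<omega> < ereal t \<and> Dleft \<tau> d t \<omega> \<noteq> Dproc \<tau> d t \<omega>}"
  define N where "N = card Js"
  define D where "D k = Dproc \<tau> d (real k * h) \<omega>" for k :: nat
  define K where "K = {k. k < n \<and> (\<exists>t\<in>Js. real k * h < t \<and> t \<le> real (Suc k) * h)}"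
  have K: "card K \<le> N"
  proof -
    \<comment> \<open>A jump belongs to the cell that is open on the left and closed on the right;
      its index is the rounded-up quotient minus 1.\<close>
    have "K \<subseteq> (\<lambda>t. nat \<lceil>t / h\<rceil> - 1) ` Js"
    proof
      fix k assume "k \<in> K"
      then obtain t where t: "t \<in> Js" "real k * h < t" "t \<le> real (Suc k) * h" by (auto simp: K_def)
      have "\<lceil>t / h\<rceil> = int k + 1"
        using t h by (intro ceiling_unique) (auto simp: field_simps)
      then show "k \<in> (\<lambda>t. nat \<lceil>t / h\<rceil> - 1) ` Js" using t(1) by (auto intro!: image_eqI[of _ _ t])
    qed
    then show ?thesis unfolding N_def using J[folded Js_def]
      by (meson card_image_le card_mono finite_imageI order.trans)
  qed
  have finK: "finite K" unfolding K_def by simp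
  have const: "Dproc \<tau> d t \<omega> = D k" if "\<tau> 0 \<omega> \<le> ereal (real k * h)" "k < n" "k \<notin> K" "real k * h \<le> t" "t \<le> real (Suc k) * h" for k t
    unfolding D_def
  proof (rule Dproc_constant[OF that(1) _ that(4,5)])
    fix s assume s: "real k * h < s" "s \<le> real (Suc k) * h"
    have "\<tau> 0 \<omega> < ereal s" using le_less_trans[OF that(1), of "ereal s"] s(1) by simp
    then show "Dleft \<tau> d s \<omega> = Dproc \<tau> d s \<omega>"
      using that(2,3) s unfolding K_def Js_def by auto
  qed
  have D0: "D k = 0 \<longleftrightarrow> real k * h < r" for k
    using Dalt_zero_iff[of d \<omega> \<tau> "real k * h", OF d] r by (simp add: D_def Dproc_eq_Dalt)
  have ge0: "\<tau> 0 \<omega> \<le> ereal (real k * h)" if "D k \<noteq> 0" for k using D0[of k] that r by simp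
  define P0 where "P0 = {k. k < n \<and> D k = 0}"
  define P1 where "P1 = {k. k < n \<and> D k \<noteq> 0 \<and> D k \<noteq> \<theta> \<omega>}"
  define P2 where "P2 = {k. k < n \<and> D k \<noteq> 0 \<and> D k \<noteq> D (Suc k)}"
  have fin: "finite P0" "finite P1" "finite P2" by (auto simp: P0_def P1_def P2_def)
  have ind: "(\<Sum>k<n. (if Q k then 1 else 0)) = real (card {k. k < n \<and> Q k})" for Q
    by (simp add: sum.If_cases Int_def lessThan_def)
  have "(\<Sum>k<n. grid_cost \<theta> c0 c1 c2 \<tau> d h k \<omega>) =
     (\<Sum>k<n. h * c0 * (if D k = 0 then 1 else 0) + h * c1 * (if D k \<noteq> 0 \<and> D k \<noteq> \<theta> \<omega> then 1 else 0)
        + c2 * (if D k \<noteq> 0 \<and> D k \<noteq> D (Suc k) then 1 else 0))"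
    by (intro sum.cong) (auto simp: grid_cost_def D_def Dproc_eq_Dalt)
  also have "\<dots> = h * c0 * real (card P0) + h * c1 * real (card P1) + c2 * real (card P2)"
    unfolding sum.distrib sum_distrib_left[symmetric] ind P0_def P1_def P2_def ..
  also have "\<dots> \<le> c0 * (r + h) + c1 * (I + h * N) + c2 * N"
  proof (intro add_mono)
    have "P0 \<subseteq> {..<nat \<lceil>r / h\<rceil>}"
    proof
      fix k assume "k \<in> P0"
      then have "real k < r / h" using D0 h by (simp add: P0_def field_simps)
      then show "k \<in> {..<nat \<lceil>r / h\<rceil>}" by (simp add: less_ceiling_iff zless_nat_eq_int_zless)
    qed
    then have "card P0 \<le> nat \<lceil>r / h\<rceil>" by (metis card_lessThan card_mono finite_lessThan)
    moreover have "real (nat \<lceil>r / h\<rceil>) \<le> r / h + 1" using r h by (simp add: of_nat_nat)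
    ultimately have "real (card P0) \<le> r / h + 1" by linarith
    then have "h * real (card P0) \<le> r + h" using h by (simp add: field_simps)
    then show "h * c0 * real (card P0) \<le> c0 * (r + h)" using c by (simp add: mult_ac)
    have "h * real (card (P1 - K)) \<le> I"
    proof -
      let ?A = "\<lambda>k::nat. {real k * h..<real (Suc k) * h}"
      have disj: "disjoint_family_on ?A (P1 - K)"
      unfolding disjoint_family_on_def
      proof (intro ballI impI)
        fix k m :: nat assume "k \<noteq> m"
        have "?A k \<inter> ?A m = {}" if "k < m" for k m :: nat
        proof -
          have "real (Suc k) * h \<le> real m * h" using that h by (intro mult_right_mono) auto
          then show ?thesis by auto
        qed
        then show "?A k \<inter> ?A m = {}" using \<open>k \<noteq> m\<close> by (metis Int_commute linorder_neqE_nat)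
      qed
      have sub: "(\<Union>k\<in>P1 - K. ?A k) \<subseteq> {t. \<tau> 0 \<omega> \<le> ereal t \<and> Dproc \<tau> d t \<omega> \<noteq> \<theta> \<omega>}"
      proof
        fix t assume "t \<in> (\<Union>k\<in>P1 - K. ?A k)"
        then obtain k where k: "k \<in> P1" "k \<notin> K" "real k * h \<le> t" "t < real (Suc k) * h" by auto
        have k0: "\<tau> 0 \<omega> \<le> ereal (real k * h)" using ge0 k(1) by (simp add: P1_def)
        have "Dproc \<tau> d t \<omega> = D k" using const[OF k0 _ k(2,3)] k(1,4) by (simp add: P1_def)
        then show "t \<in> {t. \<tau> 0 \<omega> \<le> ereal t \<and> Dproc \<tau> d t \<omega> \<noteq> \<theta> \<omega>}"
          using k k0 by (auto simp: P1_def intro: order.trans)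
      qed
      have "ennreal (h * real (card (P1 - K))) = (\<Sum>k\<in>P1 - K. ennreal h)"
        using h by (simp add: ennreal_mult' ennreal_of_nat_eq_real_of_nat mult.commute)
      also have "\<dots> = (\<Sum>k\<in>P1 - K. emeasure lborel (?A k))"
        using h by (intro sum.cong) (auto simp: algebra_simps)
      also have "\<dots> = emeasure lborel (\<Union>k\<in>P1 - K. ?A k)"
        using fin disj by (intro sum_emeasure) auto
      also have "\<dots> = (\<integral>\<^sup>+ t. indicator (\<Union>k\<in>P1 - K. ?A k) t \<partial>lborel)"
        using fin by (intro nn_integral_indicator[symmetric] sets.finite_UN) auto
      also have "\<dots> \<le> (\<integral>\<^sup>+ t. indicator {t. \<tau> 0 \<omega> \<le> ereal t \<and> Dproc \<tau> d t \<omega> \<noteq> \<theta> \<omega>} t \<partial>lborel)"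
        using sub by (rule nn_integral_indicator_mono)
      finally show ?thesis unfolding I(1) using I(2) by simp
    qed
    moreover have "card P1 \<le> card (P1 - K) + card K"
      using fin finK by (intro order.trans[OF card_mono[of "(P1 - K) \<union> K"] card_Un_le]) auto
    then have "real (card P1) \<le> real (card (P1 - K)) + real (card K)" by linarith
    then have "h * real (card P1) \<le> h * real (card (P1 - K)) + h * real (card K)"
      using mult_left_mono[of _ _ h] h by (simp add: distrib_left[symmetric])
    moreover have "h * real (card K) \<le> h * N" using K h by simp
    ultimately have "h * real (card P1) \<le> I + h * N" by linarith
    then show "h * c1 * real (card P1) \<le> c1 * (I + h * N)" using c by (simp add: mult_ac)
    have "P2 \<subseteq> K"
    proof
      fix k assume k: "k \<in> P2"
      show "k \<in> K"
      proof (rule ccontr)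
        assume "k \<notin> K"
        then have "Dproc \<tau> d (real (Suc k) * h) \<omega> = D k"
          using k h by (intro const ge0) (auto simp: P2_def)
        then show False using k by (simp add: P2_def D_def)
      qed
    qed
    then have "card P2 \<le> N" using K finK card_mono order.trans by blast
    then show "c2 * real (card P2) \<le> c2 * N" using c by simp
  qed
  finally show ?thesis unfolding N_def Js_def .
qed

end

text \<open>The excess \<open>h * c1\<close> per jump is the fraction \<open>h * c1 / c2\<close> of
  the price of that jump, which turns an additive error growing with the number of jumps into the
  factor \<open>1 + h * c1 / c2\<close>.\<close>

lemma grid_cost_le_path_cost:
  fixes \<theta> :: "'a \<Rightarrow> real" and n :: nat
  assumes d: "d \<omega> \<in> {-1, 1}" and h: "h > 0" and c: "c0 > 0" "c1 > 0" "c2 > 0" and \<theta>: "\<theta> \<omega> \<noteq> 0" and \<tau>0: "0 \<le> \<tau> 0 \<omega>"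
  shows "ennreal (((\<Sum>k<n. grid_cost \<theta> c0 c1 c2 \<tau> d h k \<omega>) - h * c0) / (1 + h * c1 / c2)) \<le> path_cost \<theta> c0 c1 c2 \<tau> d \<omega>"
proof (cases "path_cost \<theta> c0 c1 c2 \<tau> d \<omega> = \<infinity>")
  case False
  let ?I = "\<integral>\<^sup>+ t. indicator {t. \<tau> 0 \<omega> \<le> ereal t \<and> Dproc \<tau> d t \<omega> \<noteq> \<theta> \<omega>} t \<partial>lborel"
  let ?J = "{t. \<tau> 0 \<omega> < ereal t \<and> Dleft \<tau> d t \<omega> \<noteq> Dproc \<tau> d t \<omega>}"
  have fin: "ennreal c0 * e2ennreal (\<tau> 0 \<omega>) \<noteq> \<infinity>" "ennreal c1 * ?I \<noteq> \<infinity>" "ennreal c2 * emeasure (count_space UNIV) ?J \<noteq> \<infinity>"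
    using False unfolding path_cost_def by auto
  have I: "?I \<noteq> \<infinity>" using fin(2) c by (auto simp: ennreal_mult_eq_top_iff)
  have J: "finite ?J"
    using fin(3) c by (cases "finite ?J") (auto simp: ennreal_mult_eq_top_iff)
  obtain r where r: "\<tau> 0 \<omega> = ereal r" "0 \<le> r"
    using fin(1) c \<tau>0 by (cases "\<tau> 0 \<omega>") (auto simp: ennreal_mult_eq_top_iff)
  define Ir where "Ir = enn2real ?I"
  have Ir: "?I = ennreal Ir" "0 \<le> Ir" using I by (auto simp: Ir_def less_top)
  note na = between_if_integral_finite[of \<theta>, OF I \<theta>]
  define N where "N = real (card ?J)"
  have emJ: "emeasure (count_space UNIV) ?J = ennreal N"
    unfolding N_def by (simp only: emeasure_count_space_finite[OF subset_UNIV J] ennreal_of_nat_eq_real_of_nat)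
  define G where "G = (\<Sum>k<n. grid_cost \<theta> c0 c1 c2 \<tau> d h k \<omega>)"
  have "G \<le> c0 * (r + h) + c1 * (Ir + h * N) + c2 * N"
    unfolding G_def N_def using na by (intro grid_cost_le d h c r J Ir) auto
  also have "\<dots> \<le> (1 + h * c1 / c2) * (c0 * r + c1 * Ir + c2 * N) + h * c0"
  proof -
    have "(1 + h * c1 / c2) * (c0 * r + c1 * Ir + c2 * N) =
      (c0 * r + c1 * Ir + c2 * N) + (h * c1 / c2) * (c0 * r + c1 * Ir) + h * c1 * N"
      using c by (simp add: field_simps)
    moreover have "0 \<le> (h * c1 / c2) * (c0 * r + c1 * Ir)" using c h r Ir by auto
    ultimately show ?thesis by (simp add: algebra_simps)
  qed
  finally have "(G - h * c0) / (1 + h * c1 / c2) \<le> c0 * r + c1 * Ir + c2 * N"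
    using c h by (subst pos_divide_le_eq) (auto simp: add_pos_pos mult.commute)
  then have "ennreal ((G - h * c0) / (1 + h * c1 / c2)) \<le> ennreal (c0 * r + c1 * Ir + c2 * N)"
    by (rule ennreal_leI)
  also have "\<dots> = path_cost \<theta> c0 c1 c2 \<tau> d \<omega>"
    unfolding path_cost_def Ir(1) emJ unfolding r(1) using c r Ir
    by (simp add: ennreal_mult' N_def)
  finally show ?thesis unfolding G_def .
qed simp

end

subsection \<open>Lower bound for the risk of an arbitrary rule\<close>

locale testing_problem = nondegenerate M W \<theta> \<mu> p + free_boundary \<mu> c0 c1 c2 A B
  for M :: "'a measure" and W \<theta> \<mu> p c0 c1 c2 A B
begin

definition wrong :: "real \<Rightarrow> 'a \<Rightarrow> real" where
  "wrong j \<omega> = (if \<theta> \<omega> = j then 0 else 1)"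

lemma wrong_meas [measurable]: "wrong j \<in> borel_measurable M"
  unfolding wrong_def[abs_def] by measurable

lemma wrong_eq: "\<omega> \<in> space M \<Longrightarrow> j \<in> {-1, 1} \<Longrightarrow> wrong j \<omega> = (1 - j * \<theta> \<omega>) / 2"
  using \<theta>_vals[of \<omega>] by (auto simp: wrong_def)

lemma U_affine: "j \<in> {-1, 1} \<Longrightarrow> \<bar>m\<bar> < 1 \<Longrightarrow> U (j * m) = affine_logit (K * j) (- K) a (- a * j) m"
  by (auto simp: U_def affine_logit_def logit_minus algebra_simps)

lemma F0_affine: "F0 m = affine_logit 0 (- C) C0 0 m"
  by (simp add: F0_def affine_logit_def algebra_simps)

lemma K_\<mu>: "2 * \<mu>\<^sup>2 * K = c1 / 2" and C_\<mu>: "2 * \<mu>\<^sup>2 * C = c0"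
  using \<mu> by (auto simp: K_def C_def)

lemma integrable_indicator_Mp:
  assumes t: "0 \<le> t" and E: "E \<in> sets M" and q: "q \<in> borel_measurable borel"
    and bd: "\<And>m. \<bar>m\<bar> < 1 \<Longrightarrow> \<bar>q m\<bar> \<le> b + b' * (logit m)\<^sup>2"
  shows "integrable M (\<lambda>\<omega>. indicator E \<omega> * q (Mp t \<omega>))"
  using integrable_real_mult_indicator[OF E integrable_of_Mp[OF t q bd]] by (simp add: mult.commute)

lemma U_drift:
  assumes st: "0 \<le> s" "s \<le> t" and E: "E \<in> FX M X s" and j: "j \<in> {-1, 1}"
  shows "(LINT \<omega>|M. indicator E \<omega> * U (j * Mp t \<omega>)) =
    (LINT \<omega>|M. indicator E \<omega> * U (j * Mp s \<omega>)) - c1 * (t - s) * (LINT \<omega>|M. indicator E \<omega> * wrong j \<omega>)"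
proof -
  have "(LINT \<omega>|M. indicator E \<omega> * (K * j * \<theta> \<omega> + - K)) = (LINT \<omega>|M. (- 2 * K) * (indicator E \<omega> * wrong j \<omega>))"
    using j by (intro Bochner_Integration.integral_cong) (auto simp: wrong_eq algebra_simps)
  also have "\<dots> = (- 2 * K) * (LINT \<omega>|M. indicator E \<omega> * wrong j \<omega>)" by simp
  finally have *: "2 * \<mu>\<^sup>2 * (t - s) * (LINT \<omega>|M. indicator E \<omega> * (K * j * \<theta> \<omega> + - K))
    = - (2 * (2 * \<mu>\<^sup>2 * K)) * (t - s) * (LINT \<omega>|M. indicator E \<omega> * wrong j \<omega>)" by (simp add: algebra_simps)
  show ?thesis
    using affine_logit_drift[OF st E, of "K * j" "- K" a "- a * j"] unfolding * K_\<mu>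
    by (simp add: U_affine[OF j Mp_abs])
qed

lemma F0_drift:
  assumes st: "0 \<le> s" "s \<le> t" and E: "E \<in> FX M X s"
  shows "(LINT \<omega>|M. indicator E \<omega> * F0 (Mp t \<omega>)) =
    (LINT \<omega>|M. indicator E \<omega> * F0 (Mp s \<omega>)) - c0 * (t - s) * (LINT \<omega>|M. indicator E \<omega>)"
proof -
  have *: "2 * \<mu>\<^sup>2 * (t - s) * (LINT \<omega>|M. indicator E \<omega> * (0 * \<theta> \<omega> + - C))
    = - (2 * \<mu>\<^sup>2 * C) * (t - s) * (LINT \<omega>|M. indicator E \<omega>)" by (simp add: algebra_simps)
  show ?thesis
    using affine_logit_drift[OF st E, of 0 "- C" C0 0] unfolding * C_\<mu> by (simp add: F0_affine)
qed

lemma abs_U_bound: assumes "\<bar>m\<bar> < 1" "j \<in> {-1, 1}" shows "\<bar>U (j * m)\<bar> \<le> (2 * K + 2 * a) + 2 * K * (logit m)\<^sup>2"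
  using affine_logit_bound[OF assms(1), of "K * j" "- K" a "- a * j"] assms(2) K_pos a_gt
  by (auto simp: U_affine[OF assms(2,1)] abs_mult)

lemma abs_F0_bound: assumes "\<bar>m\<bar> < 1" shows "\<bar>F0 m\<bar> \<le> (C + \<bar>C0\<bar>) + C * (logit m)\<^sup>2"
  using affine_logit_bound[OF assms(1), of 0 "- C" C0 0] C_pos by (simp add: F0_affine)

lemma abs_kB_bound: assumes "\<bar>m\<bar> < 1" shows "\<bar>kB m\<bar> \<le> (2 * K + 2 * a + c2) + 2 * K * (logit m)\<^sup>2"
proof -
  have "\<bar>2 * K * logit m\<bar> \<le> 2 * K + 2 * K * (logit m)\<^sup>2"
    using mult_left_mono[OF abs_logit_le[of m], of "2 * K"] K_pos by (simp add: abs_mult algebra_simps)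
  moreover have "\<bar>2 * a * m\<bar> \<le> 2 * a" using assms a_gt K_pos by (simp add: abs_mult mult_left_le)
  moreover have "0 \<le> 2 * K * (logit m)\<^sup>2" using K_pos by simp
  ultimately show ?thesis using c2 K_pos a_gt unfolding kB_def by auto
qed

lemma abs_kA_bound: assumes "\<bar>m\<bar> < 1"
  shows "\<bar>kA m\<bar> \<le> (2 * K + 2 * a + C + \<bar>C0\<bar>) + (2 * K + C) * (logit m)\<^sup>2"
proof -
  have "0 \<le> (2 * K + 2 * a + C + \<bar>C0\<bar>)" "0 \<le> (2 * K + C) * (logit m)\<^sup>2" using K_pos C_pos a_gt by auto
  then show ?thesis
    using abs_U_bound[OF assms, of 1] abs_F0_bound[OF assms] unfolding kA_def by (auto simp: algebra_simps)
qed

lemma logit_square_minus: "\<bar>m\<bar> < 1 \<Longrightarrow> (logit (- m))\<^sup>2 = (logit m)\<^sup>2"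
  by (simp add: logit_minus)

definition Val :: "real \<Rightarrow> real \<Rightarrow> real" where
  "Val j m = (if j = 0 then V0 m else V1 (j * m))"

lemma Val_measurable [measurable]: "Val j \<in> borel_measurable borel"
  unfolding Val_def[abs_def] by measurable

lemma Val_bound: "j \<in> {-1, 0, 1} \<Longrightarrow> \<exists>b b'. \<forall>m. \<bar>m\<bar> < 1 \<longrightarrow> \<bar>Val j m\<bar> \<le> b + b' * (logit m)\<^sup>2"
proof (cases "j = 0")
  case True
  let ?b = "(C + \<bar>C0\<bar>) + 2 * (2 * K + 2 * a + C + \<bar>C0\<bar>)" and ?c = "C + 2 * (2 * K + C)"
  have "\<bar>Val j m\<bar> \<le> ?b + ?c * (logit m)\<^sup>2" if m: "\<bar>m\<bar> < 1" for m
    using abs_F0_bound[OF m] abs_kA_bound[OF m] abs_kA_bound[of "- m"] m True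
    unfolding Val_def V0_def by (auto simp: logit_square_minus algebra_simps)
  then show ?thesis by blast
next
  case False
  assume "j \<in> {-1, 0, 1}"
  then have j: "j \<in> {-1, 1}" using False by auto
  let ?b = "(2 * K + 2 * a) + (2 * K + 2 * a + c2)" and ?c = "4 * K"
  have "\<bar>Val j m\<bar> \<le> ?b + ?c * (logit m)\<^sup>2" if m: "\<bar>m\<bar> < 1" for m
  proof -
    have jm: "\<bar>- (j * m)\<bar> < 1" "(logit (- (j * m)))\<^sup>2 = (logit m)\<^sup>2"
      using j m by (auto simp: logit_square_minus)
    show ?thesis using abs_U_bound[OF m j] abs_kB_bound[OF jm(1)] False
      unfolding Val_def V1_def jm(2) by (auto simp: algebra_simps)
  qed
  then show ?thesis by blast
qed

lemma integrable_Val: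
  assumes "j \<in> {-1, 0, 1}" "0 \<le> t" "E \<in> sets M"
  shows "integrable M (\<lambda>\<omega>. indicator E \<omega> * Val j (Mp t \<omega>))"
proof -
  obtain b b' where "\<And>m. \<bar>m\<bar> < 1 \<Longrightarrow> \<bar>Val j m\<bar> \<le> b + b' * (logit m)\<^sup>2" using Val_bound[OF assms(1)] by blast
  then show ?thesis by (intro integrable_indicator_Mp[OF assms(2,3)]) auto
qed

definition run_cost :: "real \<Rightarrow> 'a \<Rightarrow> real" where
  "run_cost j \<omega> = (if j = 0 then c0 else c1 * wrong j \<omega>)"

text \<open>The value function is the sum of a function with exactly known drift and of a convex function of
  the martingale \<open>Mp\<close>.\<close>

lemma Val_drift:
  assumes st: "0 \<le> s" "s \<le> t" and E: "E \<in> FX M X s" and j: "j \<in> {-1, 0, 1}"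
  shows "(LINT \<omega>|M. indicator E \<omega> * Val j (Mp s \<omega>)) \<le>
    (LINT \<omega>|M. indicator E \<omega> * Val j (Mp t \<omega>)) + (t - s) * (LINT \<omega>|M. indicator E \<omega> * run_cost j \<omega>)"
proof -
  have t: "0 \<le> t" using st by simp
  have EM: "E \<in> sets M" using E FX_sets by auto
  show ?thesis
  proof (cases "j = 0")
    case True
    define q where "q m = kA m + kA (- m)" for m
    have qm: "q \<in> borel_measurable borel" unfolding q_def[abs_def] by measurable
    have qc: "convex_on {-1<..<1} q"
      unfolding q_def[abs_def] using convex_kA convex_on_uminus_arg[of 1 kA] by (intro convex_on_add) auto
    have qb: "\<bar>q m\<bar> \<le> 2 * (2 * K + 2 * a + C + \<bar>C0\<bar>) + 2 * (2 * K + C) * (logit m)\<^sup>2" if "\<bar>m\<bar> < 1" for m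
      using abs_kA_bound[OF that] abs_kA_bound[of "- m"] that
      unfolding q_def by (auto simp: logit_square_minus algebra_simps)
    have F0_m: "F0 \<in> borel_measurable borel" by measurable
    have split: "(LINT \<omega>|M. indicator E \<omega> * Val j (Mp r \<omega>)) =
      (LINT \<omega>|M. indicator E \<omega> * F0 (Mp r \<omega>)) + (LINT \<omega>|M. indicator E \<omega> * q (Mp r \<omega>))" if "0 \<le> r" for r
      using integrable_indicator_Mp[OF that EM F0_m abs_F0_bound] integrable_indicator_Mp[OF that EM qm qb]
      by (simp add: Val_def V0_def True q_def distrib_left)
    have "(LINT \<omega>|M. indicator E \<omega> * run_cost j \<omega>) = c0 * (LINT \<omega>|M. indicator E \<omega>)"
      by (simp add: run_cost_def True)
    then show ?thesis
      unfolding split[OF st(1)] split[OF t]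
      using F0_drift[OF st E] Mp_jensen[OF st E qc qm qb] by (simp add: algebra_simps)
  next
    case False
    then have j: "j \<in> {-1, 1}" using j by auto
    define q where "q m = kB (- (j * m))" for m
    have qm: "q \<in> borel_measurable borel" unfolding q_def[abs_def] by measurable
    have "q = kB \<or> q = (\<lambda>m. kB (- m))" using j by (auto simp: q_def fun_eq_iff)
    then have qc: "convex_on {-1<..<1} q" using convex_kB convex_on_uminus_arg[of 1 kB] by auto
    have qb: "\<bar>q m\<bar> \<le> (2 * K + 2 * a + c2) + 2 * K * (logit m)\<^sup>2" if m: "\<bar>m\<bar> < 1" for m
    proof -
      have jm: "\<bar>- (j * m)\<bar> < 1" "(logit (- (j * m)))\<^sup>2 = (logit m)\<^sup>2"
        using j m by (auto simp: logit_square_minus)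
      show ?thesis using abs_kB_bound[OF jm(1)] unfolding jm(2) q_def .
    qed
    have Um: "(\<lambda>m. U (j * m)) \<in> borel_measurable borel" by measurable
    have split: "(LINT \<omega>|M. indicator E \<omega> * Val j (Mp r \<omega>)) =
      (LINT \<omega>|M. indicator E \<omega> * U (j * Mp r \<omega>)) + (LINT \<omega>|M. indicator E \<omega> * q (Mp r \<omega>))" if "0 \<le> r" for r
      using integrable_indicator_Mp[OF that EM Um abs_U_bound[OF _ j]] integrable_indicator_Mp[OF that EM qm qb] False
      by (simp add: Val_def V1_def q_def distrib_left)
    have "(LINT \<omega>|M. indicator E \<omega> * run_cost j \<omega>) = (LINT \<omega>|M. c1 * (indicator E \<omega> * wrong j \<omega>))"
      using False by (simp add: run_cost_def mult_ac)
    also have "\<dots> = c1 * (LINT \<omega>|M. indicator E \<omega> * wrong j \<omega>)" by simp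
    finally show ?thesis
      unfolding split[OF st(1)] split[OF t]
      using U_drift[OF st E j] Mp_jensen[OF st E qc qm qb] by (simp add: algebra_simps)
  qed
qed

lemma Val_ge_V0: "\<bar>m\<bar> < 1 \<Longrightarrow> j \<in> {-1, 0, 1} \<Longrightarrow> V0 m \<le> Val j m"
proof -
  assume m: "\<bar>m\<bar> < 1" and j: "j \<in> {-1, 0, 1}"
  have "V0 (- m) = V0 m" using m by (simp add: V0_eq F0_minus)
  then show ?thesis using j V0_le_V1[OF m] V0_le_V1[of "- m"] m by (auto simp: Val_def)
qed

text \<open>Leaving the undecided state is free and cannot lower the value, because
  \<open>V0\<close> is at most \<open>V1\<close> for either sign; a change of sign costs
  \<open>c2\<close> and is covered by \<open>V1_switch\<close>. A decision once made is never
  withdrawn, which is the last condition on \<open>i\<close> and \<open>j\<close>.\<close>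

lemma Val_switch:
  assumes m: "\<bar>m\<bar> < 1" and ij: "i \<in> {-1, 0, 1}" "j \<in> {-1, 0, 1}" "i \<noteq> 0 \<longrightarrow> j \<noteq> 0"
  shows "Val i m \<le> Val j m + c2 * (if i \<noteq> 0 \<and> i \<noteq> j then 1 else 0)"
proof (cases "i = 0")
  case True then show ?thesis using Val_ge_V0[OF m ij(2)] by (simp add: Val_def)
next
  case False
  then have "j = i \<or> j = - i" "i * m = m \<or> i * m = - m" using ij by auto
  then show ?thesis using False V1_switch[of "i * m"] m by (auto simp: Val_def)
qed

context
  fixes \<tau> :: "nat \<Rightarrow> 'a \<Rightarrow> ereal" and d :: "'a \<Rightarrow> real"
  assumes rule: "decision_rule M (FX M X) \<tau> d"
begin

lemma rule_mono: "\<omega> \<in> space M \<Longrightarrow> \<tau> n \<omega> \<le> \<tau> (Suc n) \<omega>"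
  and rule_d: "\<omega> \<in> space M \<Longrightarrow> d \<omega> \<in> {-1, 1}"
  and rule_nonneg: "\<omega> \<in> space M \<Longrightarrow> 0 \<le> \<tau> n \<omega>"
  using rule unfolding decision_rule_def stopping_time_ext_def by auto

abbreviation D :: "real \<Rightarrow> 'a \<Rightarrow> real" where "D \<equiv> Dalt \<tau> d"

lemma D_vals: "\<omega> \<in> space M \<Longrightarrow> D t \<omega> \<in> {-1, 0, 1}"
  using rule_d[of \<omega>] by (auto simp: Dalt_def)

lemma D_zero_iff: "\<omega> \<in> space M \<Longrightarrow> D t \<omega> = 0 \<longleftrightarrow> ereal t < \<tau> 0 \<omega>"
  by (intro Dalt_zero_iff rule_d)

text \<open>The first decision is observable only after \<open>\<tau> 0\<close>, so it enters
  through the event that combines both. The process is then recovered from this event and the parity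
  of the current stage.\<close>

lemma D_adapted:
  assumes t: "0 \<le> t" shows "D t \<in> borel_measurable (Fm t)"
proof -
  have [measurable]: "Measurable.pred (Fm t) (\<lambda>\<omega>. \<tau> n \<omega> \<le> ereal t)" for n
    using rule t unfolding decision_rule_def stopping_time_ext_def pred_def by auto
  have "d -` {1} \<inter> space M \<in> F_at M (FX M X) (\<tau> 0)"
    using rule unfolding decision_rule_def by auto
  then have "(d -` {1} \<inter> space M) \<inter> {\<omega>\<in>space M. \<tau> 0 \<omega> \<le> ereal t} \<in> sets (Fm t)"
    using t unfolding F_at_def by auto
  also have "(d -` {1} \<inter> space M) \<inter> {\<omega>\<in>space M. \<tau> 0 \<omega> \<le> ereal t} = {\<omega>\<in>space (Fm t). \<tau> 0 \<omega> \<le> ereal t \<and> d \<omega> = 1}" by auto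
  finally have [measurable]: "Measurable.pred (Fm t) (\<lambda>\<omega>. \<tau> 0 \<omega> \<le> ereal t \<and> d \<omega> = 1)"
    unfolding pred_def .
  let ?ev = "\<lambda>\<omega>. \<exists>n. \<tau> (2*n) \<omega> \<le> ereal t \<and> \<not> \<tau> (2*n+1) \<omega> \<le> ereal t"
  have "(\<lambda>\<omega>. if \<not> \<tau> 0 \<omega> \<le> ereal t then 0 else
      if ?ev \<omega> = (\<tau> 0 \<omega> \<le> ereal t \<and> d \<omega> = 1) then 1 else -1 :: real) \<in> borel_measurable (Fm t)"
    by measurable
  then show ?thesis
    by (subst measurable_cong[where g="\<lambda>\<omega>. if \<not> \<tau> 0 \<omega> \<le> ereal t then 0 else
      if ?ev \<omega> = (\<tau> 0 \<omega> \<le> ereal t \<and> d \<omega> = 1) then 1 else -1 :: real"])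
      (use rule_d in \<open>auto simp: Dalt_def not_le\<close>)
qed

lemma D_meas [measurable (raw)]: "0 \<le> t \<Longrightarrow> D t \<in> borel_measurable M"
  using D_adapted[of t] measurable_from_subalg[OF subalgebra_Fm] by blast

lemma D_set: "0 \<le> t \<Longrightarrow> {\<omega>\<in>space M. D t \<omega> = j} \<in> FX M X t"
proof -
  assume "0 \<le> t"
  then have "{\<omega>\<in>space (Fm t). D t \<omega> = j} \<in> sets (Fm t)" using D_adapted by measurable
  then show ?thesis by simp
qed

lemma split_D:
  assumes "\<omega> \<in> space M"
  shows "f (D t \<omega>) = (\<Sum>j\<in>{-1, 0, 1}. indicator {\<omega>\<in>space M. D t \<omega> = j} \<omega> * f j :: real)"
  using D_vals[OF assms, of t] assms by (auto simp: indicator_def)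

lemma integrable_Val_D:
  assumes "0 \<le> s" "0 \<le> t" shows "integrable M (\<lambda>\<omega>. Val (D s \<omega>) (Mp t \<omega>))"
proof -
  have "integrable M (\<lambda>\<omega>. \<Sum>j\<in>{-1, 0, 1}. indicator {\<omega>\<in>space M. D s \<omega> = j} \<omega> * Val j (Mp t \<omega>))"
    using D_set[OF assms(1)] FX_sets assms(2) by (intro Bochner_Integration.integrable_sum integrable_Val) auto
  moreover have "integrable M (\<lambda>\<omega>. Val (D s \<omega>) (Mp t \<omega>)) \<longleftrightarrow>
      integrable M (\<lambda>\<omega>. \<Sum>j\<in>{-1, 0, 1}. indicator {\<omega>\<in>space M. D s \<omega> = j} \<omega> * Val j (Mp t \<omega>))"
    by (intro Bochner_Integration.integrable_cong refl split_D)
  ultimately show ?thesis by blast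
qed

lemma run_cost_measurable [measurable (raw)]: "0 \<le> t \<Longrightarrow> (\<lambda>\<omega>. run_cost (D t \<omega>) \<omega>) \<in> borel_measurable M"
  unfolding run_cost_def wrong_def by measurable

lemma run_cost_bounds: "0 \<le> run_cost j \<omega>" "run_cost j \<omega> \<le> c0 + c1"
  using c0 c1 by (auto simp: run_cost_def wrong_def)

lemma integrable_run_cost: "0 \<le> t \<Longrightarrow> integrable M (\<lambda>\<omega>. run_cost (D t \<omega>) \<omega>)"
  using run_cost_bounds by (intro integrable_const_bound[where B="c0 + c1"]) auto

lemma Val_D_drift:
  assumes st: "0 \<le> s" "s \<le> t"
  shows "(LINT \<omega>|M. Val (D s \<omega>) (Mp s \<omega>)) \<le> (LINT \<omega>|M. Val (D s \<omega>) (Mp t \<omega>)) + (t - s) * (LINT \<omega>|M. run_cost (D s \<omega>) \<omega>)"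
proof -
  have t: "0 \<le> t" using st by simp
  let ?E = "\<lambda>j. {\<omega>\<in>space M. D s \<omega> = j}"
  have E: "?E j \<in> FX M X s" for j by (rule D_set[OF st(1)])
  then have EM: "?E j \<in> sets M" for j using FX_sets by blast
  have V: "(LINT \<omega>|M. Val (D s \<omega>) (Mp r \<omega>)) = (\<Sum>j\<in>{-1, 0, 1}. (LINT \<omega>|M. indicator (?E j) \<omega> * Val j (Mp r \<omega>)))" if "0 \<le> r" for r
  proof -
    have "(LINT \<omega>|M. Val (D s \<omega>) (Mp r \<omega>)) = (LINT \<omega>|M. (\<Sum>j\<in>{-1, 0, 1}. indicator (?E j) \<omega> * Val j (Mp r \<omega>)))"
      by (intro Bochner_Integration.integral_cong refl split_D)
    also have "\<dots> = (\<Sum>j\<in>{-1, 0, 1}. (LINT \<omega>|M. indicator (?E j) \<omega> * Val j (Mp r \<omega>)))"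
      using EM that by (intro Bochner_Integration.integral_sum integrable_Val) auto
    finally show ?thesis .
  qed
  have R: "(LINT \<omega>|M. run_cost (D s \<omega>) \<omega>) = (\<Sum>j\<in>{-1, 0, 1}. (LINT \<omega>|M. indicator (?E j) \<omega> * run_cost j \<omega>))"
  proof -
    have "(LINT \<omega>|M. run_cost (D s \<omega>) \<omega>) = (LINT \<omega>|M. (\<Sum>j\<in>{-1, 0, 1}. indicator (?E j) \<omega> * run_cost j \<omega>))"
      by (intro Bochner_Integration.integral_cong refl split_D[where f="\<lambda>j. run_cost j _"])
    also have "\<dots> = (\<Sum>j\<in>{-1, 0, 1}. (LINT \<omega>|M. indicator (?E j) \<omega> * run_cost j \<omega>))"
    proof (intro Bochner_Integration.integral_sum integrable_const_bound[where B="c0 + c1"])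
      fix j :: real
      have [measurable]: "run_cost j \<in> borel_measurable M" unfolding run_cost_def[abs_def] by measurable
      show "(\<lambda>\<omega>. indicator (?E j) \<omega> * run_cost j \<omega>) \<in> borel_measurable M" using EM by measurable
      show "AE \<omega> in M. norm (indicator (?E j) \<omega> * run_cost j \<omega>) \<le> c0 + c1"
        using run_cost_bounds[of j] c0 c1 by (auto simp: indicator_def)
    qed
    finally show ?thesis .
  qed
  show ?thesis
    unfolding V[OF st(1)] V[OF t] R sum_distrib_left sum.distrib[symmetric]
    by (intro sum_mono Val_drift[OF st E])
qed

text \<open>Over a cell the decision at its left end is frozen and \<open>Val_D_drift\<close>
  applies; the change of decision is charged in one go at the right end by
  \<open>Val_switch\<close>.\<close>

lemma one_step:
  assumes h: "h > 0"
  shows "(LINT \<omega>|M. Val (D (real k * h) \<omega>) (Mp (real k * h) \<omega>)) \<le>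
    (LINT \<omega>|M. Val (D (real (Suc k) * h) \<omega>) (Mp (real (Suc k) * h) \<omega>)) + (LINT \<omega>|M. grid_cost \<theta> c0 c1 c2 \<tau> d h k \<omega>)"
    and "integrable M (grid_cost \<theta> c0 c1 c2 \<tau> d h k)"
proof -
  define s where "s = real k * h"
  define t where "t = real (Suc k) * h"
  have st: "0 \<le> s" "s \<le> t" "t - s = h" and t0: "0 \<le> t" using h by (auto simp: s_def t_def algebra_simps)
  let ?sw = "\<lambda>\<omega>. if D s \<omega> \<noteq> 0 \<and> D s \<omega> \<noteq> D t \<omega> then 1 else 0 :: real"
  note [measurable] = D_meas[OF st(1)] D_meas[OF t0]
  have sw: "integrable M ?sw" by (intro integrable_const_bound[where B=1]) auto
  have g: "grid_cost \<theta> c0 c1 c2 \<tau> d h k \<omega> = h * run_cost (D s \<omega>) \<omega> + c2 * ?sw \<omega>" for \<omega>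
    by (auto simp: grid_cost_def run_cost_def wrong_def s_def t_def)
  show int: "integrable M (grid_cost \<theta> c0 c1 c2 \<tau> d h k)"
    unfolding g[abs_def] using sw integrable_run_cost[OF st(1)] by auto
  have "(LINT \<omega>|M. Val (D s \<omega>) (Mp s \<omega>)) \<le> (LINT \<omega>|M. Val (D s \<omega>) (Mp t \<omega>)) + h * (LINT \<omega>|M. run_cost (D s \<omega>) \<omega>)"
    using Val_D_drift[OF st(1,2)] unfolding st(3) .
  also have "(LINT \<omega>|M. Val (D s \<omega>) (Mp t \<omega>)) \<le> (LINT \<omega>|M. Val (D t \<omega>) (Mp t \<omega>) + c2 * ?sw \<omega>)"
  proof (rule integral_mono)
    fix \<omega> assume w: "\<omega> \<in> space M"
    have "D s \<omega> \<noteq> 0 \<longrightarrow> D t \<omega> \<noteq> 0"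
      using D_zero_iff[OF w] st(2) by (auto simp: not_less intro: order.trans)
    then show "Val (D s \<omega>) (Mp t \<omega>) \<le> Val (D t \<omega>) (Mp t \<omega>) + c2 * ?sw \<omega>"
      by (intro Val_switch Mp_abs D_vals w)
  qed (use integrable_Val_D st t0 sw in auto)
  also have "\<dots> = (LINT \<omega>|M. Val (D t \<omega>) (Mp t \<omega>)) + c2 * (LINT \<omega>|M. ?sw \<omega>)"
    using integrable_Val_D[OF t0 t0] sw by simp
  finally show "(LINT \<omega>|M. Val (D (real k * h) \<omega>) (Mp (real k * h) \<omega>)) \<le>
    (LINT \<omega>|M. Val (D (real (Suc k) * h) \<omega>) (Mp (real (Suc k) * h) \<omega>)) + (LINT \<omega>|M. grid_cost \<theta> c0 c1 c2 \<tau> d h k \<omega>)"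
    unfolding g s_def[symmetric] t_def[symmetric] using sw integrable_run_cost[OF st(1)] by simp
qed

lemma V0_le_grid:
  assumes h: "h > 0"
  shows "V0 (2 * p - 1) \<le> (LINT \<omega>|M. Val (D (real n * h) \<omega>) (Mp (real n * h) \<omega>)) + (LINT \<omega>|M. (\<Sum>k<n. grid_cost \<theta> c0 c1 c2 \<tau> d h k \<omega>))"
proof -
  have "V0 (2 * p - 1) = (LINT \<omega>|M. V0 (2 * p - 1))" by (simp add: prob_space)
  also have "\<dots> \<le> (LINT \<omega>|M. Val (D (real 0 * h) \<omega>) (Mp (real 0 * h) \<omega>))"
  proof (intro integral_mono integrable_Val_D)
    fix \<omega> assume w: "\<omega> \<in> space M"
    show "V0 (2 * p - 1) \<le> Val (D (real 0 * h) \<omega>) (Mp (real 0 * h) \<omega>)"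
      using Val_ge_V0[OF Mp_abs D_vals[OF w], of 0 \<omega> 0] Mp_0[OF w] by simp
  qed auto
  finally have start: "V0 (2 * p - 1) \<le> \<dots>" .
  have "(LINT \<omega>|M. Val (D (real 0 * h) \<omega>) (Mp (real 0 * h) \<omega>)) \<le>
    (LINT \<omega>|M. Val (D (real n * h) \<omega>) (Mp (real n * h) \<omega>)) + (\<Sum>k<n. (LINT \<omega>|M. grid_cost \<theta> c0 c1 c2 \<tau> d h k \<omega>))"
  proof (induction n)
    case (Suc n)
    then show ?case using one_step(1)[OF h, of n] by (simp only: sum.lessThan_Suc)
  qed simp
  also have "(\<Sum>k<n. (LINT \<omega>|M. grid_cost \<theta> c0 c1 c2 \<tau> d h k \<omega>)) = (LINT \<omega>|M. (\<Sum>k<n. grid_cost \<theta> c0 c1 c2 \<tau> d h k \<omega>))"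
    using one_step(2)[OF h] by (intro Bochner_Integration.integral_sum[symmetric]) auto
  finally show ?thesis using start by simp
qed

lemma grid_le_risk:
  assumes h: "h > 0" and R: "risk M \<theta> c0 c1 c2 \<tau> d = ennreal R" "0 \<le> R"
  shows "(LINT \<omega>|M. (\<Sum>k<n. grid_cost \<theta> c0 c1 c2 \<tau> d h k \<omega>)) \<le> (1 + h * c1 / c2) * R + h * c0"
proof -
  define z where "z = 1 + h * c1 / c2"
  have z: "z > 0" unfolding z_def using h c1 c2 by (simp add: add_pos_pos)
  define G where "G \<omega> = (\<Sum>k<n. grid_cost \<theta> c0 c1 c2 \<tau> d h k \<omega>)" for \<omega>
  have G: "integrable M G" unfolding G_def using one_step(2)[OF h] by (intro Bochner_Integration.integrable_sum) auto
  have int: "integrable M (\<lambda>\<omega>. (G \<omega> - h * c0) / z)" using G by simp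
  have "(\<integral>\<^sup>+\<omega>. ennreal ((G \<omega> - h * c0) / z) \<partial>M) \<le> risk M \<theta> c0 c1 c2 \<tau> d"
    unfolding risk_eq G_def z_def using rule_mono rule_d rule_nonneg \<theta>_vals h c0 c1 c2
    by (intro nn_integral_mono grid_cost_le_path_cost) force+
  then have le: "(\<integral>\<^sup>+\<omega>. ennreal ((G \<omega> - h * c0) / z) \<partial>M) \<le> ennreal R" unfolding R(1) .
  \<comment> \<open>The shifted grid cost may be negative, and \<open>ennreal\<close> cuts it off at
    0; passing to the positive part costs only an inequality in the right direction.\<close>
  have "(LINT \<omega>|M. (G \<omega> - h * c0) / z) \<le> (LINT \<omega>|M. max 0 ((G \<omega> - h * c0) / z))"
    using int by (intro integral_mono) auto
  also have "\<dots> = enn2real (\<integral>\<^sup>+\<omega>. ennreal (max 0 ((G \<omega> - h * c0) / z)) \<partial>M)"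
    using int by (intro integral_eq_nn_integral) auto
  also have "(\<integral>\<^sup>+\<omega>. ennreal (max 0 ((G \<omega> - h * c0) / z)) \<partial>M) = (\<integral>\<^sup>+\<omega>. ennreal ((G \<omega> - h * c0) / z) \<partial>M)"
    by (intro nn_integral_cong) (simp add: max_def ennreal_neg)
  also have "enn2real \<dots> \<le> R" using le R(2) by (intro enn2real_leI)
  finally have "((LINT \<omega>|M. G \<omega>) - h * c0) / z \<le> R" using G by (simp add: prob_space)
  then have "(LINT \<omega>|M. G \<omega>) \<le> z * R + h * c0" using z by (simp add: pos_divide_le_eq algebra_simps)
  then show ?thesis unfolding G_def z_def .
qed

text \<open>Bounds the terminal value by the expected running cost at the same time. An undecided
  state has value at most \<open>2 * Cb\<close> and runs at cost \<open>c0\<close>. For a decided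
  one \<open>V1_le\<close> is linear in \<open>D t * Mp t\<close>, where \<open>Mp t\<close> may be
  replaced by \<open>\<theta>\<close>, and \<open>1 - D t * \<theta>\<close> is twice the error
  indicator, which runs at cost \<open>c1\<close>.\<close>

lemma Val_D_le_run_cost:
  assumes t: "0 \<le> t" and e: "0 < e"
  shows "(LINT \<omega>|M. Val (D t \<omega>) (Mp t \<omega>)) \<le> Cb * e + (2 * Cb / c0 + 2 * Cb / (e * c1)) * (LINT \<omega>|M. run_cost (D t \<omega>) \<omega>)"
proof -
  note [measurable] = D_meas[OF t] Mp_meas[OF t]
  let ?z = "\<lambda>\<omega>. if D t \<omega> = 0 then 1 else 0 :: real" and ?n = "\<lambda>\<omega>. if D t \<omega> \<noteq> 0 then 1 else 0 :: real"
  have Di: "integrable M (D t)"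
  proof (intro integrable_const_bound[where B=1] AE_I2)
    show "norm (D t \<omega>) \<le> 1" if "\<omega> \<in> space M" for \<omega> using D_vals[OF that, of t] by auto
  qed simp
  have zi: "integrable M ?z" and ni: "integrable M ?n" by (auto intro!: integrable_const_bound[where B=1])
  note swap = integral_mult_\<theta>[OF t D_adapted[OF t] Di]
  have "(LINT \<omega>|M. Val (D t \<omega>) (Mp t \<omega>)) \<le> (LINT \<omega>|M. Cb * e + 2 * Cb * ?z \<omega> + Cb / e * (?n \<omega> - D t \<omega> * Mp t \<omega>))"
  proof (rule integral_mono)
    fix \<omega> assume w: "\<omega> \<in> space M"
    show "Val (D t \<omega>) (Mp t \<omega>) \<le> Cb * e + 2 * Cb * ?z \<omega> + Cb / e * (?n \<omega> - D t \<omega> * Mp t \<omega>)"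
    proof (cases "D t \<omega> = 0")
      case True then show ?thesis using V0_le[OF Mp_abs[of t \<omega>]] Cb_pos e by (simp add: Val_def add_increasing)
    next
      case False
      then have "\<bar>D t \<omega> * Mp t \<omega>\<bar> < 1" using D_vals[OF w, of t] Mp_abs[of t \<omega>] by auto
      then show ?thesis using V1_le[OF _ e, of "D t \<omega> * Mp t \<omega>"] False by (simp add: Val_def distrib_left)
    qed
  qed (use integrable_Val_D[OF t t] zi ni swap in auto)
  also have "\<dots> = (LINT \<omega>|M. Cb * e + 2 * Cb * ?z \<omega> + Cb / e * (?n \<omega> - D t \<omega> * \<theta> \<omega>))"
    using zi ni swap by simp
  also have "\<dots> \<le> (LINT \<omega>|M. Cb * e + (2 * Cb / c0 + 2 * Cb / (e * c1)) * run_cost (D t \<omega>) \<omega>)"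
  proof (rule integral_mono)
    fix \<omega> assume w: "\<omega> \<in> space M"
    show "Cb * e + 2 * Cb * ?z \<omega> + Cb / e * (?n \<omega> - D t \<omega> * \<theta> \<omega>) \<le> Cb * e + (2 * Cb / c0 + 2 * Cb / (e * c1)) * run_cost (D t \<omega>) \<omega>"
    proof (cases "D t \<omega> = 0")
      case True
      have "(2 * Cb / c0 + 2 * Cb / (e * c1)) * c0 = 2 * Cb + 2 * Cb / (e * c1) * c0" using c0 by (simp add: field_simps)
      moreover have "0 \<le> 2 * Cb / (e * c1) * c0" using Cb_pos e c0 c1 by simp
      ultimately show ?thesis using True by (simp add: run_cost_def)
    next
      case False
      then have "D t \<omega> \<in> {-1, 1}" using D_vals[OF w, of t] by auto
      then have wr: "1 - D t \<omega> * \<theta> \<omega> = 2 * wrong (D t \<omega>) \<omega>" using wrong_eq[OF w, of "D t \<omega>"] by simp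
      have "(2 * Cb / c0 + 2 * Cb / (e * c1)) * (c1 * wrong (D t \<omega>) \<omega>)
         = 2 * Cb / c0 * c1 * wrong (D t \<omega>) \<omega> + Cb / e * (2 * wrong (D t \<omega>) \<omega>)" using c1 e by (simp add: field_simps)
      moreover have "0 \<le> 2 * Cb / c0 * c1 * wrong (D t \<omega>) \<omega>" using Cb_pos c0 c1 by (simp add: wrong_def)
      ultimately show ?thesis using False wr by (simp add: run_cost_def)
    qed
  qed (use zi ni swap integrable_run_cost[OF t] in auto)
  also have "\<dots> = Cb * e + (2 * Cb / c0 + 2 * Cb / (e * c1)) * (LINT \<omega>|M. run_cost (D t \<omega>) \<omega>)"
    using integrable_run_cost[OF t] by (simp add: prob_space)
  finally show ?thesis .
qed

lemma risk_lower_bound: "ennreal (V0 (2 * p - 1)) \<le> risk M \<theta> c0 c1 c2 \<tau> d"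
proof (cases "risk M \<theta> c0 c1 c2 \<tau> d")
  case (real R)
  have "V0 (2 * p - 1) \<le> R + e" if e: "e > 0" for e
  proof -
    \<comment> \<open>\<open>z\<close> collects all coefficients of \<open>h\<close> in the final
      estimate, so with \<open>h = e / z\<close> the total error is exactly
      \<open>e\<close>.\<close>
    define z where "z = Cb + c1 / c2 * R + c0"
    have z: "z > 0" using Cb_pos c0 c1 c2 real by (simp add: z_def add_pos_nonneg add_nonneg_pos)
    define h where "h = e / z"
    have h: "h > 0" using e z by (simp add: h_def)
    define q where "q k = (LINT \<omega>|M. run_cost (D (real k * h) \<omega>) \<omega>)" for k :: nat
    have q0: "0 \<le> q k" for k unfolding q_def using run_cost_bounds by (intro integral_nonneg_AE) auto
    have sum_le: "(\<Sum>k<n. h * q k) \<le> (1 + h * c1 / c2) * R + h * c0" for n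
    proof -
      have "(\<Sum>k<n. h * q k) = (\<Sum>k<n. (LINT \<omega>|M. h * run_cost (D (real k * h) \<omega>) \<omega>))" by (simp add: q_def)
      also have "\<dots> \<le> (\<Sum>k<n. (LINT \<omega>|M. grid_cost \<theta> c0 c1 c2 \<tau> d h k \<omega>))"
      proof (intro sum_mono integral_mono)
        fix k \<omega>
        show "integrable M (\<lambda>\<omega>. h * run_cost (D (real k * h) \<omega>) \<omega>)" using integrable_run_cost[of "real k * h"] h by simp
        show "integrable M (grid_cost \<theta> c0 c1 c2 \<tau> d h k)" by (rule one_step(2)[OF h])
        show "h * run_cost (D (real k * h) \<omega>) \<omega> \<le> grid_cost \<theta> c0 c1 c2 \<tau> d h k \<omega>"
          using c2 by (auto simp: grid_cost_def run_cost_def wrong_def)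
      qed
      also have "\<dots> = (LINT \<omega>|M. (\<Sum>k<n. grid_cost \<theta> c0 c1 c2 \<tau> d h k \<omega>))"
        using one_step(2)[OF h] by (intro Bochner_Integration.integral_sum[symmetric]) auto
      also have "\<dots> \<le> (1 + h * c1 / c2) * R + h * c0" using real by (intro grid_le_risk[OF h]) auto
      finally show ?thesis .
    qed
    \<comment> \<open>Finite risk bounds all partial sums of the expected running costs, so these
      costs tend to 0 along the grid and the terminal value can be made small.\<close>
    have "summable (\<lambda>k. h * q k)"
      using q0 h sum_le by (intro summableI_nonneg_bounded[where x="(1 + h * c1 / c2) * R + h * c0"]) auto
    then have "(\<lambda>k. h * q k) \<longlonglongrightarrow> 0" by (rule summable_LIMSEQ_zero)
    then have "(\<lambda>k. inverse h * (h * q k)) \<longlonglongrightarrow> inverse h * 0" by (intro tendsto_intros)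
    then have lim: "q \<longlonglongrightarrow> 0" using h by (simp add: mult.assoc[symmetric])
    let ?L = "2 * Cb / c0 + 2 * Cb / (h * c1)"
    have bound: "V0 (2 * p - 1) \<le> Cb * h + ?L * q n + ((1 + h * c1 / c2) * R + h * c0)" for n
      using V0_le_grid[OF h, of n] Val_D_le_run_cost[of "real n * h", OF _ h] grid_le_risk[OF h, of R n] real h
      unfolding q_def by auto
    have "(\<lambda>n. Cb * h + ?L * q n + ((1 + h * c1 / c2) * R + h * c0)) \<longlonglongrightarrow> Cb * h + ?L * 0 + ((1 + h * c1 / c2) * R + h * c0)"
      by (intro tendsto_intros lim)
    then have "V0 (2 * p - 1) \<le> Cb * h + ?L * 0 + ((1 + h * c1 / c2) * R + h * c0)"
      by (rule LIMSEQ_le_const) (use bound in blast)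
    also have "\<dots> = R + h * z" by (simp add: z_def algebra_simps)
    also have "h * z = e" using z by (simp add: h_def)
    finally show ?thesis .
  qed
  then have "V0 (2 * p - 1) \<le> R" by (rule field_le_epsilon)
  then show ?thesis using real by (simp add: ennreal_leI)
qed simp

end

end

subsection \<open>Optional stopping\<close>

definition cap :: "ereal \<Rightarrow> real \<Rightarrow> real" where
  "cap x T = real_of_ereal (min x (ereal T))"

lemma cap_nonneg: "0 \<le> x \<Longrightarrow> 0 \<le> T \<Longrightarrow> 0 \<le> cap x T"
  by (cases x) (auto simp: cap_def min_def)

lemma cap_le: "0 \<le> x \<Longrightarrow> 0 \<le> T \<Longrightarrow> cap x T \<le> T"
  by (cases x) (auto simp: cap_def min_def)

lemma cap_eq: "cap (ereal r) T = min r T"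
  by (auto simp: cap_def min_def)

lemma cap_infinity: "cap \<infinity> T = T"
  by (simp add: cap_def)

lemma cap_ge: "ereal T \<le> x \<Longrightarrow> cap x T = T"
  by (cases x) (auto simp: cap_def min_def)

lemma cap_mono: "0 \<le> x \<Longrightarrow> x \<le> y \<Longrightarrow> 0 \<le> T \<Longrightarrow> cap x T \<le> cap y T"
  by (cases x; cases y) (auto simp: cap_def min_def)

text \<open>\<open>real m * h\<close> is the first grid time not before \<open>\<sigma>\<close>, or
  the horizon if that comes earlier. The cells entered before \<open>\<sigma>\<close> are an initial
  segment, so sums over them telescope.\<close>

lemma grid_index:
  fixes \<sigma> :: ereal
  assumes \<sigma>: "0 \<le> \<sigma>" and h: "h > 0" and n: "n > (0::nat)"
  obtains m where "m \<le> n" "\<And>k. k < n \<Longrightarrow> ereal (real k * h) < \<sigma> \<longleftrightarrow> k < m" "\<bar>real m * h - cap \<sigma> (real n * h)\<bar> \<le> h"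
proof -
  define m where "m = (LEAST k. k = n \<or> \<not> ereal (real k * h) < \<sigma>)"
  have m: "m = n \<or> \<not> ereal (real m * h) < \<sigma>" unfolding m_def by (rule LeastI[of _ n]) simp
  have mn: "m \<le> n" unfolding m_def by (rule Least_le) simp
  have below: "ereal (real k * h) < \<sigma>" if "k < m" for k
    using not_less_Least[of k "\<lambda>k. k = n \<or> \<not> ereal (real k * h) < \<sigma>"] that unfolding m_def by auto
  have iff: "ereal (real k * h) < \<sigma> \<longleftrightarrow> k < m" if "k < n" for k
  proof
    assume k: "ereal (real k * h) < \<sigma>"
    show "k < m"
    proof (rule ccontr)
      assume "\<not> k < m"
      then have "m \<le> k" "m \<noteq> n" using that by auto
      then have "real m * h \<le> real k * h" using h by simp
      then have "ereal (real m * h) < \<sigma>" using le_less_trans[of "ereal (real m * h)" "ereal (real k * h)"] k by simp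
      then show False using m \<open>m \<noteq> n\<close> by simp
    qed
  qed (rule below)
  have prev: "real m * h - h \<le> cap \<sigma> (real n * h)"
  proof (cases m)
    case 0 then show ?thesis using cap_nonneg[OF \<sigma>, of "real n * h"] h by simp
  next
    case (Suc k)
    have "ereal (real k * h) < \<sigma>" using below Suc by simp
    moreover have "real k * h \<le> real n * h" using Suc mn h by simp
    ultimately have "real k * h \<le> cap \<sigma> (real n * h)" by (cases \<sigma>) (auto simp: cap_def min_def)
    then show ?thesis using Suc by (simp add: algebra_simps)
  qed
  have "cap \<sigma> (real n * h) \<le> real m * h"
  proof (cases "m = n")
    case True then show ?thesis using cap_le[OF \<sigma>, of "real n * h"] h by simp
  next
    case False
    then have "\<sigma> \<le> ereal (real m * h)" using m by simp
    then show ?thesis using \<sigma> by (cases \<sigma>) (auto simp: cap_def min_def)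
  qed
  then show ?thesis using that[OF mn iff] prev h by auto
qed

text \<open>Vitali's convergence theorem in the case of bounded second moments. Fatou passes the
  bound to the limit; truncation at level \<open>k\<close> changes every expectation by at most
  \<open>c / k\<close>, and the truncated variables converge boundedly.\<close>

lemma (in prob_space) expectation_tendsto_of_L2_bound:
  fixes Z :: "nat \<Rightarrow> 'a \<Rightarrow> real"
  assumes Zm [measurable]: "\<And>n. Z n \<in> borel_measurable M"
    and Z2: "\<And>n. integrable M (\<lambda>\<omega>. (Z n \<omega>)\<^sup>2)" "\<And>n. expectation (\<lambda>\<omega>. (Z n \<omega>)\<^sup>2) \<le> c"
    and lim: "\<And>\<omega>. \<omega> \<in> space M \<Longrightarrow> (\<lambda>n. Z n \<omega>) \<longlonglongrightarrow> Y \<omega>"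
  shows "integrable M Y" "(\<lambda>n. expectation (Z n)) \<longlonglongrightarrow> expectation Y"
proof -
  have Ym [measurable]: "Y \<in> borel_measurable M" using lim by (rule borel_measurable_LIMSEQ_real) measurable
  have sq: "\<bar>x\<bar> \<le> 1 + x\<^sup>2" for x :: real
  proof -
    have "0 \<le> (\<bar>x\<bar> - 1)\<^sup>2" by simp
    then have "2 * \<bar>x\<bar> \<le> 1 + x\<^sup>2" by (simp add: power2_diff)
    then show ?thesis by linarith
  qed
  have L1: "integrable M f" if "integrable M (\<lambda>\<omega>. (f \<omega>)\<^sup>2)" "f \<in> borel_measurable M" for f :: "'a \<Rightarrow> real"
  proof (rule Bochner_Integration.integrable_bound[of M "\<lambda>\<omega>. 1 + (f \<omega>)\<^sup>2"])
    show "AE \<omega> in M. norm (f \<omega>) \<le> norm (1 + (f \<omega>)\<^sup>2)"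
      using order.trans[OF sq abs_ge_self] by (intro AE_I2) simp
  qed (use that in auto)
  have c: "0 \<le> c" using order.trans[OF integral_nonneg_AE Z2(2)] by simp
  have nnZ: "(\<integral>\<^sup>+\<omega>. ennreal ((Z n \<omega>)\<^sup>2) \<partial>M) \<le> ennreal c" for n
    using Z2[of n] by (subst nn_integral_eq_integral) (auto intro: ennreal_leI)
  have "(\<integral>\<^sup>+\<omega>. ennreal ((Y \<omega>)\<^sup>2) \<partial>M) = (\<integral>\<^sup>+\<omega>. liminf (\<lambda>n. ennreal ((Z n \<omega>)\<^sup>2)) \<partial>M)"
  proof (rule nn_integral_cong)
    fix \<omega> assume "\<omega> \<in> space M"
    then have "(\<lambda>n. ennreal ((Z n \<omega>)\<^sup>2)) \<longlonglongrightarrow> ennreal ((Y \<omega>)\<^sup>2)" using lim by (intro tendsto_intros) auto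
    then show "ennreal ((Y \<omega>)\<^sup>2) = liminf (\<lambda>n. ennreal ((Z n \<omega>)\<^sup>2))"
      by (rule lim_imp_Liminf[OF trivial_limit_sequentially, symmetric])
  qed
  also have "\<dots> \<le> liminf (\<lambda>n. \<integral>\<^sup>+\<omega>. ennreal ((Z n \<omega>)\<^sup>2) \<partial>M)" by (rule nn_integral_liminf) measurable
  also have "\<dots> \<le> ennreal c" using nnZ by (intro order.trans[OF Liminf_le_Limsup Limsup_bounded]) auto
  finally have nnY: "(\<integral>\<^sup>+\<omega>. ennreal ((Y \<omega>)\<^sup>2) \<partial>M) \<le> ennreal c" .
  have Y2: "integrable M (\<lambda>\<omega>. (Y \<omega>)\<^sup>2)"
    using le_less_trans[OF nnY ennreal_less_top] by (intro integrableI_nonneg) auto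
  have Y2c: "expectation (\<lambda>\<omega>. (Y \<omega>)\<^sup>2) \<le> c"
    using nnY c by (subst integral_eq_nn_integral) (auto intro: enn2real_leI)
  show Yi: "integrable M Y" by (rule L1[OF Y2 Ym])
  note Zi = L1[OF Z2(1) Zm]
  show "(\<lambda>n. expectation (Z n)) \<longlonglongrightarrow> expectation Y"
  proof (rule LIMSEQ_I)
    fix e :: real assume e: "0 < e"
    \<comment> \<open>Gives \<open>c / k\<close> at most \<open>e / 4\<close>; the summand 1 keeps
      \<open>k\<close> positive when \<open>c = 0\<close>. Two truncation errors and one convergence
      error stay below \<open>e\<close>.\<close>
    define k where "k = 4 * (c + 1) / e"
    have k: "k > 0" using c e by (simp add: k_def)
    have ck: "c / k \<le> e / 4"
      using c e by (simp add: k_def divide_simps)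
    define tr where "tr x = max (- k) (min k x)" for x :: real
    have tr_bd: "\<bar>tr x\<bar> \<le> k" for x using k by (auto simp: tr_def)
    have tr_err: "\<bar>x - tr x\<bar> \<le> x\<^sup>2 / k" for x
    proof (cases "\<bar>x\<bar> \<le> k")
      case True then have "tr x = x" by (auto simp: tr_def)
      then show ?thesis using k by simp
    next
      case False
      then have "\<bar>x - tr x\<bar> \<le> \<bar>x\<bar>" using k by (auto simp: tr_def)
      moreover have "k * \<bar>x\<bar> \<le> \<bar>x\<bar> * \<bar>x\<bar>" using False by (intro mult_right_mono) auto
      then have "\<bar>x\<bar> \<le> x\<^sup>2 / k" using k by (simp add: field_simps power2_eq_square)
      ultimately show ?thesis by linarith
    qed
    have trm [measurable]: "tr \<in> borel_measurable borel" unfolding tr_def[abs_def] by measurable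
    have tri: "integrable M (\<lambda>\<omega>. tr (f \<omega>))" if "f \<in> borel_measurable M" for f
      using tr_bd that by (intro integrable_const_bound[where B=k]) auto
    have err: "\<bar>expectation f - expectation (\<lambda>\<omega>. tr (f \<omega>))\<bar> \<le> e / 4"
      if f: "integrable M (\<lambda>\<omega>. (f \<omega>)\<^sup>2)" "expectation (\<lambda>\<omega>. (f \<omega>)\<^sup>2) \<le> c" "f \<in> borel_measurable M" for f
    proof -
      have "\<bar>expectation f - expectation (\<lambda>\<omega>. tr (f \<omega>))\<bar> = \<bar>expectation (\<lambda>\<omega>. f \<omega> - tr (f \<omega>))\<bar>"
        using L1[OF f(1,3)] tri[OF f(3)] by simp
      also have "\<dots> \<le> expectation (\<lambda>\<omega>. \<bar>f \<omega> - tr (f \<omega>)\<bar>)" by (rule integral_abs_bound)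
      also have "\<dots> \<le> expectation (\<lambda>\<omega>. (f \<omega>)\<^sup>2 / k)"
        using L1[OF f(1,3)] tri[OF f(3)] f(1) tr_err by (intro integral_mono) auto
      also have "\<dots> \<le> c / k" using f(2) k by (simp add: divide_right_mono)
      finally show ?thesis using ck by (rule order.trans)
    qed
    have "(\<lambda>n. expectation (\<lambda>\<omega>. tr (Z n \<omega>))) \<longlonglongrightarrow> expectation (\<lambda>\<omega>. tr (Y \<omega>))"
    proof (rule integral_dominated_convergence[where w="\<lambda>_. k"])
      show "AE \<omega> in M. (\<lambda>n. tr (Z n \<omega>)) \<longlonglongrightarrow> tr (Y \<omega>)"
        using lim unfolding tr_def by (intro AE_I2 tendsto_intros) auto
    qed (use tr_bd in auto)
    from LIMSEQ_D[OF this, of "e / 4"] e obtain N where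
      N: "\<And>n. n \<ge> N \<Longrightarrow> norm (expectation (\<lambda>\<omega>. tr (Z n \<omega>)) - expectation (\<lambda>\<omega>. tr (Y \<omega>))) < e / 4"
      by auto
    show "\<exists>N. \<forall>n\<ge>N. norm (expectation (Z n) - expectation Y) < e"
    proof (intro exI allI impI)
      fix n assume "N \<le> n"
      then show "norm (expectation (Z n) - expectation Y) < e"
        using N[of n] err[OF Z2[of n] Zm] err[OF Y2 Y2c Ym] e unfolding real_norm_def by linarith
    qed
  qed
qed

context nondegenerate
begin

lemma logit_Mp_cont: "\<omega> \<in> space M \<Longrightarrow> continuous_on {0..} (\<lambda>t. logit (Mp t \<omega>))"
  unfolding logit_Mp by (intro continuous_intros X_cont)

context
  fixes \<sigma> :: "'a \<Rightarrow> ereal" and T :: real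
  assumes \<sigma>: "stopping_time_ext M (FX M X) \<sigma>" and T: "0 < T"
begin

definition step :: "nat \<Rightarrow> real" where "step n = T / real (Suc n)"

definition alive :: "nat \<Rightarrow> nat \<Rightarrow> 'a set" where
  "alive n k = {\<omega>\<in>space M. ereal (real k * step n) < \<sigma> \<omega>}"

text \<open>The stopping time cut at \<open>T\<close> and rounded up to the grid. As a sum over the
  cells entered before \<open>\<sigma>\<close> it involves only events known at the left end of each
  cell, where the drift formula applies.\<close>

definition samp :: "nat \<Rightarrow> 'a \<Rightarrow> real" where
  "samp n \<omega> = (\<Sum>k<Suc n. step n * indicator (alive n k) \<omega>)"

lemma step_pos: "step n > 0" using T by (simp add: step_def)

lemma step_end: "real (Suc n) * step n = T" by (simp add: step_def)

lemma \<sigma>_nonneg: "\<omega> \<in> space M \<Longrightarrow> 0 \<le> \<sigma> \<omega>" using \<sigma> by (auto simp: stopping_time_ext_def)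

lemma alive_FX: "alive n k \<in> FX M X (real k * step n)"
proof -
  have "0 \<le> real k * step n" using step_pos[of n] by simp
  from stopping_timeD[OF \<sigma> this order.refl]
  have "{\<omega>\<in>space M. \<sigma> \<omega> \<le> ereal (real k * step n)} \<in> sets (Fm (real k * step n))" by simp
  then have "space (Fm (real k * step n)) - {\<omega>\<in>space M. \<sigma> \<omega> \<le> ereal (real k * step n)} \<in> sets (Fm (real k * step n))"
    by (rule sets.compl_sets)
  moreover have "alive n k = space (Fm (real k * step n)) - {\<omega>\<in>space M. \<sigma> \<omega> \<le> ereal (real k * step n)}"
    by (auto simp: alive_def)
  ultimately show ?thesis by simp
qed

lemma alive_sets [measurable]: "alive n k \<in> sets M"
  using alive_FX FX_sets by blast

lemma samp_props:
  assumes w: "\<omega> \<in> space M"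
  shows "\<bar>samp n \<omega> - cap (\<sigma> \<omega>) T\<bar> \<le> step n" "0 \<le> samp n \<omega>" "samp n \<omega> \<le> T"
    and "\<And>y :: real \<Rightarrow> real. y (samp n \<omega>) = y 0 + (\<Sum>k<Suc n. indicator (alive n k) \<omega> * (y (real (Suc k) * step n) - y (real k * step n)))"
proof -
  obtain m where m: "m \<le> Suc n" "\<And>k. k < Suc n \<Longrightarrow> ereal (real k * step n) < \<sigma> \<omega> \<longleftrightarrow> k < m"
    "\<bar>real m * step n - cap (\<sigma> \<omega>) (real (Suc n) * step n)\<bar> \<le> step n"
    using grid_index[OF \<sigma>_nonneg[OF w] step_pos[of n], of "Suc n"] by auto
  have sum: "(\<Sum>k<Suc n. indicator (alive n k) \<omega> * g k) = (\<Sum>k<m. g k)" for g :: "nat \<Rightarrow> real"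
  proof -
    have "(\<Sum>k<Suc n. indicator (alive n k) \<omega> * g k) = (\<Sum>k<Suc n. if k < m then g k else 0)"
      using m(2) w by (intro sum.cong) (auto simp: alive_def indicator_def)
    also have "\<dots> = (\<Sum>k\<in>{..<Suc n} \<inter> {k. k < m}. g k)" by (simp only: sum.inter_restrict[OF finite_lessThan] mem_Collect_eq)
    also have "{..<Suc n} \<inter> {k. k < m} = {..<m}" using m(1) by auto
    finally show ?thesis .
  qed
  have s: "samp n \<omega> = real m * step n"
    using sum[of "\<lambda>_. step n"] by (simp add: samp_def mult.commute)
  show "\<bar>samp n \<omega> - cap (\<sigma> \<omega>) T\<bar> \<le> step n" using m(3) unfolding s step_end .
  show "0 \<le> samp n \<omega>" using step_pos[of n] unfolding s by simp
  have "real m * step n \<le> real (Suc n) * step n" using m(1) step_pos[of n] by (intro mult_right_mono) auto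
  then show "samp n \<omega> \<le> T" unfolding s step_end .
  show "y (samp n \<omega>) = y 0 + (\<Sum>k<Suc n. indicator (alive n k) \<omega> * (y (real (Suc k) * step n) - y (real k * step n)))" for y :: "real \<Rightarrow> real"
    unfolding sum s using sum_lessThan_telescope[of "\<lambda>k. y (real k * step n)" m] by simp
qed

lemma samp_tendsto: "\<omega> \<in> space M \<Longrightarrow> (\<lambda>n. samp n \<omega>) \<longlonglongrightarrow> cap (\<sigma> \<omega>) T"
proof -
  assume w: "\<omega> \<in> space M"
  have "(\<lambda>n. T * inverse (real (Suc n))) \<longlonglongrightarrow> T * 0" by (intro tendsto_intros LIMSEQ_inverse_real_of_nat)
  then have "step \<longlonglongrightarrow> 0" by (simp add: step_def[abs_def] divide_inverse)
  then show ?thesis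
    by (rule Lim_transform_bound[where g=step, THEN LIM_zero_cancel, rotated])
       (use samp_props(1)[OF w] step_pos in \<open>auto simp: less_imp_le abs_of_pos\<close>)
qed

lemma samp_meas [measurable]: "samp n \<in> borel_measurable M"
  unfolding samp_def[abs_def] by measurable

lemma cap_meas: "(\<lambda>\<omega>. cap (\<sigma> \<omega>) T) \<in> borel_measurable M"
  using samp_tendsto by (rule borel_measurable_LIMSEQ_real) measurable

lemma samp_process_meas:
  assumes "\<And>t. 0 \<le> t \<Longrightarrow> Y t \<in> borel_measurable M"
  shows "(\<lambda>\<omega>. Y (samp n \<omega>) \<omega> :: real) \<in> borel_measurable M"
proof (subst measurable_cong)
  show "Y (samp n \<omega>) \<omega> = Y 0 \<omega> + (\<Sum>k<Suc n. indicator (alive n k) \<omega> * (Y (real (Suc k) * step n) \<omega> - Y (real k * step n) \<omega>))"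
    if "\<omega> \<in> space M" for \<omega>
    using samp_props(4)[OF that, of "\<lambda>t. Y t \<omega>" n] .
  have "Y (real k * step n) \<in> borel_measurable M" for k using assms step_pos[of n] by simp
  then show "(\<lambda>\<omega>. Y 0 \<omega> + (\<Sum>k<Suc n. indicator (alive n k) \<omega> * (Y (real (Suc k) * step n) \<omega> - Y (real k * step n) \<omega>))) \<in> borel_measurable M"
    using assms[of 0] by measurable
qed

text \<open>The value at \<open>T\<close> minus the value at the sampled time is the sum of the
  increments over the cells entered after stopping. Stopping is known at the left end of such a
  cell, so by convexity each increment has nonnegative mean. The resulting bound does not depend on
  \<open>n\<close>.\<close>

lemma samp_logit_square:
  shows "integrable M (\<lambda>\<omega>. (logit (Mp (samp n \<omega>) \<omega>))\<^sup>2)"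
    "(LINT \<omega>|M. (logit (Mp (samp n \<omega>) \<omega>))\<^sup>2) \<le> (LINT \<omega>|M. (logit (Mp T \<omega>))\<^sup>2)"
proof -
  let ?y = "\<lambda>t \<omega>. (logit (Mp t \<omega>))\<^sup>2" and ?t = "\<lambda>k. real k * step n"
  let ?dead = "\<lambda>k. space M - alive n k"
  have yi: "integrable M (?y t)" if "0 \<le> t" for t by (rule integrable_logit_square[OF that])
  have tk: "0 \<le> ?t k" for k using step_pos[of n] by simp
  have dead: "?dead k \<in> FX M X (?t k)" for k
    using sets.compl_sets[of "alive n k" "Fm (?t k)"] alive_FX[of n k] by simp
  have ind: "indicator (alive n k) \<omega> = 1 - (indicator (?dead k) \<omega> :: real)" if "\<omega> \<in> space M" for k \<omega>
    using that by (auto simp: indicator_def)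
  have di: "integrable M (\<lambda>\<omega>. indicator (?dead k) \<omega> * ?y t \<omega>)" if "0 \<le> t" for k t
    using integrable_real_mult_indicator[OF _ yi[OF that], of "?dead k"] by (simp add: mult.commute)
  let ?S = "\<lambda>\<omega>. \<Sum>k<Suc n. indicator (?dead k) \<omega> * (?y (?t (Suc k)) \<omega> - ?y (?t k) \<omega>)"
  have eq: "?y (samp n \<omega>) \<omega> = ?y T \<omega> - ?S \<omega>" if w: "\<omega> \<in> space M" for \<omega>
  proof -
    have "?y (samp n \<omega>) \<omega> = ?y 0 \<omega> + (\<Sum>k<Suc n. (?y (?t (Suc k)) \<omega> - ?y (?t k) \<omega>) - indicator (?dead k) \<omega> * (?y (?t (Suc k)) \<omega> - ?y (?t k) \<omega>))"
      unfolding samp_props(4)[OF w, of "\<lambda>t. ?y t \<omega>" n]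
      by (intro arg_cong2[where f="(+)"] refl sum.cong) (simp add: ind[OF w] algebra_simps)
    also have "\<dots> = ?y 0 \<omega> + ((\<Sum>k<Suc n. ?y (?t (Suc k)) \<omega> - ?y (?t k) \<omega>) - ?S \<omega>)"
      by (simp only: sum_subtractf)
    also have "(\<Sum>k<Suc n. ?y (?t (Suc k)) \<omega> - ?y (?t k) \<omega>) = ?y (?t (Suc n)) \<omega> - ?y (?t 0) \<omega>"
      by (rule sum_lessThan_telescope)
    finally show ?thesis unfolding step_end by simp
  qed
  have Si: "integrable M ?S" "(LINT \<omega>|M. ?S \<omega>) = (\<Sum>k<Suc n. (LINT \<omega>|M. indicator (?dead k) \<omega> * ?y (?t (Suc k)) \<omega>) - (LINT \<omega>|M. indicator (?dead k) \<omega> * ?y (?t k) \<omega>))"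
  proof -
    have i: "integrable M (\<lambda>\<omega>. indicator (?dead k) \<omega> * (?y (?t (Suc k)) \<omega> - ?y (?t k) \<omega>))" for k
      using di[OF tk[of "Suc k"], of k] di[OF tk[of k], of k] by (simp add: right_diff_distrib)
    show "integrable M ?S" by (intro Bochner_Integration.integrable_sum i)
    have "(LINT \<omega>|M. ?S \<omega>) = (\<Sum>k<Suc n. (LINT \<omega>|M. indicator (?dead k) \<omega> * (?y (?t (Suc k)) \<omega> - ?y (?t k) \<omega>)))"
      by (intro Bochner_Integration.integral_sum i)
    also have "\<dots> = (\<Sum>k<Suc n. (LINT \<omega>|M. indicator (?dead k) \<omega> * ?y (?t (Suc k)) \<omega>) - (LINT \<omega>|M. indicator (?dead k) \<omega> * ?y (?t k) \<omega>))"
      using di[OF tk[of "Suc _"]] di[OF tk] by (intro sum.cong refl) (simp only: right_diff_distrib Bochner_Integration.integral_diff)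
    finally show "(LINT \<omega>|M. ?S \<omega>) = \<dots>" .
  qed
  have S0: "0 \<le> (LINT \<omega>|M. ?S \<omega>)"
    unfolding Si(2)
  proof (rule sum_nonneg)
    fix k
    have "?t k \<le> ?t (Suc k)" using step_pos[of n] by (simp add: algebra_simps)
    from Mp_jensen[OF tk this dead convex_on_logit_square, of 0 1]
    show "0 \<le> (LINT \<omega>|M. indicator (?dead k) \<omega> * ?y (?t (Suc k)) \<omega>) - (LINT \<omega>|M. indicator (?dead k) \<omega> * ?y (?t k) \<omega>)"
      by simp
  qed
  have i2: "integrable M (\<lambda>\<omega>. ?y T \<omega> - ?S \<omega>)" using yi[of T] T Si(1) by simp
  have "integrable M (\<lambda>\<omega>. ?y (samp n \<omega>) \<omega>) \<longleftrightarrow> integrable M (\<lambda>\<omega>. ?y T \<omega> - ?S \<omega>)"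
    by (intro Bochner_Integration.integrable_cong refl eq)
  then show "integrable M (\<lambda>\<omega>. ?y (samp n \<omega>) \<omega>)" using i2 by blast
  have "(LINT \<omega>|M. ?y (samp n \<omega>) \<omega>) = (LINT \<omega>|M. ?y T \<omega> - ?S \<omega>)"
    by (intro Bochner_Integration.integral_cong refl eq)
  also have "\<dots> = (LINT \<omega>|M. ?y T \<omega>) - (LINT \<omega>|M. ?S \<omega>)" using yi[of T] T Si(1) by simp
  finally show "(LINT \<omega>|M. ?y (samp n \<omega>) \<omega>) \<le> (LINT \<omega>|M. ?y T \<omega>)" using S0 by simp
qed

text \<open>For the discretised time this is the drift formula summed over the cells. The limit on
  the left uses path continuity and the second moment bound uniform in \<open>n\<close>; on the
  right the integrands are bounded.\<close>

lemma optional_stopping: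
  fixes \<alpha> \<beta> \<gamma> \<delta> :: real
  defines "f \<equiv> affine_logit \<alpha> \<beta> \<gamma> \<delta>"
  shows "integrable M (\<lambda>\<omega>. f (Mp (cap (\<sigma> \<omega>) T) \<omega>))"
    and "(LINT \<omega>|M. f (Mp (cap (\<sigma> \<omega>) T) \<omega>)) = f (2 * p - 1) + 2 * \<mu>\<^sup>2 * (LINT \<omega>|M. cap (\<sigma> \<omega>) T * (\<alpha> * \<theta> \<omega> + \<beta>))"
proof -
  let ?t = "\<lambda>n k. real k * step n"
  have tk: "0 \<le> ?t n k" for n k using step_pos[of n] by simp
  have fm: "f \<in> borel_measurable borel" unfolding f_def by measurable
  have fi: "integrable M (\<lambda>\<omega>. f (Mp t \<omega>))" if "0 \<le> t" for t
    using integrable_of_Mp[OF that fm] affine_logit_bound[of _ \<alpha> \<beta> \<gamma> \<delta>] unfolding f_def by blast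
  have ai: "integrable M (\<lambda>\<omega>. indicator (alive n k) \<omega> * f (Mp t \<omega>))" if "0 \<le> t" for t n k
    using integrable_real_mult_indicator[OF alive_sets fi[OF that]] by (simp add: mult.commute)
  have th: "\<bar>\<alpha> * \<theta> \<omega> + \<beta>\<bar> \<le> \<bar>\<alpha>\<bar> + \<bar>\<beta>\<bar>" if "\<omega> \<in> space M" for \<omega> using \<theta>_vals[OF that] by auto
  have thi: "integrable M (\<lambda>\<omega>. indicator (alive n k) \<omega> * (\<alpha> * \<theta> \<omega> + \<beta>))" for n k
    using th by (intro integrable_const_bound[where B="\<bar>\<alpha>\<bar> + \<bar>\<beta>\<bar>"] AE_I2) (auto simp: indicator_def)
  have sampled: "(LINT \<omega>|M. f (Mp (samp n \<omega>) \<omega>)) = f (2 * p - 1) + 2 * \<mu>\<^sup>2 * (LINT \<omega>|M. samp n \<omega> * (\<alpha> * \<theta> \<omega> + \<beta>))" for n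
  proof -
    have i: "integrable M (\<lambda>\<omega>. indicator (alive n k) \<omega> * (f (Mp (?t n (Suc k)) \<omega>) - f (Mp (?t n k) \<omega>)))" for k
      using ai[of "?t n (Suc k)" n k, OF tk] ai[of "?t n k" n k, OF tk] by (simp add: right_diff_distrib)
    have "(LINT \<omega>|M. f (Mp (samp n \<omega>) \<omega>)) =
      (LINT \<omega>|M. f (2 * p - 1) + (\<Sum>k<Suc n. indicator (alive n k) \<omega> * (f (Mp (?t n (Suc k)) \<omega>) - f (Mp (?t n k) \<omega>))))"
      using samp_props(4)[of _ "\<lambda>t. f (Mp t _)"] Mp_0 by (intro Bochner_Integration.integral_cong) auto
    also have "\<dots> = f (2 * p - 1) + (\<Sum>k<Suc n. (LINT \<omega>|M. indicator (alive n k) \<omega> * (f (Mp (?t n (Suc k)) \<omega>) - f (Mp (?t n k) \<omega>))))"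
    proof (subst Bochner_Integration.integral_add)
      show "integrable M (\<lambda>\<omega>. \<Sum>k<Suc n. indicator (alive n k) \<omega> * (f (Mp (?t n (Suc k)) \<omega>) - f (Mp (?t n k) \<omega>)))"
        by (intro Bochner_Integration.integrable_sum i)
      show "(LINT \<omega>|M. f (2 * p - 1)) + (LINT \<omega>|M. (\<Sum>k<Suc n. indicator (alive n k) \<omega> * (f (Mp (?t n (Suc k)) \<omega>) - f (Mp (?t n k) \<omega>))))
        = f (2 * p - 1) + (\<Sum>k<Suc n. (LINT \<omega>|M. indicator (alive n k) \<omega> * (f (Mp (?t n (Suc k)) \<omega>) - f (Mp (?t n k) \<omega>))))"
        by (subst Bochner_Integration.integral_sum[OF i]) (simp only: Bochner_Integration.lebesgue_integral_const prob_space scaleR_one)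
    qed simp
    also have "\<dots> = f (2 * p - 1) + (\<Sum>k<Suc n. 2 * \<mu>\<^sup>2 * step n * (LINT \<omega>|M. indicator (alive n k) \<omega> * (\<alpha> * \<theta> \<omega> + \<beta>)))"
    proof (intro arg_cong2[where f="(+)"] refl sum.cong)
      fix k
      have le: "?t n k \<le> ?t n (Suc k)" and df: "?t n (Suc k) - ?t n k = step n" using step_pos[of n] by (auto simp: algebra_simps)
      have "(LINT \<omega>|M. indicator (alive n k) \<omega> * (f (Mp (?t n (Suc k)) \<omega>) - f (Mp (?t n k) \<omega>)))
        = (LINT \<omega>|M. indicator (alive n k) \<omega> * f (Mp (?t n (Suc k)) \<omega>)) - (LINT \<omega>|M. indicator (alive n k) \<omega> * f (Mp (?t n k) \<omega>))"
        using ai[of "?t n (Suc k)" n k, OF tk] ai[of "?t n k" n k, OF tk] by (simp only: right_diff_distrib Bochner_Integration.integral_diff)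
      also have "\<dots> = 2 * \<mu>\<^sup>2 * step n * (LINT \<omega>|M. indicator (alive n k) \<omega> * (\<alpha> * \<theta> \<omega> + \<beta>))"
        using affine_logit_drift[OF tk le alive_FX, of \<alpha> \<beta> \<gamma> \<delta>] unfolding df f_def by simp
      finally show "(LINT \<omega>|M. indicator (alive n k) \<omega> * (f (Mp (?t n (Suc k)) \<omega>) - f (Mp (?t n k) \<omega>)))
        = 2 * \<mu>\<^sup>2 * step n * (LINT \<omega>|M. indicator (alive n k) \<omega> * (\<alpha> * \<theta> \<omega> + \<beta>))" .
    qed
    also have "(\<Sum>k<Suc n. 2 * \<mu>\<^sup>2 * step n * (LINT \<omega>|M. indicator (alive n k) \<omega> * (\<alpha> * \<theta> \<omega> + \<beta>)))
      = (\<Sum>k<Suc n. (LINT \<omega>|M. 2 * \<mu>\<^sup>2 * step n * (indicator (alive n k) \<omega> * (\<alpha> * \<theta> \<omega> + \<beta>))))" by simp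
    also have "\<dots> = (LINT \<omega>|M. (\<Sum>k<Suc n. 2 * \<mu>\<^sup>2 * step n * (indicator (alive n k) \<omega> * (\<alpha> * \<theta> \<omega> + \<beta>))))"
      using thi by (intro Bochner_Integration.integral_sum[symmetric]) auto
    also have "\<dots> = (LINT \<omega>|M. 2 * \<mu>\<^sup>2 * (samp n \<omega> * (\<alpha> * \<theta> \<omega> + \<beta>)))"
      unfolding samp_def sum_distrib_left sum_distrib_right by (simp only: mult_ac)
    finally show ?thesis by simp
  qed
  have cont: "continuous_on {0..} (\<lambda>t. f (Mp t \<omega>))" if "\<omega> \<in> space M" for \<omega>
    unfolding f_def affine_logit_def by (intro continuous_intros Mp_cont logit_Mp_cont that)
  have lim: "(\<lambda>n. f (Mp (samp n \<omega>) \<omega>)) \<longlonglongrightarrow> f (Mp (cap (\<sigma> \<omega>) T) \<omega>)" if w: "\<omega> \<in> space M" for \<omega>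
    using samp_props(2)[OF w] cap_nonneg[OF \<sigma>_nonneg[OF w], of T] T
    by (intro continuous_on_tendsto_compose[OF cont[OF w] samp_tendsto[OF w]]) auto
  have fs [measurable]: "(\<lambda>\<omega>. f (Mp (samp n \<omega>) \<omega>)) \<in> borel_measurable M" for n
    by (rule samp_process_meas[where Y="\<lambda>t \<omega>. f (Mp t \<omega>)"]) (use fm in measurable)
  let ?c = "2 * (\<bar>\<alpha>\<bar> + \<bar>\<beta>\<bar>)\<^sup>2" and ?d = "2 * (\<bar>\<gamma>\<bar> + \<bar>\<delta>\<bar>)\<^sup>2"
  have fsq: "(f m)\<^sup>2 \<le> ?c * (logit m)\<^sup>2 + ?d" if m: "\<bar>m\<bar> < 1" for m
  proof -
    have sq: "(x + y)\<^sup>2 \<le> 2 * x\<^sup>2 + 2 * y\<^sup>2" for x y :: real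
      using zero_le_power2[of "x - y"] by (simp add: power2_sum power2_diff)
    have "(f m)\<^sup>2 \<le> ((\<bar>\<alpha>\<bar> + \<bar>\<beta>\<bar>) * \<bar>logit m\<bar> + (\<bar>\<gamma>\<bar> + \<bar>\<delta>\<bar>))\<^sup>2"
      using affine_logit_abs[OF m, of \<alpha> \<beta> \<gamma> \<delta>] unfolding f_def
      by (subst power2_abs[symmetric], intro power_mono) auto
    also have "\<dots> \<le> 2 * ((\<bar>\<alpha>\<bar> + \<bar>\<beta>\<bar>) * \<bar>logit m\<bar>)\<^sup>2 + 2 * (\<bar>\<gamma>\<bar> + \<bar>\<delta>\<bar>)\<^sup>2" by (rule sq)
    finally show ?thesis by (simp add: power_mult_distrib)
  qed
  have sqi: "integrable M (\<lambda>\<omega>. (f (Mp (samp n \<omega>) \<omega>))\<^sup>2)" for n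
  proof (rule Bochner_Integration.integrable_bound)
    show "integrable M (\<lambda>\<omega>. ?c * (logit (Mp (samp n \<omega>) \<omega>))\<^sup>2 + ?d)"
      by (intro Bochner_Integration.integrable_add integrable_mult_right samp_logit_square(1)) simp
    show "AE \<omega> in M. norm ((f (Mp (samp n \<omega>) \<omega>))\<^sup>2) \<le> norm (?c * (logit (Mp (samp n \<omega>) \<omega>))\<^sup>2 + ?d)"
      using order.trans[OF fsq[OF Mp_abs] abs_ge_self] by (intro AE_I2) simp
  qed measurable
  have sqb: "(LINT \<omega>|M. (f (Mp (samp n \<omega>) \<omega>))\<^sup>2) \<le> ?c * (LINT \<omega>|M. (logit (Mp T \<omega>))\<^sup>2) + ?d" for n
  proof -
    have "(LINT \<omega>|M. (f (Mp (samp n \<omega>) \<omega>))\<^sup>2) \<le> (LINT \<omega>|M. ?c * (logit (Mp (samp n \<omega>) \<omega>))\<^sup>2 + ?d)"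
    proof (rule integral_mono[OF sqi])
      show "integrable M (\<lambda>\<omega>. ?c * (logit (Mp (samp n \<omega>) \<omega>))\<^sup>2 + ?d)"
        by (intro Bochner_Integration.integrable_add integrable_mult_right samp_logit_square(1)) simp
    qed (rule fsq[OF Mp_abs])
    also have "\<dots> = ?c * (LINT \<omega>|M. (logit (Mp (samp n \<omega>) \<omega>))\<^sup>2) + ?d"
      by (subst Bochner_Integration.integral_add[OF integrable_mult_right[OF samp_logit_square(1)]])
         (simp_all add: prob_space)
    also have "\<dots> \<le> ?c * (LINT \<omega>|M. (logit (Mp T \<omega>))\<^sup>2) + ?d"
      using samp_logit_square(2)[of n] by (intro add_mono mult_left_mono) auto
    finally show ?thesis .
  qed
  note L2 = expectation_tendsto_of_L2_bound[where Z="\<lambda>n \<omega>. f (Mp (samp n \<omega>) \<omega>)", OF fs sqi sqb lim]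
  show "integrable M (\<lambda>\<omega>. f (Mp (cap (\<sigma> \<omega>) T) \<omega>))" by (rule L2(1))
  have "(\<lambda>n. LINT \<omega>|M. samp n \<omega> * (\<alpha> * \<theta> \<omega> + \<beta>)) \<longlonglongrightarrow> (LINT \<omega>|M. cap (\<sigma> \<omega>) T * (\<alpha> * \<theta> \<omega> + \<beta>))"
  proof (rule integral_dominated_convergence[where w="\<lambda>_. T * (\<bar>\<alpha>\<bar> + \<bar>\<beta>\<bar>)"])
    show "(\<lambda>\<omega>. cap (\<sigma> \<omega>) T * (\<alpha> * \<theta> \<omega> + \<beta>)) \<in> borel_measurable M" using cap_meas by measurable
    show "AE \<omega> in M. (\<lambda>n. samp n \<omega> * (\<alpha> * \<theta> \<omega> + \<beta>)) \<longlonglongrightarrow> cap (\<sigma> \<omega>) T * (\<alpha> * \<theta> \<omega> + \<beta>)"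
      using samp_tendsto by (intro AE_I2 tendsto_intros)
    show "AE \<omega> in M. norm (samp n \<omega> * (\<alpha> * \<theta> \<omega> + \<beta>)) \<le> T * (\<bar>\<alpha>\<bar> + \<bar>\<beta>\<bar>)" for n
    proof (rule AE_I2)
      fix \<omega> assume w: "\<omega> \<in> space M"
      show "norm (samp n \<omega> * (\<alpha> * \<theta> \<omega> + \<beta>)) \<le> T * (\<bar>\<alpha>\<bar> + \<bar>\<beta>\<bar>)"
        unfolding real_norm_def abs_mult using samp_props(2,3)[OF w, of n] th[OF w] by (intro mult_mono) auto
    qed
  qed auto
  then have "(\<lambda>n. LINT \<omega>|M. f (Mp (samp n \<omega>) \<omega>)) \<longlonglongrightarrow> f (2 * p - 1) + 2 * \<mu>\<^sup>2 * (LINT \<omega>|M. cap (\<sigma> \<omega>) T * (\<alpha> * \<theta> \<omega> + \<beta>))"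
    unfolding sampled by (intro tendsto_intros)
  then show "(LINT \<omega>|M. f (Mp (cap (\<sigma> \<omega>) T) \<omega>)) = f (2 * p - 1) + 2 * \<mu>\<^sup>2 * (LINT \<omega>|M. cap (\<sigma> \<omega>) T * (\<alpha> * \<theta> \<omega> + \<beta>))"
    using LIMSEQ_unique[OF L2(2)] by blast
qed

end

text \<open>Restricting \<open>\<sigma>\<close> and \<open>\<sigma>'\<close> to \<open>G\<close> and setting them to infinity elsewhere reduces this to the case of
  a single stopping time.\<close>

lemma optional_stopping_between:
  fixes \<alpha> \<beta> \<gamma> \<delta> :: real
  defines "f \<equiv> affine_logit \<alpha> \<beta> \<gamma> \<delta>"
  assumes \<sigma>: "stopping_time_ext M (FX M X) \<sigma>" "stopping_time_ext M (FX M X) \<sigma>'"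
    and le: "\<And>\<omega>. \<omega> \<in> space M \<Longrightarrow> \<sigma> \<omega> \<le> \<sigma>' \<omega>"
    and G: "G \<in> sets M" "\<And>t. 0 \<le> t \<Longrightarrow> G \<inter> {\<omega>\<in>space M. \<sigma> \<omega> \<le> ereal t} \<in> FX M X t"
    and T: "0 < T"
  shows "(LINT \<omega>|M. indicator G \<omega> * f (Mp (cap (\<sigma>' \<omega>) T) \<omega>)) = (LINT \<omega>|M. indicator G \<omega> * f (Mp (cap (\<sigma> \<omega>) T) \<omega>))
    + 2 * \<mu>\<^sup>2 * (LINT \<omega>|M. indicator G \<omega> * ((cap (\<sigma>' \<omega>) T - cap (\<sigma> \<omega>) T) * (\<alpha> * \<theta> \<omega> + \<beta>)))"
proof -
  define r where "r \<rho> \<omega> = (if \<omega> \<in> G then \<rho> \<omega> else \<infinity>)" for \<rho> :: "'a \<Rightarrow> ereal" and \<omega>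
  have nonneg: "0 \<le> \<sigma> \<omega>" "0 \<le> \<sigma>' \<omega>" if "\<omega> \<in> space M" for \<omega>
    using \<sigma> that by (auto simp: stopping_time_ext_def)
  have Gsp: "G \<subseteq> space M" using sets.sets_into_space[OF G(1)] .
  have r: "stopping_time_ext M (FX M X) (r \<sigma>)" "stopping_time_ext M (FX M X) (r \<sigma>')"
    unfolding stopping_time_ext_def
  proof (safe)
    fix t :: real assume t: "0 \<le> t"
    have "{\<omega>\<in>space M. r \<sigma> \<omega> \<le> ereal t} = G \<inter> {\<omega>\<in>space M. \<sigma> \<omega> \<le> ereal t}" by (auto simp: r_def)
    then show "{\<omega>\<in>space M. r \<sigma> \<omega> \<le> ereal t} \<in> FX M X t" using G(2)[OF t] by simp
    \<comment> \<open>\<open>G\<close> need only be known once \<open>\<sigma>\<close> has occurred;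
      this is enough for \<open>\<sigma>'\<close> because it occurs no earlier.\<close>
    have "{\<omega>\<in>space M. r \<sigma>' \<omega> \<le> ereal t} = (G \<inter> {\<omega>\<in>space M. \<sigma> \<omega> \<le> ereal t}) \<inter> {\<omega>\<in>space M. \<sigma>' \<omega> \<le> ereal t}"
      using le by (auto simp: r_def intro: order.trans)
    then show "{\<omega>\<in>space M. r \<sigma>' \<omega> \<le> ereal t} \<in> FX M X t"
      using FX_Collect_Int[OF G(2)[OF t] stopping_timeD[OF \<sigma>(2) t order.refl]] by simp
  qed (use nonneg in \<open>auto simp: r_def\<close>)
  note os = optional_stopping[OF r(1) T, of \<alpha> \<beta> \<gamma> \<delta>] and os' = optional_stopping[OF r(2) T, of \<alpha> \<beta> \<gamma> \<delta>]
  have th: "\<bar>\<alpha> * \<theta> \<omega> + \<beta>\<bar> \<le> \<bar>\<alpha>\<bar> + \<bar>\<beta>\<bar>" if "\<omega> \<in> space M" for \<omega> using \<theta>_vals[OF that] by auto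
  have capi: "integrable M (\<lambda>\<omega>. cap (\<rho> \<omega>) T * (\<alpha> * \<theta> \<omega> + \<beta>))" if \<rho>: "stopping_time_ext M (FX M X) \<rho>" for \<rho>
  proof (intro integrable_const_bound[where B="T * (\<bar>\<alpha>\<bar> + \<bar>\<beta>\<bar>)"] AE_I2)
    show "(\<lambda>\<omega>. cap (\<rho> \<omega>) T * (\<alpha> * \<theta> \<omega> + \<beta>)) \<in> borel_measurable M" using cap_meas[OF \<rho> T] by measurable
    fix \<omega> assume w: "\<omega> \<in> space M"
    then have "0 \<le> \<rho> \<omega>" using \<rho> by (auto simp: stopping_time_ext_def)
    then show "norm (cap (\<rho> \<omega>) T * (\<alpha> * \<theta> \<omega> + \<beta>)) \<le> T * (\<bar>\<alpha>\<bar> + \<bar>\<beta>\<bar>)"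
      unfolding real_norm_def abs_mult using cap_nonneg[of "\<rho> \<omega>" T] cap_le[of "\<rho> \<omega>" T] T th[OF w] by (intro mult_mono) auto
  qed
  have gi: "integrable M (\<lambda>\<omega>. indicator G \<omega> * f (Mp (cap (\<rho> \<omega>) T) \<omega>))" if \<rho>: "stopping_time_ext M (FX M X) \<rho>" for \<rho>
    using integrable_real_mult_indicator[OF G(1) optional_stopping(1)[OF \<rho> T, of \<alpha> \<beta> \<gamma> \<delta>]] unfolding f_def by (simp add: mult.commute)
  have "(LINT \<omega>|M. indicator G \<omega> * f (Mp (cap (\<sigma>' \<omega>) T) \<omega>)) - (LINT \<omega>|M. indicator G \<omega> * f (Mp (cap (\<sigma> \<omega>) T) \<omega>))
    = (LINT \<omega>|M. indicator G \<omega> * f (Mp (cap (\<sigma>' \<omega>) T) \<omega>) - indicator G \<omega> * f (Mp (cap (\<sigma> \<omega>) T) \<omega>))"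
    using gi[OF \<sigma>(1)] gi[OF \<sigma>(2)] by simp
  also have "\<dots> = (LINT \<omega>|M. f (Mp (cap (r \<sigma>' \<omega>) T) \<omega>) - f (Mp (cap (r \<sigma> \<omega>) T) \<omega>))"
    by (intro Bochner_Integration.integral_cong) (auto simp: r_def indicator_def)
  also have "\<dots> = 2 * \<mu>\<^sup>2 * ((LINT \<omega>|M. cap (r \<sigma>' \<omega>) T * (\<alpha> * \<theta> \<omega> + \<beta>)) - (LINT \<omega>|M. cap (r \<sigma> \<omega>) T * (\<alpha> * \<theta> \<omega> + \<beta>)))"
    using os os' unfolding f_def by (simp add: right_diff_distrib)
  also have "(LINT \<omega>|M. cap (r \<sigma>' \<omega>) T * (\<alpha> * \<theta> \<omega> + \<beta>)) - (LINT \<omega>|M. cap (r \<sigma> \<omega>) T * (\<alpha> * \<theta> \<omega> + \<beta>))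
    = (LINT \<omega>|M. cap (r \<sigma>' \<omega>) T * (\<alpha> * \<theta> \<omega> + \<beta>) - cap (r \<sigma> \<omega>) T * (\<alpha> * \<theta> \<omega> + \<beta>))"
    using capi[OF r(1)] capi[OF r(2)] by simp
  also have "\<dots> = (LINT \<omega>|M. indicator G \<omega> * ((cap (\<sigma>' \<omega>) T - cap (\<sigma> \<omega>) T) * (\<alpha> * \<theta> \<omega> + \<beta>)))"
    by (intro Bochner_Integration.integral_cong) (auto simp: r_def indicator_def algebra_simps)
  finally show ?thesis by simp
qed

end

subsection \<open>The cost of a rule as a limit over finitely many stages\<close>

lemma cap_diff_mono:
  "0 \<le> x \<Longrightarrow> x \<le> y \<Longrightarrow> 0 \<le> T \<Longrightarrow> T \<le> T' \<Longrightarrow> cap y T - cap x T \<le> cap y T' - cap x T'"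
  by (cases x; cases y) (auto simp: cap_def min_def)

lemma cap_mono_T: "0 \<le> x \<Longrightarrow> 0 \<le> T \<Longrightarrow> T \<le> T' \<Longrightarrow> cap x T \<le> cap x T'"
  by (cases x) (auto simp: cap_def min_def)

definition stage_time :: "('a \<Rightarrow> real) \<Rightarrow> (nat \<Rightarrow> 'a \<Rightarrow> ereal) \<Rightarrow> ('a \<Rightarrow> real) \<Rightarrow> real \<Rightarrow> nat \<Rightarrow> 'a \<Rightarrow> real" where
  "stage_time \<theta> \<tau> d T i \<omega> = (cap (\<tau> (Suc i) \<omega>) T - cap (\<tau> i \<omega>) T) * (if \<theta> \<omega> = d \<omega> * (-1) ^ i then 0 else 1)"

text \<open>The same \<open>N\<close> limits the time horizon and the number of stages, so that
  monotone convergence in one index recovers the whole cost.\<close>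

definition stage_cost :: "('a \<Rightarrow> real) \<Rightarrow> real \<Rightarrow> real \<Rightarrow> real \<Rightarrow>
    (nat \<Rightarrow> 'a \<Rightarrow> ereal) \<Rightarrow> ('a \<Rightarrow> real) \<Rightarrow> nat \<Rightarrow> 'a \<Rightarrow> real" where
  "stage_cost \<theta> c0 c1 c2 \<tau> d N \<omega> = c0 * cap (\<tau> 0 \<omega>) (real N) + c1 * (\<Sum>i<N. stage_time \<theta> \<tau> d (real N) i \<omega>)
    + c2 * (\<Sum>i<N. if \<tau> (Suc i) \<omega> \<le> ereal (real N) then 1 else 0)"

context
  fixes \<tau> :: "nat \<Rightarrow> 'a \<Rightarrow> ereal" and d \<theta> :: "'a \<Rightarrow> real" and \<omega> :: 'a and c0 c1 c2 :: real
  assumes mono: "\<And>n. \<tau> n \<omega> \<le> \<tau> (Suc n) \<omega>" and \<tau>0: "0 \<le> \<tau> 0 \<omega>"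
    and c: "c0 > 0" "c1 > 0" "c2 > 0"
begin

lemma \<tau>_nonneg: "0 \<le> \<tau> i \<omega>"
  using \<tau>0 \<tau>_mono[of \<tau> \<omega>, OF mono, of 0 i] by (auto intro: order.trans)

lemma stage_time_nonneg: "0 \<le> T \<Longrightarrow> 0 \<le> stage_time \<theta> \<tau> d T i \<omega>"
  unfolding stage_time_def using cap_mono[OF \<tau>_nonneg mono] by auto

lemma stage_time_mono: "0 \<le> T \<Longrightarrow> T \<le> T' \<Longrightarrow> stage_time \<theta> \<tau> d T i \<omega> \<le> stage_time \<theta> \<tau> d T' i \<omega>"
  unfolding stage_time_def using cap_diff_mono[OF \<tau>_nonneg mono] by auto

lemma incseq_stage_time: "incseq (\<lambda>N. \<Sum>i<N. stage_time \<theta> \<tau> d (real N) i \<omega>)"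
proof (rule incseq_SucI)
  fix N
  have "(\<Sum>i<N. stage_time \<theta> \<tau> d (real N) i \<omega>) \<le> (\<Sum>i<N. stage_time \<theta> \<tau> d (real (Suc N)) i \<omega>)"
    by (intro sum_mono stage_time_mono) auto
  also have "\<dots> \<le> (\<Sum>i<Suc N. stage_time \<theta> \<tau> d (real (Suc N)) i \<omega>)"
    using stage_time_nonneg[of "real (Suc N)" N] by (simp only: sum.lessThan_Suc) simp
  finally show "(\<Sum>i<N. stage_time \<theta> \<tau> d (real N) i \<omega>) \<le> (\<Sum>i<Suc N. stage_time \<theta> \<tau> d (real (Suc N)) i \<omega>)" .
qed

lemma incseq_stage_count: "incseq (\<lambda>N. \<Sum>i<N. if \<tau> (Suc i) \<omega> \<le> ereal (real N) then 1 else 0 :: real)"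
proof (rule incseq_SucI)
  fix N
  have "(\<Sum>i<N. if \<tau> (Suc i) \<omega> \<le> ereal (real N) then 1 else 0 :: real) \<le> (\<Sum>i<N. if \<tau> (Suc i) \<omega> \<le> ereal (real (Suc N)) then 1 else 0)"
  proof (rule sum_mono)
    fix i
    have "\<tau> (Suc i) \<omega> \<le> ereal (real (Suc N))" if "\<tau> (Suc i) \<omega> \<le> ereal (real N)"
      using that by (rule order.trans) simp
    then show "(if \<tau> (Suc i) \<omega> \<le> ereal (real N) then 1 else 0 :: real) \<le> (if \<tau> (Suc i) \<omega> \<le> ereal (real (Suc N)) then 1 else 0)"
      by (simp del: of_nat_Suc)
  qed
  also have "\<dots> \<le> (\<Sum>i<Suc N. if \<tau> (Suc i) \<omega> \<le> ereal (real (Suc N)) then 1 else 0)"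
    by (simp only: sum.lessThan_Suc) simp
  finally show "(\<Sum>i<N. if \<tau> (Suc i) \<omega> \<le> ereal (real N) then 1 else 0 :: real) \<le> (\<Sum>i<Suc N. if \<tau> (Suc i) \<omega> \<le> ereal (real (Suc N)) then 1 else 0)" .
qed

lemma incseq_cap: "incseq (\<lambda>N. cap (\<tau> 0 \<omega>) (real N))"
  by (rule incseq_SucI) (auto intro!: cap_mono_T \<tau>0)

lemma incseq_stage_cost: "incseq (\<lambda>N. stage_cost \<theta> c0 c1 c2 \<tau> d N \<omega>)"
  using incseq_cap incseq_stage_time incseq_stage_count c
  unfolding incseq_def stage_cost_def by (auto intro!: add_mono mult_left_mono)

lemma stage_cost_nonneg: "0 \<le> stage_cost \<theta> c0 c1 c2 \<tau> d N \<omega>"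
  unfolding stage_cost_def using c cap_nonneg[OF \<tau>0] stage_time_nonneg
  by (intro add_nonneg_nonneg mult_nonneg_nonneg sum_nonneg) auto

text \<open>If all switching times are finite, the count of switches alone drives the supremum to
  infinity. Otherwise only finitely many stages are entered, accumulation is impossible, and the
  three costs are compared separately. Only an inequality is claimed: coinciding switching times are
  all counted on the right but may produce no jump.\<close>

lemma path_cost_le_SUP_stage_cost:
  "path_cost \<theta> c0 c1 c2 \<tau> d \<omega> \<le> (SUP N. ennreal (stage_cost \<theta> c0 c1 c2 \<tau> d N \<omega>))"
proof (cases "\<exists>m. \<tau> (Suc m) \<omega> = \<infinity>")
  case False
  define S where "S = (SUP N. ennreal (stage_cost \<theta> c0 c1 c2 \<tau> d N \<omega>))"
  have K: "ennreal (c2 * real K) \<le> S" for K :: nat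
  proof -
    obtain r where r: "\<tau> K \<omega> = ereal r"
      using False \<tau>_nonneg[of K] mono[of K] by (cases "\<tau> K \<omega>") auto
    obtain N0 :: nat where N0: "r \<le> real N0" using real_arch_simple by blast
    define N where "N = max K N0"
    have "real K = (\<Sum>i<K. 1)" by simp
    also have "\<dots> = (\<Sum>i<K. if \<tau> (Suc i) \<omega> \<le> ereal (real N) then 1 else 0)"
    proof (rule sum.cong[OF refl])
      fix i assume "i \<in> {..<K}"
      then have "\<tau> (Suc i) \<omega> \<le> \<tau> K \<omega>" by (intro \<tau>_mono[of \<tau> \<omega>, OF mono]) auto
      also have "\<dots> \<le> ereal (real N)" unfolding r using N0 by (simp add: N_def)
      finally show "1 = (if \<tau> (Suc i) \<omega> \<le> ereal (real N) then 1 else 0 :: real)" by simp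
    qed
    also have "\<dots> \<le> (\<Sum>i<N. if \<tau> (Suc i) \<omega> \<le> ereal (real N) then 1 else 0)"
      by (rule sum_mono2) (auto simp: N_def)
    finally have "c2 * real K \<le> c2 * (\<Sum>i<N. if \<tau> (Suc i) \<omega> \<le> ereal (real N) then 1 else 0)" using c by simp
    also have "\<dots> \<le> stage_cost \<theta> c0 c1 c2 \<tau> d N \<omega>"
      unfolding stage_cost_def using c cap_nonneg[OF \<tau>0, of "real N"] stage_time_nonneg[of "real N"]
      by (simp add: sum_nonneg)
    finally have "ennreal (c2 * real K) \<le> ennreal (stage_cost \<theta> c0 c1 c2 \<tau> d N \<omega>)" by (rule ennreal_leI)
    also have "\<dots> \<le> S" unfolding S_def by (rule SUP_upper) simp
    finally show ?thesis .
  qed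
  have "S = top"
  proof (cases S)
    case (real s)
    obtain K :: nat where "s / c2 < real K" using reals_Archimedean2 by blast
    then have "s < c2 * real K" using c by (simp add: field_simps)
    then show ?thesis using K[of K] real by (simp add: ennreal_le_iff2)
  qed
  then show ?thesis unfolding S_def[symmetric] by simp
next
  case True
  then obtain m where m: "\<tau> (Suc m) \<omega> = \<infinity>" by blast
  note btw = Dproc_between(1)[where \<tau>=\<tau> and \<omega>=\<omega> and d=d, OF mono]
  have na: "\<exists>n. \<tau> n \<omega> \<le> ereal t \<and> ereal t < \<tau> (Suc n) \<omega>" if t: "\<tau> 0 \<omega> \<le> ereal t" for t
  proof -
    define n where "n = (LEAST n. ereal t < \<tau> (Suc n) \<omega>)"
    have 1: "ereal t < \<tau> (Suc n) \<omega>" unfolding n_def by (rule LeastI[of _ m]) (simp add: m)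
    have "\<tau> n \<omega> \<le> ereal t"
    proof (cases n)
      case (Suc k)
      then show ?thesis using not_less_Least[of k "\<lambda>n. ereal t < \<tau> (Suc n) \<omega>"] unfolding n_def by simp
    qed (use t in simp)
    then show ?thesis using 1 by blast
  qed
  let ?e0 = "\<lambda>N. cap (\<tau> 0 \<omega>) (real N)"
  let ?e1 = "\<lambda>N. \<Sum>i<N. stage_time \<theta> \<tau> d (real N) i \<omega>"
  let ?e2 = "\<lambda>N. \<Sum>i<N. if \<tau> (Suc i) \<omega> \<le> ereal (real N) then 1 else 0 :: real"
  have A: "e2ennreal (\<tau> 0 \<omega>) \<le> (SUP N. ennreal (?e0 N))"
  proof (cases "\<tau> 0 \<omega>")
    case (real r)
    obtain N :: nat where N: "r \<le> real N" using real_arch_simple by blast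
    then have "e2ennreal (\<tau> 0 \<omega>) = ennreal (?e0 N)" by (simp add: real cap_eq)
    also have "\<dots> \<le> (SUP N. ennreal (?e0 N))" by (rule SUP_upper) simp
    finally show ?thesis .
  next
    case PInf
    then have "?e0 N = real N" for N by (simp add: cap_infinity)
    then have "(SUP N. ennreal (?e0 N)) = top"
      by (simp only: ennreal_of_nat_eq_real_of_nat[symmetric] ennreal_SUP_of_nat_eq_top)
    then show ?thesis by (simp only: top_greatest)
  qed (use \<tau>0 in auto)
  have Bd: "(\<integral>\<^sup>+ t. indicator {t. \<tau> 0 \<omega> \<le> ereal t \<and> Dproc \<tau> d t \<omega> \<noteq> \<theta> \<omega>} t \<partial>lborel) \<le> (SUP N. ennreal (?e1 N))"
  proof -
    define W where "W N = {i. i < N \<and> \<theta> \<omega> \<noteq> d \<omega> * (-1) ^ i}" for N :: nat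
    define S where "S N = (\<Union>i\<in>W N. {cap (\<tau> i \<omega>) (real N)..<cap (\<tau> (Suc i) \<omega>) (real N)})" for N :: nat
    have finW: "finite (W N)" for N by (simp add: W_def)
    have S_mem: "t \<in> S N \<longleftrightarrow> (\<exists>i\<in>W N. \<tau> i \<omega> \<le> ereal t \<and> ereal t < \<tau> (Suc i) \<omega>) \<and> t < real N" for t N
    proof -
      have "cap (\<tau> i \<omega>) (real N) \<le> t \<and> t < cap (\<tau> (Suc i) \<omega>) (real N) \<longleftrightarrow>
          (\<tau> i \<omega> \<le> ereal t \<and> ereal t < \<tau> (Suc i) \<omega>) \<and> t < real N" for i
        using \<tau>_nonneg[of i] \<tau>_nonneg[of "Suc i"]
        by (cases "\<tau> i \<omega>"; cases "\<tau> (Suc i) \<omega>") (auto simp: cap_def min_def)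
      then show ?thesis unfolding S_def by auto
    qed
    have incS: "incseq S"
      unfolding incseq_def
    proof (intro allI impI subsetI)
      fix N N' :: nat and t assume "N \<le> N'" "t \<in> S N"
      then show "t \<in> S N'" unfolding S_mem W_def by force
    qed
    have Sm: "S N \<in> sets lborel" for N unfolding S_def using finW by (intro sets.finite_UN) auto
    have sub: "{t. \<tau> 0 \<omega> \<le> ereal t \<and> Dproc \<tau> d t \<omega> \<noteq> \<theta> \<omega>} \<subseteq> (\<Union>N. S N)"
    proof
      fix t assume t: "t \<in> {t. \<tau> 0 \<omega> \<le> ereal t \<and> Dproc \<tau> d t \<omega> \<noteq> \<theta> \<omega>}"
      then obtain n where n: "\<tau> n \<omega> \<le> ereal t" "ereal t < \<tau> (Suc n) \<omega>" using na by blast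
      obtain N0 :: nat where N0: "t < real N0" using reals_Archimedean2 by blast
      have "t \<in> S (max N0 (Suc n))"
        unfolding S_mem W_def using n N0 btw[OF n] t by (auto intro!: exI[of _ n])
      then show "t \<in> (\<Union>N. S N)" by blast
    qed
    have "(\<integral>\<^sup>+ t. indicator {t. \<tau> 0 \<omega> \<le> ereal t \<and> Dproc \<tau> d t \<omega> \<noteq> \<theta> \<omega>} t \<partial>lborel) \<le> (\<integral>\<^sup>+ t. indicator (\<Union>N. S N) t \<partial>lborel)"
      by (rule nn_integral_indicator_mono[OF sub])
    also have "\<dots> = emeasure lborel (\<Union>N. S N)" using Sm by (intro nn_integral_indicator) auto
    also have "\<dots> = (SUP N. emeasure lborel (S N))" using Sm incS by (intro SUP_emeasure_incseq[symmetric]) auto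
    also have "\<dots> \<le> (SUP N. ennreal (?e1 N))"
    proof (intro SUP_mono bexI)
      fix N :: nat
      have "emeasure lborel (S N) \<le> (\<Sum>i\<in>W N. emeasure lborel {cap (\<tau> i \<omega>) (real N)..<cap (\<tau> (Suc i) \<omega>) (real N)})"
        unfolding S_def using finW by (intro emeasure_subadditive_finite) auto
      also have "\<dots> = (\<Sum>i\<in>W N. ennreal (stage_time \<theta> \<tau> d (real N) i \<omega>))"
        using cap_mono[OF \<tau>_nonneg mono, of "real N"] by (intro sum.cong) (auto simp: W_def stage_time_def)
      also have "\<dots> \<le> (\<Sum>i<N. ennreal (stage_time \<theta> \<tau> d (real N) i \<omega>))"
        by (rule sum_mono2) (auto simp: W_def)
      also have "\<dots> = ennreal (?e1 N)" using stage_time_nonneg by (intro sum_ennreal) auto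
      finally show "emeasure lborel (S N) \<le> ennreal (?e1 N)" .
    qed simp
    finally show ?thesis .
  qed
  have Cd: "emeasure (count_space UNIV) {t. \<tau> 0 \<omega> < ereal t \<and> Dleft \<tau> d t \<omega> \<noteq> Dproc \<tau> d t \<omega>} \<le> (SUP N. ennreal (?e2 N))"
  proof -
    define F where "F = {i. \<tau> (Suc i) \<omega> \<noteq> \<infinity>}"
    have Fm: "F \<subseteq> {..<m}"
    proof
      fix i assume "i \<in> F"
      show "i \<in> {..<m}"
      proof (rule ccontr)
        assume "i \<notin> {..<m}"
        then have "\<tau> (Suc m) \<omega> \<le> \<tau> (Suc i) \<omega>" by (intro \<tau>_mono[of \<tau> \<omega>, OF mono]) auto
        then show False using m \<open>i \<in> F\<close> by (simp add: F_def)
      qed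
    qed
    have finF: "finite F" using Fm finite_subset by blast
    have sub: "{t. \<tau> 0 \<omega> < ereal t \<and> Dleft \<tau> d t \<omega> \<noteq> Dproc \<tau> d t \<omega>} \<subseteq> (\<lambda>i. real_of_ereal (\<tau> (Suc i) \<omega>)) ` F"
    proof
      fix t assume "t \<in> {t. \<tau> 0 \<omega> < ereal t \<and> Dleft \<tau> d t \<omega> \<noteq> Dproc \<tau> d t \<omega>}"
      then have t: "\<tau> 0 \<omega> < ereal t" "Dleft \<tau> d t \<omega> \<noteq> Dproc \<tau> d t \<omega>" by auto
      show "t \<in> (\<lambda>i. real_of_ereal (\<tau> (Suc i) \<omega>)) ` F"
      proof (rule ccontr)
        assume no: "t \<notin> (\<lambda>i. real_of_ereal (\<tau> (Suc i) \<omega>)) ` F"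
        have ne: "\<tau> (Suc i) \<omega> \<noteq> ereal t" for i
        proof
          assume "\<tau> (Suc i) \<omega> = ereal t"
          then have "i \<in> F" "t = real_of_ereal (\<tau> (Suc i) \<omega>)" by (auto simp: F_def)
          then show False using no by blast
        qed
        obtain n where n: "\<tau> n \<omega> \<le> ereal t" "ereal t < \<tau> (Suc n) \<omega>" using na t(1) by (meson less_imp_le)
        have "\<tau> n \<omega> < ereal t" using n(1) ne t(1) by (cases n) (auto simp: less_le)
        then obtain r where r: "\<tau> n \<omega> = ereal r" "r < t" using \<tau>_nonneg[of n] by (cases "\<tau> n \<omega>") auto
        have "Dproc \<tau> d s \<omega> = Dproc \<tau> d t \<omega>" if "r < s" "s < t" for s
        proof -
          have "ereal s < \<tau> (Suc n) \<omega>" using order.strict_trans[OF _ n(2), of "ereal s"] that by simp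
          then show ?thesis using btw[OF n] btw[of n s] r that by simp
        qed
        then have "Dleft \<tau> d t \<omega> = Dproc \<tau> d t \<omega>" unfolding Dleft_def by (rule Lim_at_left_const[OF r(2)])
        then show False using t(2) by simp
      qed
    qed
    have "emeasure (count_space UNIV) {t. \<tau> 0 \<omega> < ereal t \<and> Dleft \<tau> d t \<omega> \<noteq> Dproc \<tau> d t \<omega>}
      \<le> emeasure (count_space UNIV) ((\<lambda>i. real_of_ereal (\<tau> (Suc i) \<omega>)) ` F)" using sub by (intro emeasure_mono) auto
    also have "\<dots> = of_nat (card ((\<lambda>i. real_of_ereal (\<tau> (Suc i) \<omega>)) ` F))" using finF by simp
    also have "\<dots> \<le> of_nat (card F)" using card_image_le[OF finF] by simp
    also have "\<dots> \<le> (SUP N. ennreal (?e2 N))"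
    proof -
      have "\<exists>N0::nat. \<forall>i\<in>F. \<tau> (Suc i) \<omega> \<le> ereal (real N0)"
      proof -
        have "\<forall>i\<in>F. \<exists>k::nat. \<tau> (Suc i) \<omega> \<le> ereal (real k)"
        proof
          fix i assume "i \<in> F"
          then obtain r where "\<tau> (Suc i) \<omega> = ereal r" using \<tau>_nonneg[of "Suc i"] by (cases "\<tau> (Suc i) \<omega>") (auto simp: F_def)
          then show "\<exists>k::nat. \<tau> (Suc i) \<omega> \<le> ereal (real k)" using real_arch_simple[of r] by auto
        qed
        then obtain k where k: "\<And>i. i \<in> F \<Longrightarrow> \<tau> (Suc i) \<omega> \<le> ereal (real (k i :: nat))" by metis
        have "\<tau> (Suc i) \<omega> \<le> ereal (real (Max (k ` F)))" if "i \<in> F" for i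
          using k[OF that] finF that by (auto intro!: order.trans[OF k[OF that]] Max_ge)
        then show ?thesis by blast
      qed
      then obtain N0 :: nat where N0: "\<And>i. i \<in> F \<Longrightarrow> \<tau> (Suc i) \<omega> \<le> ereal (real N0)" by blast
      define N where "N = max N0 m"
      have "real (card F) = (\<Sum>i\<in>F. if \<tau> (Suc i) \<omega> \<le> ereal (real N) then 1 else 0)"
      proof -
        have "\<tau> (Suc i) \<omega> \<le> ereal (real N)" if "i \<in> F" for i using N0[OF that] by (rule order.trans) (simp add: N_def)
        then have "(\<Sum>i\<in>F. if \<tau> (Suc i) \<omega> \<le> ereal (real N) then 1 else 0) = (\<Sum>i\<in>F. 1 :: real)" by (intro sum.cong) auto
        then show ?thesis by simp
      qed
      also have "\<dots> \<le> ?e2 N" using Fm by (intro sum_mono2) (auto simp: N_def)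
      finally have "ennreal (real (card F)) \<le> ennreal (?e2 N)" by (rule ennreal_leI)
      also have "\<dots> \<le> (SUP N. ennreal (?e2 N))" by (rule SUP_upper) simp
      finally show ?thesis by (simp add: ennreal_of_nat_eq_real_of_nat)
    qed
    finally show ?thesis .
  qed
  have inc: "incseq (\<lambda>N. ennreal (k * f N))" if "incseq f" "0 \<le> k" for k and f :: "nat \<Rightarrow> real"
    using that by (auto simp: incseq_def intro!: ennreal_leI mult_left_mono)
  have scale: "ennreal k * (SUP N. ennreal (f N)) = (SUP N. ennreal (k * f N))" if "0 \<le> k" for k and f :: "nat \<Rightarrow> real"
    using that by (simp add: SUP_mult_left_ennreal ennreal_mult')
  have "path_cost \<theta> c0 c1 c2 \<tau> d \<omega> \<le> ennreal c0 * (SUP N. ennreal (?e0 N)) + ennreal c1 * (SUP N. ennreal (?e1 N)) + ennreal c2 * (SUP N. ennreal (?e2 N))"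
    unfolding path_cost_def using A Bd Cd by (intro add_mono mult_left_mono) auto
  also have "\<dots> = (SUP N. ennreal (c0 * ?e0 N) + ennreal (c1 * ?e1 N) + ennreal (c2 * ?e2 N))"
  proof -
    note i = inc[OF incseq_cap less_imp_le[OF c(1)]] inc[OF incseq_stage_time less_imp_le[OF c(2)]]
      inc[OF incseq_stage_count less_imp_le[OF c(3)]]
    have i01: "incseq (\<lambda>N. ennreal (c0 * ?e0 N) + ennreal (c1 * ?e1 N))"
      using i(1,2) unfolding incseq_def by (intro allI impI add_mono) blast+
    show ?thesis
      unfolding scale[OF less_imp_le[OF c(1)]] scale[OF less_imp_le[OF c(2)]] scale[OF less_imp_le[OF c(3)]]
        ennreal_SUP_add[OF i(1,2), symmetric] ennreal_SUP_add[OF i01 i(3), symmetric] ..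
  qed
  also have "\<dots> = (SUP N. ennreal (stage_cost \<theta> c0 c1 c2 \<tau> d N \<omega>))"
  proof (rule SUP_cong[OF refl])
    fix N :: nat
    have "0 \<le> c0 * ?e0 N" "0 \<le> c1 * ?e1 N" "0 \<le> c2 * ?e2 N"
      using c cap_nonneg[OF \<tau>0, of "real N"] stage_time_nonneg[of "real N"]
      by (auto intro!: mult_nonneg_nonneg sum_nonneg)
    then show "ennreal (c0 * ?e0 N) + ennreal (c1 * ?e1 N) + ennreal (c2 * ?e2 N) = ennreal (stage_cost \<theta> c0 c1 c2 \<tau> d N \<omega>)"
      unfolding stage_cost_def by (simp only: ennreal_plus add_nonneg_nonneg)
  qed
  finally show ?thesis .
qed

end

subsection \<open>The risk of the candidate rule\<close>

context testing_problem
begin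

abbreviation ts :: "nat \<Rightarrow> 'a \<Rightarrow> ereal" where "ts \<equiv> tau_star Mp A B"
abbreviation ds :: "'a \<Rightarrow> real" where "ds \<equiv> d_star Mp A"

lemma rule_star: "decision_rule M (FX M X) ts ds"
  by (rule decision_rule_star[OF Mp_adapted Mp_cont A(1)])

lemma ts_stop: "stopping_time_ext M (FX M X) (ts n)"
  using rule_star by (simp add: decision_rule_def)

lemma ts_mono: "\<omega> \<in> space M \<Longrightarrow> ts n \<omega> \<le> ts (Suc n) \<omega>"
  using rule_star by (simp add: decision_rule_def del: tau_star.simps)

lemma ts_ge_0: "\<omega> \<in> space M \<Longrightarrow> ts 0 \<omega> \<le> ts n \<omega>"
  by (induction n) (auto intro: order.trans[OF _ ts_mono] simp del: tau_star.simps)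

lemma ts_nonneg: "\<omega> \<in> space M \<Longrightarrow> 0 \<le> ts n \<omega>"
  using ts_stop[of n] unfolding stopping_time_ext_def by blast

lemma ds_vals: "\<omega> \<in> space M \<Longrightarrow> ds \<omega> \<in> {-1, 1}"
  using rule_star by (simp add: decision_rule_def)

text \<open>The function to be stopped, \<open>U (sgn_at n * Mp)\<close>, carries a random sign. On
  \<open>G j\<close> the sign is a constant, and \<open>optional_stopping_between\<close> applies
  with \<open>G j\<close> as its event.\<close>

definition G :: "real \<Rightarrow> 'a set" where "G j = {\<omega>\<in>space M. ds \<omega> = j}"

lemma G_stop: "0 \<le> t \<Longrightarrow> G j \<inter> {\<omega>\<in>space M. ts n \<omega> \<le> ereal t} \<in> FX M X t"
proof -
  assume t: "0 \<le> t"
  have "ds -` {j} \<inter> space M \<in> F_at M (FX M X) (ts 0)"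
    using rule_star unfolding decision_rule_def by auto
  then have "(ds -` {j} \<inter> space M) \<inter> {\<omega>\<in>space M. ts 0 \<omega> \<le> ereal t} \<in> FX M X t"
    using t unfolding F_at_def by blast
  from FX_Collect_Int[OF this stopping_timeD[OF ts_stop[of n] t order.refl]]
  have "((ds -` {j} \<inter> space M) \<inter> {\<omega>\<in>space M. ts 0 \<omega> \<le> ereal t}) \<inter> {\<omega>\<in>space M. ts n \<omega> \<le> ereal t} \<in> FX M X t" .
  also have "((ds -` {j} \<inter> space M) \<inter> {\<omega>\<in>space M. ts 0 \<omega> \<le> ereal t}) \<inter> {\<omega>\<in>space M. ts n \<omega> \<le> ereal t}
    = G j \<inter> {\<omega>\<in>space M. ts n \<omega> \<le> ereal t}"
    using ts_ge_0[of _ n] by (auto simp: G_def simp del: tau_star.simps intro: order.trans)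
  finally show ?thesis .
qed

lemma G_sets [measurable]: "G j \<in> sets M"
proof -
  have "ds -` {j} \<inter> space M \<in> F_infty M (FX M X)"
    using rule_star unfolding decision_rule_def F_at_def by auto
  moreover have "F_infty M (FX M X) \<subseteq> sets M"
    unfolding F_infty_def using FX_sets by (intro sets.sigma_sets_subset) auto
  moreover have "G j = ds -` {j} \<inter> space M" by (auto simp: G_def)
  ultimately show ?thesis by auto
qed

lemma split_G: "\<omega> \<in> space M \<Longrightarrow> (x::real) = indicator (G 1) \<omega> * x + indicator (G (-1)) \<omega> * x"
  using ds_vals[of \<omega>] by (auto simp: G_def indicator_def)

definition sgn_at :: "nat \<Rightarrow> 'a \<Rightarrow> real" where "sgn_at n \<omega> = ds \<omega> * (-1) ^ n"

lemma sgn_at_vals: "\<omega> \<in> space M \<Longrightarrow> sgn_at n \<omega> \<in> {-1, 1}"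
  using ds_vals[of \<omega>] by (cases "even n") (auto simp: sgn_at_def)

section \<open>The candidate rule stage by stage, up to a finite horizon\<close>

context
  fixes T :: real assumes T: "0 < T"
begin

abbreviation ct :: "nat \<Rightarrow> 'a \<Rightarrow> real" where "ct n \<omega> \<equiv> cap (ts n \<omega>) T"

lemma ct_meas [measurable]: "ct n \<in> borel_measurable M"
  by (rule cap_meas[OF ts_stop T])

text \<open>The continuation value on entering stage \<open>n\<close>. A stage not entered by the
  horizon causes no cost before it, so the value 0 is what makes the stage bounds telescope.\<close>

definition entry_val :: "nat \<Rightarrow> 'a \<Rightarrow> real" where
  "entry_val n \<omega> = (if ts n \<omega> \<le> ereal T then U (sgn_at n \<omega> * Mp (ct n \<omega>) \<omega>) else 0)"

lemma integrable_G_U: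
  assumes s: "s \<in> {-1, 1}"
  shows "integrable M (\<lambda>\<omega>. indicator (G j) \<omega> * U (s * Mp (ct k \<omega>) \<omega>))"
  using integrable_real_mult_indicator[OF G_sets optional_stopping(1)[OF ts_stop[of k] T, of "K * s" "- K" a "- a * s"], of j]
  by (simp add: U_affine[OF s Mp_abs] mult.commute)

lemma sign_pow: "j \<in> {-1, 1} \<Longrightarrow> j * (-1) ^ n \<in> {-1, 1 :: real}"
  by (cases "even n") auto

lemma G_U_cong: "\<omega> \<in> space M \<Longrightarrow> indicator (G j) \<omega> * f (sgn_at n \<omega>) = indicator (G j) \<omega> * (f (j * (-1) ^ n) :: real)"
  by (auto simp: G_def indicator_def sgn_at_def)

lemma integrable_U_sgn: "integrable M (\<lambda>\<omega>. U (sgn_at n \<omega> * Mp (ct k \<omega>) \<omega>))"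
proof -
  have i: "integrable M (\<lambda>\<omega>. indicator (G 1) \<omega> * U ((1 * (-1) ^ n) * Mp (ct k \<omega>) \<omega>)
      + indicator (G (-1)) \<omega> * U ((-1 * (-1) ^ n) * Mp (ct k \<omega>) \<omega>))"
    by (intro Bochner_Integration.integrable_add integrable_G_U sign_pow) auto
  have "integrable M (\<lambda>\<omega>. U (sgn_at n \<omega> * Mp (ct k \<omega>) \<omega>)) \<longleftrightarrow>
    integrable M (\<lambda>\<omega>. indicator (G 1) \<omega> * U ((1 * (-1) ^ n) * Mp (ct k \<omega>) \<omega>)
      + indicator (G (-1)) \<omega> * U ((-1 * (-1) ^ n) * Mp (ct k \<omega>) \<omega>))"
  proof (rule Bochner_Integration.integrable_cong[OF refl])
    fix \<omega> assume w: "\<omega> \<in> space M"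
    show "U (sgn_at n \<omega> * Mp (ct k \<omega>) \<omega>) = indicator (G 1) \<omega> * U ((1 * (-1) ^ n) * Mp (ct k \<omega>) \<omega>)
      + indicator (G (-1)) \<omega> * U ((-1 * (-1) ^ n) * Mp (ct k \<omega>) \<omega>)"
      unfolding G_U_cong[OF w, where f="\<lambda>s. U (s * Mp (ct k \<omega>) \<omega>)", symmetric] by (rule split_G[OF w])
  qed
  then show ?thesis using i by blast
qed

lemma integrable_stage_time: "integrable M (stage_time \<theta> ts ds T n)"
proof (intro integrable_const_bound[where B=T] AE_I2)
  have [measurable]: "Measurable.pred M (\<lambda>\<omega>. ds \<omega> = 1)"
    unfolding pred_def using G_sets[of 1] by (simp add: G_def)
  have "(\<lambda>\<omega>. (ct (Suc n) \<omega> - ct n \<omega>) * (if \<theta> \<omega> = (if ds \<omega> = 1 then 1 else -1) * (-1) ^ n then 0 else 1)) \<in> borel_measurable M"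
    by measurable
  also have "?this \<longleftrightarrow> stage_time \<theta> ts ds T n \<in> borel_measurable M"
  proof (rule measurable_cong)
    fix \<omega> assume "\<omega> \<in> space M"
    then show "(ct (Suc n) \<omega> - ct n \<omega>) * (if \<theta> \<omega> = (if ds \<omega> = 1 then 1 else -1) * (-1) ^ n then 0 else 1) = stage_time \<theta> ts ds T n \<omega>"
      using ds_vals[of \<omega>] unfolding stage_time_def by (cases "ds \<omega> = 1") auto
  qed
  finally show "stage_time \<theta> ts ds T n \<in> borel_measurable M" .
  fix \<omega> assume w: "\<omega> \<in> space M"
  have "0 \<le> ct n \<omega>" "ct n \<omega> \<le> ct (Suc n) \<omega>" "ct (Suc n) \<omega> \<le> T"
    using cap_nonneg[OF ts_nonneg[OF w]] cap_mono[OF ts_nonneg[OF w] ts_mono[OF w]] cap_le[OF ts_nonneg[OF w]] T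
    by (auto simp del: tau_star.simps)
  then show "norm (stage_time \<theta> ts ds T n \<omega>) \<le> T"
    unfolding stage_time_def by (auto simp del: tau_star.simps)
qed

text \<open>Within a stage the current value is \<open>U\<close> itself, without convex correction;
  hence optional stopping yields an equality, taken separately on the two events
  \<open>G j\<close>.\<close>

lemma stage_identity:
  "c1 * (LINT \<omega>|M. stage_time \<theta> ts ds T n \<omega>) =
    (LINT \<omega>|M. U (sgn_at n \<omega> * Mp (ct n \<omega>) \<omega>)) - (LINT \<omega>|M. U (sgn_at n \<omega> * Mp (ct (Suc n) \<omega>) \<omega>))"
proof -
  have split: "(LINT \<omega>|M. f \<omega>) = (LINT \<omega>|M. indicator (G 1) \<omega> * f \<omega>) + (LINT \<omega>|M. indicator (G (-1)) \<omega> * f \<omega>)"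
    if f: "integrable M f" for f :: "'a \<Rightarrow> real"
  proof -
    have "integrable M (\<lambda>\<omega>. indicator (G j) \<omega> * f \<omega>)" for j
      using integrable_real_mult_indicator[OF G_sets f] by (simp add: mult.commute)
    moreover have "(LINT \<omega>|M. f \<omega>) = (LINT \<omega>|M. indicator (G 1) \<omega> * f \<omega> + indicator (G (-1)) \<omega> * f \<omega>)"
      by (intro Bochner_Integration.integral_cong refl split_G)
    ultimately show ?thesis by simp
  qed
  have part: "c1 * (LINT \<omega>|M. indicator (G j) \<omega> * stage_time \<theta> ts ds T n \<omega>) =
    (LINT \<omega>|M. indicator (G j) \<omega> * U (sgn_at n \<omega> * Mp (ct n \<omega>) \<omega>)) -
    (LINT \<omega>|M. indicator (G j) \<omega> * U (sgn_at n \<omega> * Mp (ct (Suc n) \<omega>) \<omega>))" if j: "j \<in> {-1, 1}" for j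
  proof -
    define s where "s = j * (-1) ^ n"
    have s: "s \<in> {-1, 1}" unfolding s_def by (rule sign_pow[OF j])
    have U_int: "(LINT \<omega>|M. indicator (G j) \<omega> * U (sgn_at n \<omega> * Mp (ct k \<omega>) \<omega>))
      = (LINT \<omega>|M. indicator (G j) \<omega> * affine_logit (K * s) (- K) a (- a * s) (Mp (ct k \<omega>) \<omega>))" for k
      using G_U_cong[where f="\<lambda>s. U (s * Mp (ct k _) _)" and j=j and n=n]
      by (intro Bochner_Integration.integral_cong) (simp_all add: s_def[symmetric] U_affine[OF s Mp_abs] del: tau_star.simps)
    have "(LINT \<omega>|M. indicator (G j) \<omega> * ((ct (Suc n) \<omega> - ct n \<omega>) * (K * s * \<theta> \<omega> + - K)))
      = (LINT \<omega>|M. - 2 * K * (indicator (G j) \<omega> * stage_time \<theta> ts ds T n \<omega>))"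
    proof (rule Bochner_Integration.integral_cong[OF refl])
      fix \<omega> assume w: "\<omega> \<in> space M"
      show "indicator (G j) \<omega> * ((ct (Suc n) \<omega> - ct n \<omega>) * (K * s * \<theta> \<omega> + - K))
        = - 2 * K * (indicator (G j) \<omega> * stage_time \<theta> ts ds T n \<omega>)"
      proof (cases "\<omega> \<in> G j")
        case True
        then have "stage_time \<theta> ts ds T n \<omega> = (ct (Suc n) \<omega> - ct n \<omega>) * wrong s \<omega>"
          by (simp add: stage_time_def wrong_def G_def s_def del: tau_star.simps)
        moreover have "K * s * \<theta> \<omega> + - K = - 2 * K * wrong s \<omega>"
          unfolding wrong_eq[OF w s] by (simp add: algebra_simps)
        ultimately show ?thesis by (simp del: tau_star.simps)
      qed simp
    qed
    also have "\<dots> = - 2 * K * (LINT \<omega>|M. indicator (G j) \<omega> * stage_time \<theta> ts ds T n \<omega>)" by simp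
    finally have *: "2 * \<mu>\<^sup>2 * (LINT \<omega>|M. indicator (G j) \<omega> * ((ct (Suc n) \<omega> - ct n \<omega>) * (K * s * \<theta> \<omega> + - K)))
      = - (2 * (2 * \<mu>\<^sup>2 * K)) * (LINT \<omega>|M. indicator (G j) \<omega> * stage_time \<theta> ts ds T n \<omega>)" by (simp del: tau_star.simps)
    show ?thesis
      using optional_stopping_between[OF ts_stop[of n] ts_stop[of "Suc n"] ts_mono G_sets G_stop T, of j "K * s" "- K" a "- a * s"]
      unfolding * K_\<mu> U_int by (simp del: tau_star.simps)
  qed
  show ?thesis
    unfolding split[OF integrable_stage_time] split[OF integrable_U_sgn[of n n]] split[OF integrable_U_sgn[of n "Suc n"]]
    using part[of 1] part[of "-1"] by (simp add: distrib_left del: tau_star.simps)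
qed

lemma pred_ts [measurable]: "Measurable.pred M (\<lambda>\<omega>. ts n \<omega> \<le> ereal T)"
  using stopping_timeD[OF ts_stop[of n], of T T] T FX_sets unfolding pred_def by auto

lemma integrable_entry_val: "integrable M (entry_val n)"
  unfolding entry_val_def[abs_def] using integrable_U_sgn[of n n]
  by (intro Bochner_Integration.integrable_bound[OF integrable_U_sgn[of n n]]) (auto simp del: tau_star.simps)

lemma ts_realD:
  assumes w: "\<omega> \<in> space M" and le: "ts n \<omega> \<le> ereal T"
  obtains r where "ts n \<omega> = ereal r" "0 \<le> r" "r \<le> T" "ct n \<omega> = r"
  using ts_nonneg[OF w, of n] le by (cases "ts n \<omega>") (auto simp: cap_eq min_def simp del: tau_star.simps)

lemma sgn_at_Mp_lt: "\<omega> \<in> space M \<Longrightarrow> \<bar>sgn_at n \<omega> * Mp t \<omega>\<bar> < 1"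
  using sgn_at_vals[of \<omega> n] Mp_abs[of t \<omega>] by auto

lemma entry_val_nonneg: assumes w: "\<omega> \<in> space M" shows "0 \<le> entry_val n \<omega>"
proof (cases "ts n \<omega> \<le> ereal T")
  case True
  then obtain r where r: "ts n \<omega> = ereal r" "ct n \<omega> = r" using ts_realD[OF w] by metis
  have "min A B \<le> sgn_at n \<omega> * Mp r \<omega>"
    using tau_star_attained(2)[OF Mp_cont[OF w] A(1) r(1)] D_star_def[of Mp A \<omega> n] by (simp add: sgn_at_def)
  then have "- B \<le> sgn_at n \<omega> * Mp r \<omega>" using A B by (auto simp: min_def split: if_splits)
  then show ?thesis using True r sgn_at_Mp_lt[OF w, of n r] U_nonneg unfolding entry_val_def
    by (auto simp del: tau_star.simps)
qed (simp add: entry_val_def del: tau_star.simps)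

text \<open>A stage beyond the horizon contributes nothing. A stage cut by the horizon leaves a
  value that is nonnegative because the signed posterior mean is still above \<open>- B\<close>. A
  completed stage ends exactly at \<open>- B\<close>, where value matching
  \<open>U (- B) = U B + c2\<close> pays for the switch and gives the entry value of the next
  stage.\<close>

lemma stage_bound_pathwise:
  assumes w: "\<omega> \<in> space M"
  shows "U (sgn_at n \<omega> * Mp (ct n \<omega>) \<omega>) - U (sgn_at n \<omega> * Mp (ct (Suc n) \<omega>) \<omega>)
    \<le> entry_val n \<omega> - entry_val (Suc n) \<omega> - c2 * (if ts (Suc n) \<omega> \<le> ereal T then 1 else 0)"
proof -
  have D: "D_star Mp A \<omega> n = sgn_at n \<omega>" using D_star_def[of Mp A \<omega> n] by (simp add: sgn_at_def)
  have le: "ts n \<omega> \<le> ts (Suc n) \<omega>" by (rule ts_mono[OF w])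
  consider "ereal T < ts n \<omega>" | "ts n \<omega> \<le> ereal T" "ereal T < ts (Suc n) \<omega>" | "ts (Suc n) \<omega> \<le> ereal T"
    by fastforce
  then show ?thesis
  proof cases
    case 1
    then have 2: "ereal T < ts (Suc n) \<omega>" using le by (rule less_le_trans)
    have "ct n \<omega> = T" "ct (Suc n) \<omega> = T" using 1 2 by (auto intro!: cap_ge less_imp_le simp del: tau_star.simps)
    then show ?thesis using 1 2 by (simp add: entry_val_def not_le[symmetric] del: tau_star.simps)
  next
    case 2
    have "ct (Suc n) \<omega> = T" using 2 by (auto intro!: cap_ge less_imp_le simp del: tau_star.simps)
    moreover have "- B < sgn_at n \<omega> * Mp T \<omega>"
      using before_tau_star_Suc[OF Mp_cont[OF w] A(1) 2] unfolding D .
    then have "0 \<le> U (sgn_at n \<omega> * Mp T \<omega>)" using sgn_at_Mp_lt[OF w, of n T] by (intro U_nonneg) auto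
    ultimately show ?thesis using 2 by (simp add: entry_val_def not_le[symmetric] del: tau_star.simps)
  next
    case 3
    obtain r where r: "ts (Suc n) \<omega> = ereal r" "ct (Suc n) \<omega> = r" using ts_realD[OF w 3] by metis
    have B': "sgn_at n \<omega> * Mp r \<omega> = - B"
      using at_tau_star_Suc[OF Mp_cont[OF w] A(1) B(1) r(1)] unfolding D .
    then have "sgn_at (Suc n) \<omega> * Mp r \<omega> = B" by (simp add: sgn_at_def)
    moreover have "ts n \<omega> \<le> ereal T" using le 3 by (rule order.trans)
    ultimately show ?thesis using B' r 3 U_minus_B by (simp add: entry_val_def del: tau_star.simps)
  qed
qed

lemma integrable_switch: "integrable M (\<lambda>\<omega>. if ts n \<omega> \<le> ereal T then 1 else 0 :: real)"
  by (intro integrable_const_bound[where B=1]) (auto simp del: tau_star.simps)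

lemma stage_bound:
  "c1 * (LINT \<omega>|M. stage_time \<theta> ts ds T n \<omega>) + c2 * (LINT \<omega>|M. (if ts (Suc n) \<omega> \<le> ereal T then 1 else 0))
    \<le> (LINT \<omega>|M. entry_val n \<omega>) - (LINT \<omega>|M. entry_val (Suc n) \<omega>)"
proof -
  have "c1 * (LINT \<omega>|M. stage_time \<theta> ts ds T n \<omega>) =
    (LINT \<omega>|M. U (sgn_at n \<omega> * Mp (ct n \<omega>) \<omega>) - U (sgn_at n \<omega> * Mp (ct (Suc n) \<omega>) \<omega>))"
    unfolding stage_identity
    by (rule Bochner_Integration.integral_diff[OF integrable_U_sgn[of n n] integrable_U_sgn[of n "Suc n"], symmetric])
  also have "\<dots> \<le> (LINT \<omega>|M. entry_val n \<omega> - entry_val (Suc n) \<omega> - c2 * (if ts (Suc n) \<omega> \<le> ereal T then 1 else 0))"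
    by (intro integral_mono stage_bound_pathwise Bochner_Integration.integrable_diff integrable_U_sgn integrable_entry_val
        integrable_mult_right integrable_switch)
  also have "\<dots> = (LINT \<omega>|M. entry_val n \<omega>) - (LINT \<omega>|M. entry_val (Suc n) \<omega>) - (LINT \<omega>|M. c2 * (if ts (Suc n) \<omega> \<le> ereal T then 1 else 0))"
    by (subst Bochner_Integration.integral_diff Bochner_Integration.integral_diff[OF integrable_entry_val integrable_entry_val];
        (intro Bochner_Integration.integrable_diff integrable_entry_val integrable_mult_right integrable_switch)?)+ simp
  finally show ?thesis by (simp del: tau_star.simps)
qed

text \<open>If the prior mean lies between the stopping boundaries, \<open>F0\<close> is stopped: at
  the boundary it equals \<open>U A\<close>, the entry value of the first stage, and at the horizon
  it is nonnegative. Otherwise the decision falls at time 0 and the entry value is already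
  \<open>V0\<close>.\<close>

lemma initial_bound: "c0 * (LINT \<omega>|M. ct 0 \<omega>) + (LINT \<omega>|M. entry_val 0 \<omega>) \<le> V0 (2 * p - 1)"
proof -
  have m0: "\<bar>2 * p - 1\<bar> < 1" using p01 by auto
  show ?thesis
  proof (cases "\<bar>2 * p - 1\<bar> < A")
    case True
    note os = optional_stopping[OF ts_stop[of 0] T, of 0 "- C" C0 0, folded F0_affine]
    have "(LINT \<omega>|M. entry_val 0 \<omega>) \<le> (LINT \<omega>|M. F0 (Mp (ct 0 \<omega>) \<omega>))"
    proof (rule integral_mono[OF integrable_entry_val os(1)])
      fix \<omega> assume w: "\<omega> \<in> space M"
      show "entry_val 0 \<omega> \<le> F0 (Mp (ct 0 \<omega>) \<omega>)"
      proof (cases "ts 0 \<omega> \<le> ereal T")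
        case le: True
        then obtain r where r: "ts 0 \<omega> = ereal r" "ct 0 \<omega> = r" using ts_realD[OF w] by metis
        have r': "tau0_star Mp A \<omega> = ereal r" using r by simp
        have abs: "\<bar>Mp r \<omega>\<bar> = A"
          using abs_at_tau0_star[OF Mp_cont[OF w] A(1) r'] True Mp_0[OF w] by simp
        have "A \<le> sgn_at 0 \<omega> * Mp r \<omega>" using d_star_tau0[OF Mp_cont[OF w] A(1) r'] by (simp add: sgn_at_def)
        moreover have "\<bar>sgn_at 0 \<omega> * Mp r \<omega>\<bar> = \<bar>Mp r \<omega>\<bar>" using sgn_at_vals[OF w, of 0] by auto
        ultimately have "sgn_at 0 \<omega> * Mp r \<omega> = A" using abs by simp
        moreover have "F0 (Mp r \<omega>) = F0 A" using F0_abs[OF Mp_abs[of r \<omega>]] abs by simp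
        ultimately show ?thesis using le r U_A by (simp add: entry_val_def)
      next
        case False
        then have lt: "ereal T < ts 0 \<omega>" by simp
        have "ct 0 \<omega> = T" using lt by (auto intro!: cap_ge less_imp_le)
        moreover have "\<bar>Mp T \<omega>\<bar> < A"
        proof (cases "tau0_star Mp A \<omega>")
          case (real r)
          then show ?thesis using tau0_star_attained(3)[OF Mp_cont[OF w] A(1) real, of T] lt T by simp
        next
          case PInf
          then show ?thesis using tau0_star_infinite[OF Mp_cont[OF w] A(1) PInf, of T] T by simp
        next
          case MInf
          then show ?thesis using lt by simp
        qed
        ultimately show ?thesis using False F0_nonneg[of "Mp T \<omega>"] by (simp add: entry_val_def)
      qed
    qed
    also have "\<dots> = F0 (2 * p - 1) + 2 * \<mu>\<^sup>2 * (LINT \<omega>|M. ct 0 \<omega> * (0 * \<theta> \<omega> + - C))" by (rule os(2))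
    also have "\<dots> = F0 (2 * p - 1) - (2 * \<mu>\<^sup>2 * C) * (LINT \<omega>|M. ct 0 \<omega>)" by simp
    finally show ?thesis unfolding C_\<mu> using V0_eq[OF m0] True by simp
  next
    case False
    have t0: "ts 0 \<omega> = 0" if w: "\<omega> \<in> space M" for \<omega>
    proof -
      have "tau0_star Mp A \<omega> \<le> ereal 0"
        unfolding tau0_star_def
        using hit_le_iff[where Y=Mp and \<omega>=\<omega> and \<sigma>="\<lambda>_. 0" and t=0, OF Mp_cont[OF w] closed_abs_ge[of A]] False Mp_0[OF w]
        by auto
      then show ?thesis using ts_nonneg[OF w, of 0] by (simp add: zero_ereal_def[symmetric])
    qed
    have "ct 0 \<omega> = 0" if "\<omega> \<in> space M" for \<omega> using t0[OF that] T by (simp add: cap_def)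
    then have "(LINT \<omega>|M. ct 0 \<omega>) = (LINT \<omega>|M. 0)" by (intro Bochner_Integration.integral_cong) auto
    moreover have "entry_val 0 \<omega> = U \<bar>2 * p - 1\<bar>" if w: "\<omega> \<in> space M" for \<omega>
    proof -
      have r': "tau0_star Mp A \<omega> = ereal 0" using t0[OF w] by (simp add: zero_ereal_def)
      have "A \<le> sgn_at 0 \<omega> * Mp 0 \<omega>" using d_star_tau0[OF Mp_cont[OF w] A(1) r'] by (simp add: sgn_at_def)
      then have "sgn_at 0 \<omega> * Mp 0 \<omega> = \<bar>2 * p - 1\<bar>" using sgn_at_vals[OF w, of 0] Mp_0[OF w] A by auto
      then show ?thesis using r' T \<open>\<omega> \<in> space M \<Longrightarrow> ct 0 \<omega> = 0\<close> w by (simp add: entry_val_def cap_def)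
    qed
    then have "(LINT \<omega>|M. entry_val 0 \<omega>) = (LINT \<omega>|M. U \<bar>2 * p - 1\<bar>)" by (intro Bochner_Integration.integral_cong) auto
    ultimately show ?thesis using V0_eq[OF m0] False by (simp add: prob_space)
  qed
qed

lemma stages_bound:
  "c0 * (LINT \<omega>|M. ct 0 \<omega>) + (\<Sum>n<N. c1 * (LINT \<omega>|M. stage_time \<theta> ts ds T n \<omega>)
     + c2 * (LINT \<omega>|M. (if ts (Suc n) \<omega> \<le> ereal T then 1 else 0))) \<le> V0 (2 * p - 1)"
proof -
  have "(\<Sum>n<N. c1 * (LINT \<omega>|M. stage_time \<theta> ts ds T n \<omega>) + c2 * (LINT \<omega>|M. (if ts (Suc n) \<omega> \<le> ereal T then 1 else 0)))
    \<le> (\<Sum>n<N. (LINT \<omega>|M. entry_val n \<omega>) - (LINT \<omega>|M. entry_val (Suc n) \<omega>))"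
    by (intro sum_mono stage_bound)
  also have "\<dots> = (LINT \<omega>|M. entry_val 0 \<omega>) - (LINT \<omega>|M. entry_val N \<omega>)"
    by (rule sum_lessThan_telescope')
  also have "\<dots> \<le> (LINT \<omega>|M. entry_val 0 \<omega>)"
    using entry_val_nonneg by (simp add: integral_nonneg_AE)
  finally show ?thesis using initial_bound by linarith
qed

lemma integrable_ct: "integrable M (ct n)"
proof (intro integrable_const_bound[where B=T] AE_I2)
  fix \<omega> assume w: "\<omega> \<in> space M"
  show "norm (ct n \<omega>) \<le> T"
    using cap_nonneg[OF ts_nonneg[OF w], of T n] cap_le[OF ts_nonneg[OF w], of T n] T by (simp del: tau_star.simps)
qed simp

end

lemma stage_cost_bound:
  assumes N: "0 < N"
  shows "integrable M (stage_cost \<theta> c0 c1 c2 ts ds N)" "(LINT \<omega>|M. stage_cost \<theta> c0 c1 c2 ts ds N \<omega>) \<le> V0 (2 * p - 1)"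
proof -
  have T: "0 < real N" using N by simp
  note i = integrable_ct[OF T, of 0] integrable_stage_time[OF T] integrable_switch[OF T]
  have is1: "integrable M (\<lambda>\<omega>. \<Sum>i<N. stage_time \<theta> ts ds (real N) i \<omega>)"
    by (intro Bochner_Integration.integrable_sum i)
  have is2: "integrable M (\<lambda>\<omega>. \<Sum>i<N. if ts (Suc i) \<omega> \<le> ereal (real N) then 1 else 0 :: real)"
    by (intro Bochner_Integration.integrable_sum i)
  show "integrable M (stage_cost \<theta> c0 c1 c2 ts ds N)"
    unfolding stage_cost_def[abs_def]
    by (intro Bochner_Integration.integrable_add integrable_mult_right i is1 is2)
  have "(LINT \<omega>|M. stage_cost \<theta> c0 c1 c2 ts ds N \<omega>) = c0 * (LINT \<omega>|M. cap (ts 0 \<omega>) (real N))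
    + c1 * (LINT \<omega>|M. (\<Sum>i<N. stage_time \<theta> ts ds (real N) i \<omega>))
    + c2 * (LINT \<omega>|M. (\<Sum>i<N. if ts (Suc i) \<omega> \<le> ereal (real N) then 1 else 0))"
    unfolding stage_cost_def using i(1) is1 is2 by (simp del: tau_star.simps)
  also have "(LINT \<omega>|M. (\<Sum>i<N. stage_time \<theta> ts ds (real N) i \<omega>)) = (\<Sum>i<N. (LINT \<omega>|M. stage_time \<theta> ts ds (real N) i \<omega>))"
    by (intro Bochner_Integration.integral_sum i)
  also have "(LINT \<omega>|M. (\<Sum>i<N. if ts (Suc i) \<omega> \<le> ereal (real N) then 1 else 0 :: real)) = (\<Sum>i<N. (LINT \<omega>|M. (if ts (Suc i) \<omega> \<le> ereal (real N) then 1 else 0)))"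
    by (intro Bochner_Integration.integral_sum i)
  finally show "(LINT \<omega>|M. stage_cost \<theta> c0 c1 c2 ts ds N \<omega>) \<le> V0 (2 * p - 1)"
    using stages_bound[OF T, of N] by (simp only: sum.distrib sum_distrib_left add.assoc)
qed

lemma risk_star_le: "risk M \<theta> c0 c1 c2 ts ds \<le> ennreal (V0 (2 * p - 1))"
proof -
  \<comment> \<open>The index is shifted because the stage bounds require a positive
    horizon.\<close>
  let ?S = "\<lambda>N \<omega>. ennreal (stage_cost \<theta> c0 c1 c2 ts ds (Suc N) \<omega>)"
  have path: "path_cost \<theta> c0 c1 c2 ts ds \<omega> \<le> (SUP N. ?S N \<omega>) \<and> incseq (\<lambda>N. ?S N \<omega>)" if w: "\<omega> \<in> space M" for \<omega>
  proof -
    note h = ts_mono[OF w] ts_nonneg[OF w, of 0] c0 c1 c2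
    have inc: "incseq (\<lambda>N. stage_cost \<theta> c0 c1 c2 ts ds N \<omega>)" by (rule incseq_stage_cost[where \<tau>=ts and \<omega>=\<omega>, OF h])
    have "path_cost \<theta> c0 c1 c2 ts ds \<omega> \<le> (SUP N. ennreal (stage_cost \<theta> c0 c1 c2 ts ds N \<omega>))"
      by (rule path_cost_le_SUP_stage_cost[where \<tau>=ts and \<omega>=\<omega>, OF h])
    also have "\<dots> \<le> (SUP N. ?S N \<omega>)"
      using inc by (intro SUP_mono) (auto simp: incseq_Suc_iff intro!: ennreal_leI)
    finally show ?thesis using inc by (auto simp: incseq_Suc_iff intro!: ennreal_leI)
  qed
  have m: "stage_cost \<theta> c0 c1 c2 ts ds (Suc N) \<in> borel_measurable M" for N
    using stage_cost_bound(1)[of "Suc N"] by simp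
  have "risk M \<theta> c0 c1 c2 ts ds \<le> (\<integral>\<^sup>+\<omega>. (SUP N. ?S N \<omega>) \<partial>M)"
    unfolding risk_eq using path by (intro nn_integral_mono) blast
  also have "\<dots> = (SUP N. \<integral>\<^sup>+\<omega>. ?S N \<omega> \<partial>M)"
    using path m by (intro nn_integral_monotone_convergence_SUP_AE) (auto simp: incseq_Suc_iff intro!: AE_I2)
  also have "\<dots> \<le> ennreal (V0 (2 * p - 1))"
  proof (rule SUP_least)
    fix N
    have "(\<integral>\<^sup>+\<omega>. ?S N \<omega> \<partial>M) = ennreal (LINT \<omega>|M. stage_cost \<theta> c0 c1 c2 ts ds (Suc N) \<omega>)"
      using stage_cost_bound(1)[of "Suc N"] stage_cost_nonneg[where \<tau>=ts, OF ts_mono ts_nonneg c0 c1 c2]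
      by (intro nn_integral_eq_integral) auto
    also have "\<dots> \<le> ennreal (V0 (2 * p - 1))" using stage_cost_bound(2)[of "Suc N"] by (intro ennreal_leI) simp
    finally show "(\<integral>\<^sup>+\<omega>. ?S N \<omega> \<partial>M) \<le> ennreal (V0 (2 * p - 1))" .
  qed
  finally show ?thesis .
qed

end

context observed_BM
begin

lemma posterior_adapted: "0 \<le> t \<Longrightarrow> posterior p \<mu> X t \<in> borel_measurable (Fm t)"
  unfolding posterior_def[abs_def] using X_adapted[of t] by measurable

lemma posterior_cont: "\<omega> \<in> space M \<Longrightarrow> continuous_on {0..} (\<lambda>t. posterior p \<mu> X t \<omega>)"
proof -
  assume w: "\<omega> \<in> space M"
  have "p * exp x + 1 - p \<noteq> 0" for x
  proof (cases "p = 0")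
    case False
    then have "0 < p * exp x" "0 \<le> 1 - p" using p_bounds by auto
    then show ?thesis by linarith
  qed simp
  then show ?thesis unfolding posterior_def by (intro continuous_intros X_cont w) auto
qed

text \<open>If \<open>p\<close> is 0 or 1, the posterior mean is constant and the candidate rule announces the almost sure
  value of \<open>\<theta>\<close> at time 0.\<close>

lemma risk_star_degenerate:
  assumes p: "p = 0 \<or> p = 1" and c: "c0 > 0" "c1 > 0" "c2 > 0" and A: "0 < A" "A < 1" and B: "0 < B"
  shows "risk M \<theta> c0 c1 c2 (tau_star (posterior p \<mu> X) A B) (d_star (posterior p \<mu> X) A) = 0"
proof -
  let ?Y = "posterior p \<mu> X"
  define j :: real where "j = 2 * p - 1"
  have j: "j \<in> {-1, 1}" using p by (auto simp: j_def)
  have Y: "?Y t \<omega> = j" for t \<omega> using p by (auto simp: posterior_def j_def)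
  have rule: "decision_rule M (FX M X) (tau_star ?Y A B) (d_star ?Y A)"
    by (rule decision_rule_star[OF posterior_adapted posterior_cont A(1)])
  have t0: "tau0_star ?Y A \<omega> = 0" for \<omega>
  proof (rule antisym)
    show "tau0_star ?Y A \<omega> \<le> 0"
      unfolding tau0_star_def hit_def using A j by (intro Inf_lower) (auto simp: Y zero_ereal_def intro!: exI[of _ 0])
    show "0 \<le> tau0_star ?Y A \<omega>" unfolding tau0_star_def by (rule hit_nonneg)
  qed
  have d: "d_star ?Y A \<omega> = j" for \<omega> using j by (auto simp: d_star_def t0 Y)
  have never: "hit ?Y S \<sigma> \<omega> = \<infinity>" if "j \<notin> S" for S \<sigma> \<omega>
    unfolding hit_def Y using that by (simp add: top_ereal_def)
  have tS: "tau_star ?Y A B (Suc n) \<omega> = \<infinity>" for n \<omega>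
  proof (induction n)
    case 0
    show ?case unfolding tau_star.simps(2) d using j B by (cases "j = 1") (simp_all add: never)
  next
    case (Suc n)
    have "hit ?Y S (tau_star ?Y A B (Suc n)) \<omega> = \<infinity>" for S :: "real set"
      unfolding hit_def Suc by (simp add: top_ereal_def)
    then show ?case by (subst tau_star.simps(2)) simp
  qed
  have "AE \<omega> in M. \<omega> \<in> hyp j"
    using p p_def prob_hyp_minus by (intro AE_prob_1) (auto simp: j_def)
  then have "AE \<omega> in M. path_cost \<theta> c0 c1 c2 (tau_star ?Y A B) (d_star ?Y A) \<omega> = 0"
  proof eventually_elim
    case (elim \<omega>)
    then have w: "\<omega> \<in> space M" and th: "\<theta> \<omega> = j" by auto
    have "stage_time \<theta> (tau_star ?Y A B) (d_star ?Y A) T i \<omega> = 0" for T i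
      using th by (cases i) (auto simp: stage_time_def d tS simp del: tau_star.simps)
    then have "stage_cost \<theta> c0 c1 c2 (tau_star ?Y A B) (d_star ?Y A) N \<omega> = 0" for N
      unfolding stage_cost_def tS by (simp add: t0 cap_def)
    moreover have "path_cost \<theta> c0 c1 c2 (tau_star ?Y A B) (d_star ?Y A) \<omega>
      \<le> (SUP N. ennreal (stage_cost \<theta> c0 c1 c2 (tau_star ?Y A B) (d_star ?Y A) N \<omega>))"
      using rule w unfolding decision_rule_def stopping_time_ext_def
      by (intro path_cost_le_SUP_stage_cost c) (auto simp del: tau_star.simps)
    ultimately show ?case by simp
  qed
  then have "(\<integral>\<^sup>+\<omega>. path_cost \<theta> c0 c1 c2 (tau_star ?Y A B) (d_star ?Y A) \<omega> \<partial>M) = (\<integral>\<^sup>+\<omega>. 0 \<partial>M)"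
    by (rule nn_integral_cong_AE)
  then show ?thesis by (simp add: risk_eq)
qed

end

theorem theorem1:
  fixes M :: "'a measure" and W :: "real \<Rightarrow> 'a \<Rightarrow> real" and \<theta> :: "'a \<Rightarrow> real"
    and \<mu> c0 c1 c2 p A B :: real
  assumes "prob_space M" and "complete_measure M"
    and "std_BM M W"
    and "\<theta> \<in> borel_measurable M" and "\<forall>\<omega>\<in>space M. \<theta> \<omega> \<in> {-1, 1}"
    and "prob_space.indep_set M (gen_events1 M \<theta>) (gen_events M W {0..})"
    and "p = measure M {\<omega>\<in>space M. \<theta> \<omega> = 1}"
    and "\<mu> > 0" and "c0 > 0" and "c1 > 0" and "c2 > 0"
    and "0 < B" and "B < 1"
    and "ln ((1 - B) / (1 + B)) + 2 * B / (1 - B\<^sup>2) = 2 * \<mu>\<^sup>2 * c2 / c1"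
    and "0 < A" and "A < 1"
    and "(c1 / (2 * c0) - 1) * ln ((1 - A) / (1 + A)) + 2 / (1 + A) * (c1 / (2 * c0) + A / (1 - A))
           = c1 / (c0 * (1 - B\<^sup>2))"
  defines "X \<equiv> (\<lambda>t \<omega>. \<mu> * \<theta> \<omega> * t + W t \<omega>)"
  defines "Mp \<equiv> posterior p \<mu> X"
  shows "decision_rule M (FX M X) (tau_star Mp A B) (d_star Mp A)
    \<and> risk M \<theta> c0 c1 c2 (tau_star Mp A B) (d_star Mp A)
        = (INF \<delta>\<in>{(\<tau>, d). decision_rule M (FX M X) \<tau> d}. risk M \<theta> c0 c1 c2 (fst \<delta>) (snd \<delta>))"
proof -
  interpret O: observed_BM M W \<theta> \<mu> p
    using assms(1-8) unfolding observed_BM_def observed_BM_axioms_def by auto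
  have X: "X = O.X" unfolding X_def O.X_def ..
  have rule: "decision_rule M (FX M X) (tau_star Mp A B) (d_star Mp A)"
    unfolding Mp_def X by (rule O.decision_rule_star[OF O.posterior_adapted O.posterior_cont \<open>0 < A\<close>])
  have le: "risk M \<theta> c0 c1 c2 (tau_star Mp A B) (d_star Mp A) \<le> risk M \<theta> c0 c1 c2 \<tau> d"
    if \<delta>: "decision_rule M (FX M X) \<tau> d" for \<tau> d
  proof (cases "p = 0 \<or> p = 1")
    case True
    then show ?thesis
      unfolding Mp_def X
      by (simp add: O.risk_star_degenerate[OF True \<open>c0 > 0\<close> \<open>c1 > 0\<close> \<open>c2 > 0\<close> \<open>0 < A\<close> \<open>A < 1\<close> \<open>0 < B\<close>])
  next
    case False
    then have "0 < p" "p < 1" using O.p_bounds by auto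
    then interpret P: testing_problem M W \<theta> \<mu> p c0 c1 c2 A B
      by unfold_locales (use assms in auto)
    have "Mp = P.Mp" unfolding Mp_def X P.Mp_def ..
    then show ?thesis
      using order.trans[OF P.risk_star_le P.risk_lower_bound[OF \<delta>[unfolded X]]] by simp
  qed
  have "risk M \<theta> c0 c1 c2 (tau_star Mp A B) (d_star Mp A)
        = (INF \<delta>\<in>{(\<tau>, d). decision_rule M (FX M X) \<tau> d}. risk M \<theta> c0 c1 c2 (fst \<delta>) (snd \<delta>))"
  proof (rule antisym)
    show "risk M \<theta> c0 c1 c2 (tau_star Mp A B) (d_star Mp A)
        \<le> (INF \<delta>\<in>{(\<tau>, d). decision_rule M (FX M X) \<tau> d}. risk M \<theta> c0 c1 c2 (fst \<delta>) (snd \<delta>))"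
      by (rule INF_greatest) (auto intro: le)
    show "(INF \<delta>\<in>{(\<tau>, d). decision_rule M (FX M X) \<tau> d}. risk M \<theta> c0 c1 c2 (fst \<delta>) (snd \<delta>))
        \<le> risk M \<theta> c0 c1 c2 (tau_star Mp A B) (d_star Mp A)"
      using rule by (intro INF_lower2[where i="(tau_star Mp A B, d_star Mp A)"]) auto
  qed
  with rule show ?thesis by blast
qed

end
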